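(* For every fixed integer $d\ge 1$ and every fixed $k\le 5$ (with $k\ge 3$), there is a deterministic algorithm that, given a $d$-degenerated graph $G$ on $n$ vertices, finds an induced cycle of length $k$ in $G$ (if one exists) in time $O(n)$.
   Context: All graphs are finite, undirected and simple. A graph $G$ is $d$-degenerated if every induced subgraph of $G$ has a vertex of degree at most $d$. An induced cycle of length $k$ is a set of $k$ vertices whose induced subgraph is a cycle $C_k$. The constant in $O(n)$ may depend on $d$ and $k$. *)

theory Defs
  imports "Graph_Theory.Graph_Theory" "HOL-Library.Landau_Symbols"
begin

section \<open>Graphs\<close>

text \<open>
  A finite simple undirected graph is a \<open>pair_graph\<close>: every edge is represented by its two arcs,
  so the degree of a vertex is its out-degree.
\<close>

definition degenerated :: "nat \<Rightarrow> 'a pair_pre_digraph \<Rightarrow> bool" where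
  "degenerated d G \<longleftrightarrow>
     (\<forall>S \<subseteq> pverts G. S \<noteq> {} \<longrightarrow> (\<exists>v \<in> S. out_degree (with_proj G \<restriction> S) v \<le> d))"

definition cycle_graph :: "nat \<Rightarrow> nat pair_pre_digraph" where
  "cycle_graph k = \<lparr> pverts = {..<k},
     parcs = (\<Union>i<k. {(i, (i + 1) mod k), ((i + 1) mod k, i)}) \<rparr>"

lemma pair_graph_cycle_graph:
  assumes "2 \<le> k"
  shows "pair_graph (cycle_graph k)"
proof -
  have "Suc i mod k \<noteq> i" if "i < k" for i
    using assms that by (cases "Suc i = k") auto
  note neq = this this[symmetric]
  show ?thesis
  proof unfold_locales
    show "symmetric (with_proj (cycle_graph k))"
      unfolding symmetric_def sym_def with_proj_simps cycle_graph_def by force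
  qed (use assms neq in \<open>auto simp: cycle_graph_def\<close>)
qed

definition induced_cycle :: "nat \<Rightarrow> 'a pair_pre_digraph \<Rightarrow> 'a set \<Rightarrow> bool" where
  "induced_cycle k G S \<longleftrightarrow>
     S \<subseteq> pverts G \<and> card S = k \<and> digraph_iso (with_proj G \<restriction> S) (with_proj (cycle_graph k))"


section \<open>A unit-cost word RAM\<close>

text \<open>
  Programs use scalar registers and random-access arrays of natural numbers, both named by
  numbers. The names are part of the program text, so a program uses only finitely many of them.
  Evaluating each node of an expression and executing each command node costs one unit.
\<close>

record state =
  reg :: "nat \<Rightarrow> nat"
  arr :: "nat \<Rightarrow> nat \<Rightarrow> nat"

datatype binop = Add | Sub | Mul | Less | Equal

datatype exp =
    Const nat
  | Reg nat
  | Load nat exp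
  | Bin binop exp exp

datatype com =
    Skip
  | Assign nat exp
  | Store nat exp exp
  | Seq com com
  | Cond exp com com
  | While exp com

fun binop_val :: "binop \<Rightarrow> nat \<Rightarrow> nat \<Rightarrow> nat" where
  "binop_val Add x y = x + y"
| "binop_val Sub x y = x - y"
| "binop_val Mul x y = x * y"
| "binop_val Less x y = (if x < y then 1 else 0)"
| "binop_val Equal x y = (if x = y then 1 else 0)"

fun val :: "state \<Rightarrow> exp \<Rightarrow> nat" where
  "val s (Const c) = c"
| "val s (Reg x) = reg s x"
| "val s (Load a i) = arr s a (val s i)"
| "val s (Bin f e1 e2) = binop_val f (val s e1) (val s e2)"

text \<open>Every value (and hence every address) arising in an evaluation must fit in a machine word.\<close>

fun fits :: "nat \<Rightarrow> state \<Rightarrow> exp \<Rightarrow> bool" where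
  "fits W s (Const c) \<longleftrightarrow> c < W"
| "fits W s (Reg x) \<longleftrightarrow> reg s x < W"
| "fits W s (Load a i) \<longleftrightarrow> fits W s i \<and> arr s a (val s i) < W"
| "fits W s (Bin f e1 e2) \<longleftrightarrow>
     fits W s e1 \<and> fits W s e2 \<and> binop_val f (val s e1) (val s e2) < W"

fun cost :: "exp \<Rightarrow> nat" where
  "cost (Const c) = 1"
| "cost (Reg x) = 1"
| "cost (Load a i) = cost i + 1"
| "cost (Bin f e1 e2) = cost e1 + cost e2 + 1"

text \<open>
  \<open>exec W p s t s'\<close>: with words ranging over \<open>{..<W}\<close>, program \<open>p\<close> started in \<open>s\<close> halts in
  \<open>s'\<close> after exactly \<open>t\<close> steps. A run that produces a value not fitting in a word is stuck, so
  it is not related to any final state.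
\<close>

inductive exec :: "nat \<Rightarrow> com \<Rightarrow> state \<Rightarrow> nat \<Rightarrow> state \<Rightarrow> bool" for W where
  Skip: "exec W Skip s 1 s"
| Assign: "fits W s e \<Longrightarrow>
    exec W (Assign x e) s (cost e + 1) (s\<lparr>reg := (reg s)(x := val s e)\<rparr>)"
| Store: "fits W s i \<Longrightarrow> fits W s e \<Longrightarrow>
    exec W (Store a i e) s (cost i + cost e + 1)
      (s\<lparr>arr := (arr s)(a := (arr s a)(val s i := val s e))\<rparr>)"
| Seq: "exec W p s t s' \<Longrightarrow> exec W q s' u s'' \<Longrightarrow> exec W (Seq p q) s (t + u + 1) s''"
| CondTrue: "fits W s e \<Longrightarrow> val s e \<noteq> 0 \<Longrightarrow> exec W p s t s' \<Longrightarrow>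
    exec W (Cond e p q) s (cost e + t + 1) s'"
| CondFalse: "fits W s e \<Longrightarrow> val s e = 0 \<Longrightarrow> exec W q s t s' \<Longrightarrow>
    exec W (Cond e p q) s (cost e + t + 1) s'"
| WhileFalse: "fits W s e \<Longrightarrow> val s e = 0 \<Longrightarrow> exec W (While e p) s (cost e + 1) s"
| WhileTrue: "fits W s e \<Longrightarrow> val s e \<noteq> 0 \<Longrightarrow> exec W p s t s' \<Longrightarrow>
    exec W (While e p) s' u s'' \<Longrightarrow> exec W (While e p) s (cost e + t + u + 1) s''"

inductive_cases exec_elims:
  "exec W Skip s t s'"
  "exec W (Assign x e) s t s'"
  "exec W (Store a i e) s t s'"
  "exec W (Seq p q) s t s'"
  "exec W (Cond e p q) s t s'"
  "exec W (While e p) s t s'"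

lemma exec_deterministic:
  "exec W p s t s' \<Longrightarrow> exec W p s u s'' \<Longrightarrow> t = u \<and> s' = s''"
proof (induction arbitrary: u s'' rule: exec.induct)
  case Skip
  then show ?case by (elim exec_elims) simp
next
  case Assign
  from Assign.prems show ?case by (elim exec_elims) simp
next
  case Store
  from Store.prems show ?case by (elim exec_elims) simp
next
  case (Seq p s t s' q v s1)
  from Seq.prems obtain t2 s2 v2
    where *: "u = Suc (t2 + v2)" "exec W p s t2 s2" "exec W q s2 v2 s''"
    by (rule exec_elims(4))
  from Seq.IH(1)[OF *(2)] have eq: "t = t2" "s' = s2" by auto
  with Seq.IH(2) *(3) have "v = v2 \<and> s1 = s''" by simp
  with eq *(1) show ?case by simp
next
  case (CondTrue s e p t s' q)
  from CondTrue.prems CondTrue.hyps obtain t2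
    where *: "u = Suc (cost e + t2)" "exec W p s t2 s''"
    by (elim exec_elims(5)) simp_all
  from CondTrue.IH[OF *(2)] *(1) show ?case by simp
next
  case (CondFalse s e q t s' p)
  from CondFalse.prems CondFalse.hyps obtain t2
    where *: "u = Suc (cost e + t2)" "exec W q s t2 s''"
    by (elim exec_elims(5)) simp_all
  from CondFalse.IH[OF *(2)] *(1) show ?case by simp
next
  case (WhileFalse s e p)
  from WhileFalse.prems show ?case
    by (rule exec_elims(6)) (use WhileFalse.hyps in simp_all)
next
  case (WhileTrue s e p t s' v s1)
  obtain t2 s2 v2
    where *: "u = Suc (cost e + t2 + v2)" "exec W p s t2 s2" "exec W (While e p) s2 v2 s''"
    by (rule exec_elims(6)[OF WhileTrue.prems]) (use WhileTrue.hyps in simp_all)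
  from WhileTrue.IH(1)[OF *(2)] have eq: "t = t2" "s' = s2" by auto
  with WhileTrue.IH(2) *(3) have "v = v2 \<and> s1 = s''" by simp
  with eq *(1) show ?case by simp
qed

section \<open>Input and output\<close>

text \<open>
  \<open>L ! v\<close> lists the neighbours of \<open>v\<close>, in any order and without repetition; the vertices are
  \<open>0, \<dots>, length L - 1\<close>.
\<close>

definition adjacency_lists :: "nat list list \<Rightarrow> nat pair_pre_digraph \<Rightarrow> bool" where
  "adjacency_lists L G \<longleftrightarrow>
     pverts G = {..<length L} \<and>
     (\<forall>v < length L. distinct (L ! v) \<and> set (L ! v) = {w. (v, w) \<in> parcs G})"

text \<open>
  Register 0 holds the number of vertices, array 1 the concatenation of the adjacency lists, and
  array 0 the offsets into it: the list of \<open>v\<close> occupies the positions from \<open>arr s 0 v\<close>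
  (inclusive) to \<open>arr s 0 (v + 1)\<close> (exclusive). All other cells are 0.
\<close>

definition input_state :: "nat list list \<Rightarrow> state" where
  "input_state L = \<lparr>
     reg = (\<lambda>_. 0)(0 := length L),
     arr = (\<lambda>_ _. 0)
       (0 := (\<lambda>v. if v \<le> length L then length (concat (take v L)) else 0),
        1 := (\<lambda>j. if j < length (concat L) then concat L ! j else 0)) \<rparr>"

text \<open>
  Register 0 tells whether an induced cycle was found; if so, the first \<open>k\<close> cells of array 0
  contain its vertices.
\<close>

definition finds_induced_cycle :: "nat \<Rightarrow> nat pair_pre_digraph \<Rightarrow> state \<Rightarrow> bool" where
  "finds_induced_cycle k G s \<longleftrightarrow>
     (if \<exists>S. induced_cycle k G S
      then reg s 0 = 1 \<and> induced_cycle k G (arr s 0 ` {..<k})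
      else reg s 0 = 0)"

end

theory Submission
  imports Defs
begin

text \<open>
  Repeatedly removing a vertex of degree at most \<open>d\<close> orients the edges acyclically with
  out-degree at most \<open>d\<close>. In an induced cycle of length at most 5 one can choose a vertex \<open>s\<close>,
  preceding both of its neighbours \<open>t1\<close> and \<open>t2\<close> on the cycle, such that the path formed by the
  remaining vertices can be reached by at most three forward steps from a single vertex \<open>v\<close>. So
  there are only boundedly many paths to try for each \<open>v\<close>, and for each of them it remains to
  decide whether a suitable \<open>s\<close> exists. The vertices preceding \<open>t1\<close> and \<open>t2\<close> but none of the at
  most two inner vertices of the path are counted by inclusion-exclusion from a table that stores
  for all \<open>a, b, c, e\<close> how many vertices precede all four of them. Those among them which are
  adjacent to an inner vertex must be successors of it, hence are boundedly many and can be
  subtracted. Once a path has passed this test, a single scan finds \<open>s\<close>.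

  The tables live in arrays with polynomially many cells, which are initially 0, so they need not
  be cleared. The loops over slots and over paths have constant length and are unrolled
  in the program text.
\<close>

section \<open>Execution of loop-free programs and of loops\<close>

text \<open>The obstacle is that only out-degrees are bounded. Two vertices may have linearly many
  common predecessors, so looking for \<open>s\<close> separately for each path would cost quadratic
  time. Counting avoids this: every vertex contributes to at most \<open>d ^ 4\<close> table
  entries, and a test reads only four of them. For this table to see \<open>s\<close>, it has to
  precede both \<open>t1\<close> and \<open>t2\<close>; four indices suffice because the path has at
  most two inner vertices. Length 5 is where the scheme ends: a hexagon whose edges alternate in
  direction has three sources, and deleting one of them leaves a path that no single vertex of it
  reaches by forward steps along the path. The word size has to be a fixed power of
  \<open>n + 2\<close>, and a run gets stuck on overflow. Hence every loop invariant keeps all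
  stored values at most \<open>X\<close>, a bound polynomial in \<open>n\<close>, while the values
  arising within one round, table addresses among them, are at most a power of \<open>X\<close>
  whose exponent is determined by the program text.\<close>

primrec run :: "com \<Rightarrow> state \<Rightarrow> state" where
  "run Skip s = s"
| "run (Assign x e) s = s\<lparr>reg := (reg s)(x := val s e)\<rparr>"
| "run (Store a i e) s = s\<lparr>arr := (arr s)(a := (arr s a)(val s i := val s e))\<rparr>"
| "run (Seq p q) s = run q (run p s)"
| "run (Cond e p q) s = (if val s e \<noteq> 0 then run p s else run q s)"
| "run (While e p) s = s"

text \<open>The programs on which \<open>run\<close> describes the effect of \<open>exec\<close>;
  its equation for \<open>While\<close> is a default.\<close>

primrec loopfree :: "com \<Rightarrow> bool" where
  "loopfree Skip = True"
| "loopfree (Assign x e) = True"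
| "loopfree (Store a i e) = True"
| "loopfree (Seq p q) = (loopfree p \<and> loopfree q)"
| "loopfree (Cond e p q) = (loopfree p \<and> loopfree q)"
| "loopfree (While e p) = False"

text \<open>An upper bound rather than the exact time: both branches of a \<open>Cond\<close> are
  charged, and a \<open>While\<close> is charged for a single round, to be multiplied by the number
  of rounds in \<open>exec_while\<close>.\<close>

primrec ccost :: "com \<Rightarrow> nat" where
  "ccost Skip = 1"
| "ccost (Assign x e) = cost e + 1"
| "ccost (Store a i e) = cost i + cost e + 1"
| "ccost (Seq p q) = ccost p + ccost q + 1"
| "ccost (Cond e p q) = cost e + ccost p + ccost q + 1"
| "ccost (While e p) = cost e + ccost p + 1"

text \<open>If all values are at most \<open>X\<close>, those arising in a run of \<open>c\<close> are at most \<open>X ^ growth c\<close>.\<close>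

primrec growth :: "com \<Rightarrow> nat" where
  "growth Skip = 1"
| "growth (Assign x e) = cost e"
| "growth (Store a i e) = cost i + cost e"
| "growth (Seq p q) = growth p * growth q"
| "growth (Cond e p q) = cost e * growth p * growth q"
| "growth (While e p) = cost e * growth p"

primrec exp_consts_le :: "nat \<Rightarrow> exp \<Rightarrow> bool" where
  "exp_consts_le X (Const c) = (c \<le> X)"
| "exp_consts_le X (Reg x) = True"
| "exp_consts_le X (Load a i) = exp_consts_le X i"
| "exp_consts_le X (Bin f e1 e2) = (exp_consts_le X e1 \<and> exp_consts_le X e2)"

primrec consts_le :: "nat \<Rightarrow> com \<Rightarrow> bool" where
  "consts_le X Skip = True"
| "consts_le X (Assign x e) = exp_consts_le X e"
| "consts_le X (Store a i e) = (exp_consts_le X i \<and> exp_consts_le X e)"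
| "consts_le X (Seq p q) = (consts_le X p \<and> consts_le X q)"
| "consts_le X (Cond e p q) = (exp_consts_le X e \<and> consts_le X p \<and> consts_le X q)"
| "consts_le X (While e p) = (exp_consts_le X e \<and> consts_le X p)"

primrec written_regs :: "com \<Rightarrow> nat set" where
  "written_regs Skip = {}"
| "written_regs (Assign x e) = {x}"
| "written_regs (Store a i e) = {}"
| "written_regs (Seq p q) = written_regs p \<union> written_regs q"
| "written_regs (Cond e p q) = written_regs p \<union> written_regs q"
| "written_regs (While e p) = written_regs p"

primrec written_arrs :: "com \<Rightarrow> nat set" where
  "written_arrs Skip = {}"
| "written_arrs (Assign x e) = {}"
| "written_arrs (Store a i e) = {a}"
| "written_arrs (Seq p q) = written_arrs p \<union> written_arrs q"
| "written_arrs (Cond e p q) = written_arrs p \<union> written_arrs q"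
| "written_arrs (While e p) = written_arrs p"

section \<open>Value bounds and frame conditions\<close>

definition bounded :: "nat \<Rightarrow> state \<Rightarrow> bool" where
  "bounded X s \<longleftrightarrow> (\<forall>x. reg s x \<le> X) \<and> (\<forall>a i. arr s a i \<le> X)"

definition frame :: "com \<Rightarrow> state \<Rightarrow> state \<Rightarrow> bool" where
  "frame c s0 s \<longleftrightarrow> (\<forall>x. x \<notin> written_regs c \<longrightarrow> reg s x = reg s0 x) \<and>
     (\<forall>a. a \<notin> written_arrs c \<longrightarrow> arr s a = arr s0 a)"

lemma frame_reg: "frame c s0 s \<Longrightarrow> x \<notin> written_regs c \<Longrightarrow> reg s x = reg s0 x"
  and frame_arr: "frame c s0 s \<Longrightarrow> a \<notin> written_arrs c \<Longrightarrow> arr s a = arr s0 a"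
  by (auto simp: frame_def)

lemma frame_refl: "frame c s s"
  by (simp add: frame_def)

lemma frame_run: "frame c s0 s \<Longrightarrow> frame c s0 (run c s)"
proof -
  have "written_regs c \<subseteq> R \<Longrightarrow> written_arrs c \<subseteq> A \<Longrightarrow>
      (\<forall>x. x \<notin> R \<longrightarrow> reg (run c s) x = reg s x) \<and> (\<forall>a. a \<notin> A \<longrightarrow> arr (run c s) a = arr s a)"
    for R A
    by (induction c arbitrary: s) (auto simp: fun_upd_def)
  from this[of "written_regs c" "written_arrs c"] show "frame c s0 s \<Longrightarrow> frame c s0 (run c s)"
    by (auto simp: frame_def)
qed

lemma cost_pos: "1 \<le> cost e"
  by (induction e) auto

lemma growth_pos: "1 \<le> growth c"
  by (induction c) (use cost_pos in \<open>auto simp: Suc_le_eq intro: add_pos_pos\<close>)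

text \<open>Two numbers that are at least 2 have a sum bounded by their product. Hence addition asks
  for no larger exponent than multiplication.\<close>

lemma add_le_power:
  fixes x y X :: nat
  assumes "x \<le> X ^ a" "y \<le> X ^ b" "1 \<le> a" "1 \<le> b" "2 \<le> X"
  shows "x + y \<le> X ^ (a + b)"
proof -
  have "2 \<le> X ^ a" "2 \<le> X ^ b"
    using assms self_le_power[of X a] self_le_power[of X b] by auto
  then obtain p q where "X ^ a = p + 2" "X ^ b = q + 2"
    by (metis add.commute le_Suc_ex)
  then have "X ^ a + X ^ b \<le> X ^ a * X ^ b"
    by (simp add: algebra_simps)
  then show ?thesis
    using assms by (simp add: power_add)
qed

text \<open>A leaf or a loaded cell is at most \<open>X\<close>, and no operation exceeds the
  product of the powers that bound its operands, so the number of nodes can serve as exponent.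
  Subexpressions have smaller exponents and therefore fit as well.\<close>

lemma val_le_fits:
  assumes "bounded X s" "2 \<le> X" "exp_consts_le X e" "X ^ cost e < W"
  shows "val s e \<le> X ^ cost e \<and> fits W s e"
  using assms(3,4)
proof (induction e)
  case (Load a i)
  have "X ^ cost i \<le> X ^ cost (Load a i)" "X ^ 1 \<le> X ^ cost (Load a i)"
    using assms(2) by (intro power_increasing; simp)+
  moreover have "arr s a (val s i) \<le> X ^ 1"
    using assms(1) by (simp add: bounded_def)
  ultimately have "arr s a (val s i) \<le> X ^ cost (Load a i)" "X ^ cost i < W"
    using Load.prems by (linarith | simp)+
  with Load show ?case
    by (auto intro: order.strict_trans1)
next
  case (Bin f e1 e2)
  have le: "X ^ cost e1 \<le> X ^ cost (Bin f e1 e2)" "X ^ cost e2 \<le> X ^ cost (Bin f e1 e2)"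
    "X ^ (cost e1 + cost e2) \<le> X ^ cost (Bin f e1 e2)"
    using assms(2) by (intro power_increasing; simp)+
  have one: "1 \<le> X ^ cost (Bin f e1 e2)"
    using assms(2) by (intro one_le_power) simp
  from le Bin have IH: "val s e1 \<le> X ^ cost e1" "fits W s e1" "val s e2 \<le> X ^ cost e2" "fits W s e2"
    by (meson exp_consts_le.simps order.strict_trans1)+
  have "binop_val f (val s e1) (val s e2) \<le> X ^ cost (Bin f e1 e2)"
  proof (cases f)
    case Add
    then show ?thesis
      using order.trans[OF add_le_power[OF IH(1,3) cost_pos cost_pos assms(2)] le(3)]
      by (simp del: cost.simps)
  next
    case Mul
    then show ?thesis
      using order.trans[OF mult_le_mono[OF IH(1,3), folded power_add] le(3)]
      by (simp del: cost.simps)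
  next
    case Sub
    then show ?thesis
      using IH(1) le(1) by simp
  qed (use one in \<open>simp_all del: cost.simps\<close>)
  with IH Bin.prems(2) show ?case by (simp del: cost.simps)
qed (use assms in \<open>auto simp: bounded_def intro: order.strict_trans1\<close>)

lemma bounded_mono: "bounded X s \<Longrightarrow> X \<le> Y \<Longrightarrow> bounded Y s"
  unfolding bounded_def by (meson order.trans)

lemma exp_consts_le_mono: "exp_consts_le X e \<Longrightarrow> X \<le> Y \<Longrightarrow> exp_consts_le Y e"
  by (induction e) auto

lemma consts_le_mono: "consts_le X c \<Longrightarrow> X \<le> Y \<Longrightarrow> consts_le Y c"
  by (induction c) (auto intro: exp_consts_le_mono)

text \<open>The bound reached by the first command of a \<open>Seq\<close> plays the role of
  \<open>X\<close> for the second; this is why \<open>growth\<close> multiplies there.\<close>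

lemma exec_loopfree:
  assumes "loopfree c" "bounded X s" "2 \<le> X" "consts_le X c" "X ^ growth c < W"
  shows "bounded (X ^ growth c) (run c s) \<and> (\<exists>t \<le> ccost c. exec W c s t (run c s))"
  using assms
proof (induction c arbitrary: s X)
  case Skip
  then show ?case using exec.Skip[of W s] by auto
next
  case (Assign x e)
  have X: "X \<le> X ^ cost e"
    using Assign.prems cost_pos[of e] by (intro self_le_power) auto
  from Assign val_le_fits have *: "val s e \<le> X ^ cost e" "fits W s e" by simp_all
  from bounded_mono[OF Assign.prems(2) X] *(1) have "bounded (X ^ cost e) (run (Assign x e) s)"
    by (simp add: bounded_def)
  with exec.Assign[OF *(2), of x] show ?case
    by (intro conjI exI[of _ "cost e + 1"]) simp_all
next
  case (Store a i e)
  have X: "X ^ 1 \<le> X ^ (cost i + cost e)" "X ^ cost e \<le> X ^ (cost i + cost e)" "X ^ cost i \<le> X ^ (cost i + cost e)"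
    using Store.prems cost_pos[of e] by (intro power_increasing; simp)+
  have W: "X ^ cost e < W" "X ^ cost i < W"
    using X(2,3) Store.prems(5) unfolding growth.simps by linarith+
  have "val s e \<le> X ^ cost e \<and> fits W s e" "fits W s i"
    using Store.prems val_le_fits[of X s e W] val_le_fits[of X s i W] W by simp_all
  with X(2) have *: "val s e \<le> X ^ (cost i + cost e)" "fits W s e" "fits W s i"
    by auto
  from bounded_mono[OF Store.prems(2)] X(1) *(1)
  have "bounded (X ^ (cost i + cost e)) (run (Store a i e) s)"
    by (simp add: bounded_def)
  with exec.Store[OF *(3,2), of a] show ?case
    by (intro conjI exI[of _ "cost i + cost e + 1"]) simp_all
next
  case (Seq p q)
  let ?Y = "X ^ growth p"
  have Y: "X \<le> ?Y" using Seq.prems growth_pos[of p] by (intro self_le_power) auto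
  have Z: "?Y ^ growth q < W" using Seq.prems by (simp add: power_mult)
  have "?Y \<le> ?Y ^ growth q" using Seq.prems Y growth_pos[of q] by (intro self_le_power) auto
  with Z have "?Y < W" by simp
  with Seq.IH(1)[of X s] Seq.prems obtain t where
    1: "bounded ?Y (run p s)" "t \<le> ccost p" "exec W p s t (run p s)" by auto
  with Seq.IH(2)[of ?Y "run p s"] Seq.prems Y Z consts_le_mono[OF _ Y, of q] obtain u where
    2: "bounded (?Y ^ growth q) (run q (run p s))" "u \<le> ccost q" "exec W q (run p s) u (run q (run p s))"
    by auto
  from exec.Seq[OF 1(3) 2(3)] 1(2) 2(1,2) show ?case
    by (auto simp: power_mult intro!: exI[of _ "t + u + 1"])
next
  case (Cond e p q)
  let ?g = "growth (Cond e p q)"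
  have g: "growth p \<le> ?g" "growth q \<le> ?g" "cost e \<le> ?g"
    using cost_pos[of e] growth_pos[of p] growth_pos[of q] by auto
  have le: "X ^ growth p \<le> X ^ ?g" "X ^ growth q \<le> X ^ ?g" "X ^ cost e \<le> X ^ ?g"
    using Cond.prems g by (intro power_increasing; simp)+
  have lt: "X ^ growth p < W" "X ^ growth q < W" "X ^ cost e < W"
    using le Cond.prems(5) by linarith+
  have f: "fits W s e"
    using val_le_fits[of X s e W] Cond.prems lt by auto
  show ?case
  proof (cases "val s e = 0")
    case True
    from Cond.IH(2)[of X s] Cond.prems lt obtain u where
      "bounded (X ^ growth q) (run q s)" "u \<le> ccost q" "exec W q s u (run q s)" by auto
    with exec.CondFalse[OF f True, of q u _ p] True bounded_mono[OF _ le(2)] show ?thesis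
      by (auto intro!: exI[of _ "cost e + u + 1"])
  next
    case False
    from Cond.IH(1)[of X s] Cond.prems lt obtain u where
      "bounded (X ^ growth p) (run p s)" "u \<le> ccost p" "exec W p s u (run p s)" by auto
    with exec.CondTrue[OF f False, of p u _ q] False bounded_mono[OF _ le(1)] show ?thesis
      by (auto intro!: exI[of _ "cost e + u + 1"])
  qed
qed auto

text \<open>The counter \<open>j\<close> numbers the iterations, so the invariant also carries the time bound.\<close>

lemma exec_while:
  assumes lf: "loopfree c" "consts_le X (While b c)" "2 \<le> X" "X ^ growth (While b c) < W"
    and init: "I 0 s0" "bounded X s0"
    and step: "\<And>j s. I j s \<Longrightarrow> frame c s0 s \<Longrightarrow> val s b \<noteq> 0 \<Longrightarrow> j < K \<and> I (Suc j) (run c s)"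
    and bnd: "\<And>j s. I j s \<Longrightarrow> frame c s0 s \<Longrightarrow>
       (\<forall>x \<in> written_regs c. reg s x \<le> X) \<and> (\<forall>a \<in> written_arrs c. \<forall>i. arr s a i \<le> X)"
  shows "\<exists>t j s. exec W (While b c) s0 t s \<and> t \<le> (K + 1) * ccost (While b c) \<and>
    I j s \<and> val s b = 0 \<and> frame c s0 s \<and> bounded X s"
proof -
  let ?B = "ccost (While b c)"
  have "cost b \<le> growth (While b c)" "growth c \<le> growth (While b c)"
    using cost_pos[of b] growth_pos[of c] by auto
  then have "X ^ cost b \<le> X ^ growth (While b c)" "X ^ growth c \<le> X ^ growth (While b c)"
    using lf(3) by (intro power_increasing; simp)+
  with lf(4) have W: "X ^ cost b < W" "X ^ growth c < W" by linarith+
  \<comment> \<open>The bound of \<open>exec_loopfree\<close> would be raised to a new power in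
    every round. Assumption \<open>bnd\<close> resets it to \<open>X\<close> for the written
    locations, and \<open>frame\<close> does so for the others.\<close>
  have bounded: "bounded X s" if "I j s" "frame c s0 s" for j s
    using bnd[OF that] that(2) init(2) unfolding bounded_def frame_def by metis
  have "\<exists>t j' s'. exec W (While b c) s t s' \<and> t \<le> (K + 1 - j) * ?B \<and>
      I j' s' \<and> val s' b = 0 \<and> frame c s0 s'"
    if "I j s" "frame c s0 s" "j \<le> K" for j s
    using that
  proof (induction "K - j" arbitrary: j s rule: less_induct)
    case less
    have f: "fits W s b"
      using val_le_fits[OF bounded[OF less.prems(1,2)] lf(3) _ W(1)] lf(2) by simp
    show ?case
    proof (cases "val s b = 0")
      case True
      have "cost b + 1 \<le> ?B" by simp
      also have "1 * ?B \<le> (K + 1 - j) * ?B"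
        using less.prems(3) by (intro mult_le_mono1) simp
      finally have "cost b + 1 \<le> (K + 1 - j) * ?B" by simp
      with exec.WhileFalse[OF f True] less.prems True show ?thesis by blast
    next
      case False
      from step[OF less.prems(1,2) False] have 1: "j < K" "I (Suc j) (run c s)" by auto
      from exec_loopfree[OF lf(1) bounded[OF less.prems(1,2)] lf(3) _ W(2)] lf(2) obtain u
        where u: "u \<le> ccost c" "exec W c s u (run c s)" by auto
      have "K - Suc j < K - j" "Suc j \<le> K" using 1(1) by simp_all
      from less.hyps[OF this(1) 1(2) frame_run[OF less.prems(2)] this(2)] obtain t j' s' where
        t: "exec W (While b c) (run c s) t s'" "t \<le> (K + 1 - Suc j) * ?B"
          "I j' s'" "val s' b = 0" "frame c s0 s'" by blast
      have "K + 1 - j = Suc (K + 1 - Suc j)" using 1(1) by simp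
      then have "(K + 1 - j) * ?B = ?B + (K + 1 - Suc j) * ?B" by simp
      with t(2) u(1) have "cost b + u + t + 1 \<le> (K + 1 - j) * ?B" by simp
      with exec.WhileTrue[OF f False u(2) t(1)] t show ?thesis by blast
    qed
  qed
  from this[OF init(1) frame_refl] show ?thesis
    using bounded by fastforce
qed

definition seqs :: "com list \<Rightarrow> com" where
  "seqs cs = foldr Seq cs Skip"

lemma seqs_simps [simp]:
  "seqs [] = Skip" "seqs (c # cs) = Seq c (seqs cs)"
  by (simp_all add: seqs_def)

lemma loopfree_seqs: "loopfree (seqs cs) \<longleftrightarrow> (\<forall>c \<in> set cs. loopfree c)"
  by (induction cs) auto

lemma consts_le_seqs: "consts_le X (seqs cs) \<longleftrightarrow> (\<forall>c \<in> set cs. consts_le X c)"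
  by (induction cs) auto

lemma written_regs_seqs: "written_regs (seqs cs) = (\<Union>c \<in> set cs. written_regs c)"
  by (induction cs) auto

lemma written_arrs_seqs: "written_arrs (seqs cs) = (\<Union>c \<in> set cs. written_arrs c)"
  by (induction cs) auto

section \<open>Induced cycles in acyclically oriented graphs\<close>

definition cyc :: "nat \<Rightarrow> nat \<Rightarrow> nat \<Rightarrow> bool" where
  "cyc k i j \<longleftrightarrow> j = (i + 1) mod k \<or> i = (j + 1) mod k"

lemma cycle_graph_arc: "i < k \<Longrightarrow> j < k \<Longrightarrow> (i, j) \<in> parcs (cycle_graph k) \<longleftrightarrow> cyc k i j"
  by (auto simp: cycle_graph_def cyc_def)

text \<open>The inverse of an isomorphism onto \<open>cycle_graph k\<close> numbers the vertices of
  \<open>S\<close> around the cycle. From here on cycles are treated as such numberings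
  \<open>c\<close>.\<close>

lemma induced_cycleD:
  assumes "pair_graph G" "induced_cycle k G S"
  obtains c where "c ` {..<k} = S" "inj_on c {..<k}" "S \<subseteq> pverts G"
    "\<And>i j. i < k \<Longrightarrow> j < k \<Longrightarrow> (c i, c j) \<in> parcs G \<longleftrightarrow> cyc k i j"
proof -
  from assms(2) obtain f where
    f: "pre_digraph.digraph_isomorphism (with_proj G \<restriction> S) f"
      "with_proj (cycle_graph k) = app_iso f (with_proj G \<restriction> S)" and S: "S \<subseteq> pverts G"
    unfolding induced_cycle_def digraph_iso_def by auto
  let ?g = "iso_verts f" and ?A = "{e \<in> parcs G. fst e \<in> S \<and> snd e \<in> S}"
  have "verts (with_proj (cycle_graph k)) = ?g ` S" "arcs (with_proj (cycle_graph k)) = iso_arcs f ` ?A"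
    "tail (with_proj (cycle_graph k)) = iso_tail f" "head (with_proj (cycle_graph k)) = iso_head f"
    unfolding f(2) by simp_all
  then have im: "?g ` S = {..<k}" "parcs (cycle_graph k) = iso_arcs f ` ?A" "iso_tail f = fst" "iso_head f = snd"
    by (simp_all add: cycle_graph_def)
  have inj: "inj_on ?g S" and arcs: "\<And>e. e \<in> ?A \<Longrightarrow> iso_arcs f e = (?g (fst e), ?g (snd e))"
    using f(1) im(3,4) by (auto simp: pre_digraph.digraph_isomorphism_def prod_eq_iff)
  define c where "c = inv_into S ?g"
  have bij: "bij_betw ?g S {..<k}"
    using inj im(1) by (simp add: bij_betw_def)
  have c: "c i \<in> S" "?g (c i) = i" if "i < k" for i
    using that im(1) unfolding c_def by (auto intro: inv_into_into f_inv_into_f)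
  have "(c i, c j) \<in> parcs G \<longleftrightarrow> cyc k i j" if "i < k" "j < k" for i j
  proof -
    have "(i, j) \<in> parcs (cycle_graph k) \<longleftrightarrow> (\<exists>e \<in> ?A. (?g (fst e), ?g (snd e)) = (i, j))"
      unfolding im(2) using arcs by (force simp: image_iff)
    also have "\<dots> \<longleftrightarrow> (c i, c j) \<in> parcs G"
    proof
      assume "\<exists>e \<in> ?A. (?g (fst e), ?g (snd e)) = (i, j)"
      then obtain u v where e: "(u, v) \<in> parcs G" "u \<in> S" "v \<in> S" "?g u = i" "?g v = j" by auto
      then have "u = c i" "v = c j"
        using c(1)[OF that(1)] c(1)[OF that(2)] c(2)[OF that(1)] c(2)[OF that(2)]
        by (metis inj inj_onD)+
      with e show "(c i, c j) \<in> parcs G" by simp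
    qed (use c that in \<open>force\<close>)
    finally show ?thesis using that cycle_graph_arc by simp
  qed
  moreover have "c ` {..<k} = S" "inj_on c {..<k}"
    using bij_betw_inv_into[OF bij] by (auto simp: c_def bij_betw_def)
  ultimately show ?thesis using that S by blast
qed

text \<open>Inverting the numbering \<open>c\<close> gives the isomorphism; as arcs of
  \<open>with_proj\<close> are pairs of vertices, it acts on them componentwise.\<close>

lemma induced_cycleI:
  assumes "pair_graph G" "inj_on c {..<k}" "c ` {..<k} \<subseteq> pverts G"
    and c: "\<And>i j. i < k \<Longrightarrow> j < k \<Longrightarrow> (c i, c j) \<in> parcs G \<longleftrightarrow> cyc k i j"
  shows "induced_cycle k G (c ` {..<k})"
proof -
  interpret pair_graph G by fact
  let ?S = "c ` {..<k}"
  define g where "g = the_inv_into {..<k} c"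
  have g: "g (c i) = i" if "i < k" for i
    using that assms(2) by (simp add: g_def the_inv_into_f_f)
  define f where "f = \<lparr>iso_verts = g, iso_arcs = (\<lambda>(u, v). (g u, g v)), iso_head = snd, iso_tail = fst\<rparr>"
  have "pre_digraph.digraph_isomorphism (with_proj G \<restriction> ?S) f"
    unfolding pre_digraph.digraph_isomorphism_def
  proof (intro conjI)
    show "wf_digraph (with_proj G \<restriction> ?S)" by unfold_locales auto
    show "inj_on (iso_verts f) (verts (with_proj G \<restriction> ?S))"
      by (auto simp: f_def inj_on_def g)
    show "inj_on (iso_arcs f) (arcs (with_proj G \<restriction> ?S))"
      by (auto simp: f_def inj_on_def g)
  qed (auto simp: f_def)
  moreover have "with_proj (cycle_graph k) = app_iso f (with_proj G \<restriction> ?S)"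
  proof -
    have "g ` ?S = {..<k}" by (force simp: g image_image)
    moreover have "parcs (cycle_graph k) = (\<lambda>(u, v). (g u, g v)) ` {e \<in> parcs G. fst e \<in> ?S \<and> snd e \<in> ?S}"
      (is "?L = ?R")
    proof
      show "?L \<subseteq> ?R"
      proof
        fix e assume e: "e \<in> ?L"
        then obtain i j where ij: "e = (i, j)" "i < k" "j < k"
          by (auto simp: cycle_graph_def)
        with e c have "(c i, c j) \<in> parcs G" by (simp add: cycle_graph_arc)
        with ij show "e \<in> ?R" by (force simp: g intro: rev_image_eqI[of "(c i, c j)"])
      qed
      show "?R \<subseteq> ?L" using c by (auto simp: g cycle_graph_arc)
    qed
    moreover have "pverts (cycle_graph k) = {..<k}" by (simp add: cycle_graph_def)
    ultimately show ?thesis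
      unfolding app_iso_def with_proj_def induce_subgraph_def f_def by simp
  qed
  ultimately show ?thesis
    using assms(2,3) unfolding induced_cycle_def digraph_iso_def by (auto simp: card_image)
qed

text \<open>
  A cycle of length \<open>k\<close> is split into a vertex \<open>s\<close> and the path formed by the others, written
  \<open>t1, z1, z2, t2\<close>; for \<open>k = 4\<close> both \<open>z1\<close> and \<open>z2\<close> are its middle vertex, and for \<open>k = 3\<close> both are
  the dummy \<open>n + 1\<close>, which is adjacent to nothing.
\<close>

definition path_pattern ::
    "nat \<Rightarrow> nat \<Rightarrow> (nat \<Rightarrow> nat \<Rightarrow> bool) \<Rightarrow> nat \<Rightarrow> nat \<Rightarrow> nat \<Rightarrow> nat \<Rightarrow> bool" where
  "path_pattern k n E t1 z1 z2 t2 \<longleftrightarrow>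
     (if k = 3 then z1 = n + 1 \<and> z2 = n + 1 \<and> E t1 t2
      else if k = 4 then z1 = z2 \<and> t1 \<noteq> t2 \<and> E t1 z1 \<and> E z1 t2 \<and> \<not> E t1 t2
      else E t1 z1 \<and> E z1 z2 \<and> E z2 t2 \<and> \<not> E t1 z2 \<and> \<not> E t1 t2 \<and> \<not> E z1 t2)"

text \<open>The interface between the graph argument and the tables: arcs lead from \<open>u\<close>
  to the entries of \<open>ol u\<close>, and the rank \<open>r\<close>, increasing along arcs,
  excludes directed cycles.\<close>

locale oriented_graph =
  fixes n D :: nat and ol :: "nat \<Rightarrow> nat list" and r :: "nat \<Rightarrow> nat"
  assumes ol_distinct: "distinct (ol u)"
    and ol_length: "length (ol u) \<le> D"
    and ol_set: "w \<in> set (ol u) \<Longrightarrow> u \<in> {1..n} \<and> w \<in> {1..n} \<and> r u < r w"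
begin

definition E :: "nat \<Rightarrow> nat \<Rightarrow> bool" where
  "E u w \<longleftrightarrow> w \<in> set (ol u) \<or> u \<in> set (ol w)"

lemma E_sym: "E u w \<longleftrightarrow> E w u"
  by (auto simp: E_def)

lemma E_irrefl: "\<not> E u u"
  using ol_set by (auto simp: E_def)

lemma E_verts: "E u w \<Longrightarrow> u \<in> {1..n} \<and> w \<in> {1..n}"
  using ol_set by (auto simp: E_def)

lemma E_less: "E u w \<Longrightarrow> r u < r w \<longleftrightarrow> w \<in> set (ol u)"
  using ol_set by (fastforce simp: E_def)

lemma E_neq: "E u w \<Longrightarrow> r u \<noteq> r w"
  using ol_set by (fastforce simp: E_def)

section \<open>Cycles reached by forward steps\<close>

definition hop :: "nat \<Rightarrow> nat \<Rightarrow> bool" where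
  "hop u w \<longleftrightarrow> w = u \<or> w \<in> set (ol u)"

text \<open>As a hop may stay in place, three hops cover all walks of at most three arcs.\<close>

definition reach :: "nat \<Rightarrow> nat \<Rightarrow> bool" where
  "reach u w \<longleftrightarrow> (\<exists>a b. hop u a \<and> hop a b \<and> hop b w)"

text \<open>A vertex that closes a path matching \<open>path_pattern\<close> to an induced cycle and
  from which both new edges point away.\<close>

definition closer :: "nat \<Rightarrow> nat \<Rightarrow> nat \<Rightarrow> nat \<Rightarrow> nat \<Rightarrow> bool" where
  "closer t1 z1 z2 t2 s \<longleftrightarrow> t1 \<in> set (ol s) \<and> t2 \<in> set (ol s) \<and>
     \<not> E s z1 \<and> \<not> E s z2 \<and> s \<noteq> z1 \<and> s \<noteq> z2"

text \<open>The property that the search decides. For \<open>k = 3\<close> the inner vertices are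
  dummies, hence exempt from reachability.\<close>

definition reachable_cycle :: "nat \<Rightarrow> bool" where
  "reachable_cycle k \<longleftrightarrow> (\<exists>v \<in> {1..n}. \<exists>t1 z1 z2 t2.
     reach v t1 \<and> reach v t2 \<and> (k \<noteq> 3 \<longrightarrow> reach v z1 \<and> reach v z2) \<and>
     path_pattern k n E t1 z1 z2 t2 \<and> (\<exists>s. closer t1 z1 z2 t2 s))"

lemma reachI: "reach u u" "a \<in> set (ol u) \<Longrightarrow> reach u a"
  "a \<in> set (ol u) \<Longrightarrow> b \<in> set (ol a) \<Longrightarrow> reach u b"
  "a \<in> set (ol u) \<Longrightarrow> b \<in> set (ol a) \<Longrightarrow> w \<in> set (ol b) \<Longrightarrow> reach u w"
  unfolding reach_def hop_def by blast+

lemma reachable_cycleI: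
  assumes "reach v t1" "reach v t2" "k \<noteq> 3 \<Longrightarrow> reach v z1 \<and> reach v z2" "v \<in> {1..n}"
    "path_pattern k n E t1 z1 z2 t2" "closer t1 z1 z2 t2 s"
  shows "reachable_cycle k"
  using assms unfolding reachable_cycle_def by blast

text \<open>The vertex that precedes the other two is both the start \<open>v\<close> and the
  closing vertex \<open>s\<close>.\<close>

lemma triangle_reachable:
  assumes "E a b" "E b c" "E c a" "r a < r b" "r a < r c"
  shows "reachable_cycle 3"
proof (rule reachable_cycleI)
  have o: "b \<in> set (ol a)" "c \<in> set (ol a)"
    using assms(1,4,5) E_less E_sym[THEN iffD1, OF assms(3)] by blast+
  have V: "a \<in> {1..n}"
    using E_verts[OF assms(1)] by blast
  show "path_pattern 3 n E b (n + 1) (n + 1) c"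
    using assms by (simp add: path_pattern_def)
  show "closer b (n + 1) (n + 1) c a"
    using o E_verts[of a "n + 1"] V by (auto simp: closer_def)
  show "reach a b" "reach a c"
    using o by (auto intro: reachI)
  show "a \<in> {1..n}" by (rule V)
qed simp

text \<open>With \<open>a\<close> as closing vertex only the directions at \<open>c\<close> matter:
  if an edge enters \<open>c\<close>, everything is reached from \<open>a\<close>; otherwise
  \<open>c\<close> precedes \<open>b\<close> and \<open>d\<close> and is itself the start.\<close>

lemma square_reachable:
  assumes E: "E a b" "E b c" "E c d" "E d a" "\<not> E a c" "\<not> E b d" and ne: "a \<noteq> c" "b \<noteq> d"
    and a: "r a < r b" "r a < r d"
  shows "reachable_cycle 4"
proof -
  have o: "b \<in> set (ol a)" "d \<in> set (ol a)" using E a E_less E_sym by blast+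
  have V: "a \<in> {1..n}" "c \<in> {1..n}" using E E_verts by blast+
  have P: "path_pattern 4 n E b c c d"
    using E ne by (simp add: path_pattern_def)
  have C: "closer b c c d a"
    using E ne o by (simp add: closer_def)
  show ?thesis
  proof (cases "c \<in> set (ol b) \<or> c \<in> set (ol d)")
    case True
    show ?thesis
      by (rule reachable_cycleI[OF _ _ _ V(1) P C]) (use o True in \<open>auto intro: reachI\<close>)
  next
    case False
    then have "b \<in> set (ol c)" "d \<in> set (ol c)" using E by (auto simp: E_def)
    then show ?thesis
      by (intro reachable_cycleI[OF _ _ _ V(2) P C]) (auto intro: reachI)
  qed
qed

text \<open>The closing vertex cannot always be \<open>a\<close>. If \<open>b\<close> and
  \<open>d\<close> both precede \<open>c\<close> and \<open>d\<close> precedes \<open>e\<close>,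
  then the path \<open>b, c, d, e\<close> has the two sources \<open>b\<close> and \<open>d\<close>,
  and \<open>d\<close> has to close the cycle instead. In the mirror image of this case it is
  \<open>c\<close>.\<close>

lemma pentagon_reachable:
  assumes E: "E a b" "E b c" "E c d" "E d e" "E e a"
    and N: "\<not> E a c" "\<not> E a d" "\<not> E b d" "\<not> E b e" "\<not> E c e"
    and ne: "distinct [a, b, c, d, e]"
    and a: "r a < r b" "r a < r e"
  shows "reachable_cycle 5"
proof -
  have o: "b \<in> set (ol a)" "e \<in> set (ol a)" using E a E_less E_sym by blast+
  have V: "a \<in> {1..n}" "c \<in> {1..n}" "d \<in> {1..n}" using E E_verts by blast+
  have E': "E b a" "E c b" "E d c" "E e d" "E a e" "\<not> E c a" "\<not> E d a" "\<not> E d b" "\<not> E e b" "\<not> E e c"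
    using E N E_sym by blast+
  note N' = this(6-)
  have P: "path_pattern 5 n E b c d e" "path_pattern 5 n E c b a e" "path_pattern 5 n E d e a b"
    using E N E' N' by (simp_all add: path_pattern_def)
  have C: "closer b c d e a" using o N ne by (simp add: closer_def)
  have D: "closer c b a e d" if "c \<in> set (ol d)" "e \<in> set (ol d)"
    using that N E' ne by (auto simp: closer_def)
  have B: "closer d e a b c" if "b \<in> set (ol c)" "d \<in> set (ol c)"
    using that N E' ne by (auto simp: closer_def)
  \<comment> \<open>The eight orientations of the path \<open>b, c, d, e\<close>. The start is
    \<open>a\<close> except in the fourth case, where it is \<open>c\<close>, and the sixth, where
    it is \<open>d\<close>. The fifth uses three steps, from \<open>a\<close> through
    \<open>e\<close> and \<open>d\<close> to \<open>c\<close>.\<close>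
  consider "c \<in> set (ol b)" "d \<in> set (ol c) \<or> d \<in> set (ol e)"
    | "c \<in> set (ol b)" "c \<in> set (ol d)" "e \<in> set (ol d)"
    | "b \<in> set (ol c)" "d \<in> set (ol c)" "d \<in> set (ol e)"
    | "b \<in> set (ol c)" "d \<in> set (ol c)" "e \<in> set (ol d)"
    | "b \<in> set (ol c)" "c \<in> set (ol d)" "d \<in> set (ol e)"
    | "b \<in> set (ol c)" "c \<in> set (ol d)" "e \<in> set (ol d)"
    using E(2-4) unfolding E_def by blast
  then show ?thesis
  proof cases
    case 1
    show ?thesis
      by (rule reachable_cycleI[OF _ _ _ V(1) P(1) C]) (use o 1 in \<open>auto intro: reachI\<close>)
  next
    case 2
    show ?thesis
      by (rule reachable_cycleI[OF _ _ _ V(1) P(2) D]) (use o 2 in \<open>auto intro: reachI\<close>)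
  next
    case 3
    show ?thesis
      by (rule reachable_cycleI[OF _ _ _ V(1) P(3) B]) (use o 3 in \<open>auto intro: reachI\<close>)
  next
    case 4
    show ?thesis
      by (rule reachable_cycleI[OF _ _ _ V(2) P(1) C]) (use o 4 in \<open>auto intro: reachI\<close>)
  next
    case 5
    show ?thesis
      by (rule reachable_cycleI[OF _ _ _ V(1) P(1) C]) (use o 5 in \<open>auto intro: reachI\<close>)
  next
    case 6
    show ?thesis
      by (rule reachable_cycleI[OF _ _ _ V(3) P(1) C]) (use o 6 in \<open>auto intro: reachI\<close>)
  qed
qed

lemma induced_cycle_reachable:
  assumes k: "3 \<le> k" "k \<le> 5" and inj: "inj_on c {..<k}"
    and c: "\<And>i j. i < k \<Longrightarrow> j < k \<Longrightarrow> E (c i) (c j) \<longleftrightarrow> cyc k i j"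
  shows "reachable_cycle k"
proof -
  obtain m where m: "m < k" "\<And>i. i < k \<Longrightarrow> r (c m) \<le> r (c i)"
    using arg_min_nat_lemma[of "\<lambda>i. i < k" 0 "\<lambda>i. r (c i)"] k(1) by auto
  \<comment> \<open>Rotating the numbering puts a vertex of least rank at index 0, so that it
    precedes both of its neighbours on the cycle.\<close>
  define b where "b i = c ((m + i) mod k)" for i
  have b: "E (b i) (b j) \<longleftrightarrow> cyc k ((m + i) mod k) ((m + j) mod k)" for i j
    using k(1) by (simp add: b_def c)
  have min: "r (b 0) \<le> r (b i)" for i
    using m k(1) by (simp add: b_def)
  have less: "r (b 0) < r (b i)" if "E (b 0) (b i)" for i
    using min[of i] E_neq[OF that] by simp
  have neq: "b i = b j \<longleftrightarrow> (m + i) mod k = (m + j) mod k" for i j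
    using k(1) inj by (auto simp: b_def dest: inj_onD)
  consider (3) "k = 3" | (4) "k = 4" | (5) "k = 5" using k by linarith
  then show ?thesis
  proof cases
    case 3
    then have m': "m \<in> {0, 1, 2}"
      using m(1) by auto
    have "\<forall>m \<in> {0, 1, 2}.
        cyc 3 ((m + 0) mod 3) ((m + 1) mod 3) \<and>
        cyc 3 ((m + 1) mod 3) ((m + 2) mod 3) \<and>
        cyc 3 ((m + 2) mod 3) ((m + 0) mod 3)"
      by (simp add: cyc_def)
    from bspec[OF this m']
    have h: "E (b 0) (b 1)" "E (b 1) (b 2)" "E (b 2) (b 0)"
      unfolding b 3 by blast+
    show ?thesis
      unfolding 3 by (rule triangle_reachable[OF h less[OF h(1)] less[OF E_sym[THEN iffD1, OF h(3)]]])
  next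
    case 4
    then have m': "m \<in> {0, 1, 2, 3}"
      using m(1) by auto
    have "\<forall>m \<in> {0, 1, 2, 3}.
        cyc 4 ((m + 0) mod 4) ((m + 1) mod 4) \<and>
        cyc 4 ((m + 1) mod 4) ((m + 2) mod 4) \<and>
        cyc 4 ((m + 2) mod 4) ((m + 3) mod 4) \<and>
        cyc 4 ((m + 3) mod 4) ((m + 0) mod 4) \<and>
        \<not> cyc 4 ((m + 0) mod 4) ((m + 2) mod 4) \<and>
        \<not> cyc 4 ((m + 1) mod 4) ((m + 3) mod 4)"
      by (simp add: cyc_def)
    from bspec[OF this m']
    have h: "E (b 0) (b 1)" "E (b 1) (b 2)" "E (b 2) (b 3)" "E (b 3) (b 0)"
        "\<not> E (b 0) (b 2)" "\<not> E (b 1) (b 3)"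
      unfolding b 4 by blast+
    have ne: "b 0 \<noteq> b 2" "b 1 \<noteq> b 3"
      using m' by (auto simp: neq 4)
    show ?thesis
      unfolding 4 by (rule square_reachable[OF h ne less[OF h(1)] less[OF E_sym[THEN iffD1, OF h(4)]]])
  next
    case 5
    then have m': "m \<in> {0, 1, 2, 3, 4}"
      using m(1) by auto
    have "\<forall>m \<in> {0, 1, 2, 3, 4}.
        cyc 5 ((m + 0) mod 5) ((m + 1) mod 5) \<and>
        cyc 5 ((m + 1) mod 5) ((m + 2) mod 5) \<and>
        cyc 5 ((m + 2) mod 5) ((m + 3) mod 5) \<and>
        cyc 5 ((m + 3) mod 5) ((m + 4) mod 5) \<and>
        cyc 5 ((m + 4) mod 5) ((m + 0) mod 5) \<and>
        \<not> cyc 5 ((m + 0) mod 5) ((m + 2) mod 5) \<and>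
        \<not> cyc 5 ((m + 0) mod 5) ((m + 3) mod 5) \<and>
        \<not> cyc 5 ((m + 1) mod 5) ((m + 3) mod 5) \<and>
        \<not> cyc 5 ((m + 1) mod 5) ((m + 4) mod 5) \<and>
        \<not> cyc 5 ((m + 2) mod 5) ((m + 4) mod 5)"
      by (simp add: cyc_def)
    from bspec[OF this m']
    have h: "E (b 0) (b 1)" "E (b 1) (b 2)" "E (b 2) (b 3)" "E (b 3) (b 4)" "E (b 4) (b 0)"
        "\<not> E (b 0) (b 2)" "\<not> E (b 0) (b 3)" "\<not> E (b 1) (b 3)" "\<not> E (b 1) (b 4)" "\<not> E (b 2) (b 4)"
      unfolding b 5 by blast+
    have ne: "distinct [b 0, b 1, b 2, b 3, b 4]"
      using m' by (auto simp: neq 5)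
    show ?thesis
      unfolding 5 by (rule pentagon_reachable[OF h ne less[OF h(1)] less[OF E_sym[THEN iffD1, OF h(5)]]])
  qed
qed

text \<open>The converse, needed for the output. The list \<open>[t1, t2, s, z1, z2]\<close> is not
  in cyclic order; it is arranged so that for each \<open>k\<close> its first \<open>k\<close>
  entries are the vertices of the cycle, leaving out the repetition for \<open>k = 4\<close> and the
  dummies for \<open>k = 3\<close>. Adjacency of \<open>s\<close> is assumed in place of precedence
  because this is what the final scan tests.\<close>

lemma closer_cycle:
  assumes k: "3 \<le> k" "k \<le> 5" and P: "path_pattern k n E t1 z1 z2 t2" and C: "E s t1" "E s t2"
    "\<not> E s z1" "\<not> E s z2" "s \<noteq> z1" "s \<noteq> z2"
  obtains c where "inj_on c {..<k}" "c ` {..<k} = (\<lambda>i. [t1, t2, s, z1, z2] ! i) ` {..<k}"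
    "c ` {..<k} \<subseteq> {1..n}"
    "\<And>i j. i < k \<Longrightarrow> j < k \<Longrightarrow> E (c i) (c j) \<longleftrightarrow> cyc k i j"
proof -
  have C': "E t1 s" "E t2 s" "\<not> E z1 s" "\<not> E z2 s"
    by (simp_all add: C E_sym[of t1 s] E_sym[of t2 s] E_sym[of z1 s] E_sym[of z2 s])
  have V: "s \<in> {1..n}" "t1 \<in> {1..n}" "t2 \<in> {1..n}"
    using C E_verts by blast+
  have ne: "s \<noteq> t1" "s \<noteq> t2"
    using C E_irrefl by auto
  consider (3) "k = 3" | (4) "k = 4" | (5) "k = 5" using k by linarith
  then show ?thesis
  proof cases
    case 3
    let ?c = "\<lambda>i. [s, t1, t2] ! i"
    have lt: "{..<3::nat} = {0, 1, 2}" by auto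
    from P 3 have "E t1 t2"
      by (simp add: path_pattern_def)
    then have E: "E t1 t2" "E t2 t1" "t1 \<noteq> t2"
      using E_irrefl by (auto simp: E_sym[of t2 t1])
    have "\<forall>i \<in> {..<k}. \<forall>j \<in> {..<k}. E (?c i) (?c j) \<longleftrightarrow> cyc k i j"
      unfolding 3 lt cyc_def using C C' E E_irrefl by simp
    then have "E (?c i) (?c j) \<longleftrightarrow> cyc k i j" if "i < k" "j < k" for i j
      using that by blast
    moreover have "inj_on ?c {..<k}"
      unfolding 3 lt using ne E by simp
    moreover have "?c ` {..<k} = (\<lambda>i. [t1, t2, s, z1, z2] ! i) ` {..<k}"
      unfolding 3 lt by auto
    moreover have "?c ` {..<k} \<subseteq> {1..n}"
      unfolding 3 lt using V by simp
    ultimately show ?thesis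
      using that[of ?c] by blast
  next
    case 4
    let ?c = "\<lambda>i. [s, t1, z1, t2] ! i"
    have lt: "{..<4::nat} = {0, 1, 2, 3}" by auto
    from P 4 have E: "E t1 z1" "E z1 t2" "\<not> E t1 t2" "z1 = z2" "t1 \<noteq> t2"
      by (auto simp: path_pattern_def)
    then have E': "E z1 t1" "E t2 z1" "\<not> E t2 t1" "t1 \<noteq> z1" "z1 \<noteq> t2" "z1 \<in> {1..n}"
      using E_irrefl E_verts by (auto simp: E_sym[of z1 t1] E_sym[of t2 z1] E_sym[of t2 t1] E_sym[of z2 t1] E_sym[of t2 z2])
    have "\<forall>i \<in> {..<k}. \<forall>j \<in> {..<k}. E (?c i) (?c j) \<longleftrightarrow> cyc k i j"
      unfolding 4 lt cyc_def using C(1-4) C' E(1-3) E'(1-3) E_irrefl by simp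
    then have "E (?c i) (?c j) \<longleftrightarrow> cyc k i j" if "i < k" "j < k" for i j
      using that by blast
    moreover have "inj_on ?c {..<k}"
      unfolding 4 lt using ne C(5) E(5) E'(4,5) by simp
    moreover have "?c ` {..<k} = (\<lambda>i. [t1, t2, s, z1, z2] ! i) ` {..<k}"
      unfolding 4 lt using E(4) by auto
    moreover have "?c ` {..<k} \<subseteq> {1..n}"
      unfolding 4 lt using V E'(6) by simp
    ultimately show ?thesis
      using that[of ?c] by blast
  next
    case 5
    let ?c = "\<lambda>i. [s, t1, z1, z2, t2] ! i"
    have lt: "{..<5::nat} = {0, 1, 2, 3, 4}" by auto
    from P 5 have E: "E t1 z1" "E z1 z2" "E z2 t2" "\<not> E t1 z2" "\<not> E t1 t2" "\<not> E z1 t2"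
      by (auto simp: path_pattern_def)
    then have E': "E z1 t1" "E z2 z1" "E t2 z2" "\<not> E z2 t1" "\<not> E t2 t1" "\<not> E t2 z1"
        "z1 \<in> {1..n}" "z2 \<in> {1..n}"
      using E_verts by (auto simp: E_sym[of z1 t1] E_sym[of z2 z1] E_sym[of t2 z2]
          E_sym[of z2 t1] E_sym[of t2 t1] E_sym[of t2 z1])
    have ne': "t1 \<noteq> z1" "t1 \<noteq> z2" "t1 \<noteq> t2" "z1 \<noteq> z2" "z1 \<noteq> t2" "z2 \<noteq> t2"
      using E E' E_irrefl by auto
    have "\<forall>i \<in> {..<k}. \<forall>j \<in> {..<k}. E (?c i) (?c j) \<longleftrightarrow> cyc k i j"
      unfolding 5 lt cyc_def using C(1-4) C' E E'(1-6) E_irrefl by simp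
    then have "E (?c i) (?c j) \<longleftrightarrow> cyc k i j" if "i < k" "j < k" for i j
      using that by blast
    moreover have "inj_on ?c {..<k}"
      unfolding 5 lt using ne ne' C(5,6) by simp
    moreover have "?c ` {..<k} = (\<lambda>i. [t1, t2, s, z1, z2] ! i) ` {..<k}"
      unfolding 5 lt by auto
    moreover have "?c ` {..<k} \<subseteq> {1..n}"
      unfolding 5 lt using V E'(7,8) by simp
    ultimately show ?thesis
      using that[of ?c] by blast
  qed
qed

section \<open>Counting the closing vertices by inclusion-exclusion\<close>

definition joint :: "nat \<Rightarrow> nat \<Rightarrow> nat \<Rightarrow> nat \<Rightarrow> nat" where
  "joint a b c e = card {s \<in> {1..n}. {a, b, c, e} \<subseteq> set (ol s)}"

text \<open>The vertices that precede both ends and neither inner vertex, yet do not close the path.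
  Besides successors of an inner vertex this can be an inner vertex itself: for \<open>k = 4\<close>
  the middle vertex may precede both ends.\<close>

definition barred :: "nat \<Rightarrow> nat \<Rightarrow> nat \<Rightarrow> nat \<Rightarrow> nat set" where
  "barred t1 z1 z2 t2 = {s \<in> {z1, z2} \<union> set (ol z1) \<union> set (ol z2).
     t1 \<in> set (ol s) \<and> t2 \<in> set (ol s) \<and> z1 \<notin> set (ol s) \<and> z2 \<notin> set (ol s)}"

text \<open>
  Inclusion-exclusion counts the \<open>s\<close> preceding \<open>t1\<close> and \<open>t2\<close> but neither \<open>z1\<close> nor \<open>z2\<close>. Those
  among them that are not closers lie in the bounded set \<open>{z1, z2} \<union> set (ol z1) \<union> set (ol z2)\<close>.
\<close>

lemma ex_closer_iff:
  "(\<exists>s. closer t1 z1 z2 t2 s) \<longleftrightarrow>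
     joint t1 t2 z1 z1 + joint t1 t2 z2 z2 + card (barred t1 z1 z2 t2)
       < joint t1 t2 t2 t2 + joint t1 t2 z1 z2"
proof -
  let ?A = "{s \<in> {1..n}. {t1, t2} \<subseteq> set (ol s)}"
  let ?B = "\<lambda>z. {s. z \<in> set (ol s)}"
  let ?F = "?A - ?B z1 - ?B z2" and ?X = "barred t1 z1 z2 t2"
  have X: "?X \<subseteq> ?F" unfolding barred_def using ol_set by blast
  \<comment> \<open>Inclusion-exclusion in additive form, which avoids truncated
    subtraction.\<close>
  have "card ?A + card (?A \<inter> ?B z1 \<inter> ?B z2) = card ?F + card (?A \<inter> ?B z1) + card (?A \<inter> ?B z2)"
  proof -
    have "card ?A = card (?A \<inter> ?B z1) + card (?A - ?B z1)"
      by (subst card_Int_Diff[of _ "?B z1"]) simp_all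
    moreover have "card (?A - ?B z1) = card ((?A - ?B z1) \<inter> ?B z2) + card ?F"
      by (subst card_Int_Diff[of _ "?B z2"]) simp_all
    moreover have "card (?A \<inter> ?B z2) = card (?A \<inter> ?B z2 \<inter> ?B z1) + card (?A \<inter> ?B z2 - ?B z1)"
      by (subst card_Int_Diff[of _ "?B z1"]) simp_all
    moreover have "?A \<inter> ?B z2 - ?B z1 = (?A - ?B z1) \<inter> ?B z2" "?A \<inter> ?B z2 \<inter> ?B z1 = ?A \<inter> ?B z1 \<inter> ?B z2"
      by auto
    ultimately show ?thesis by simp
  qed
  moreover have "joint t1 t2 t2 t2 = card ?A" "joint t1 t2 z1 z1 = card (?A \<inter> ?B z1)"
    "joint t1 t2 z2 z2 = card (?A \<inter> ?B z2)" "joint t1 t2 z1 z2 = card (?A \<inter> ?B z1 \<inter> ?B z2)"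
    unfolding joint_def by (auto intro!: arg_cong[where f = card])
  ultimately have count: "joint t1 t2 z1 z1 + joint t1 t2 z2 z2 + card ?X < joint t1 t2 t2 t2 + joint t1 t2 z1 z2
      \<longleftrightarrow> card ?X < card ?F"
    by (intro iffI) linarith+
  have "{s. closer t1 z1 z2 t2 s} = ?F - ?X"
  proof (intro set_eqI)
    fix s
    show "s \<in> {s. closer t1 z1 z2 t2 s} \<longleftrightarrow> s \<in> ?F - ?X"
      using ol_set[of t1 s] unfolding closer_def E_def barred_def by auto
  qed
  then have "(\<exists>s. closer t1 z1 z2 t2 s) \<longleftrightarrow> ?F - ?X \<noteq> {}"
    by blast
  also have "?F - ?X \<noteq> {} \<longleftrightarrow> card ?X < card ?F"
  proof -
    have fin: "finite ?F" by simp
    have "?F - ?X \<noteq> {} \<longleftrightarrow> card (?F - ?X) \<noteq> 0"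
      using fin by (simp only: card_0_eq finite_Diff)
    also have "card (?F - ?X) = card ?F - card ?X"
      by (rule card_Diff_subset[OF finite_subset[OF X fin] X])
    finally show ?thesis by (simp only: neq0_conv zero_less_diff)
  qed
  finally show ?thesis
    by (simp only: count)
qed

end

section \<open>Elimination order\<close>

text \<open>A Hoare triple for total correctness with time bound \<open>B\<close>.\<close>

definition reaches :: "nat \<Rightarrow> com \<Rightarrow> nat \<Rightarrow> (state \<Rightarrow> bool) \<Rightarrow> (state \<Rightarrow> bool) \<Rightarrow> bool" where
  "reaches W c B P Q \<longleftrightarrow> (\<forall>s. P s \<longrightarrow> (\<exists>t s'. exec W c s t s' \<and> t \<le> B \<and> Q s'))"

lemma reaches_seq:
  "reaches W p B P Q \<Longrightarrow> reaches W q C Q R \<Longrightarrow> reaches W (Seq p q) (B + C + 1) P R"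
  unfolding reaches_def by (meson exec.Seq add_le_mono le_refl)

abbreviation add_exp :: "exp \<Rightarrow> exp \<Rightarrow> exp" where "add_exp \<equiv> Bin Add"
text \<open>Tests are compared with 0, so products double as conjunctions, and sums as
  disjunctions.\<close>

abbreviation mult_exp :: "exp \<Rightarrow> exp \<Rightarrow> exp" where "mult_exp \<equiv> Bin Mul"
abbreviation "inc x \<equiv> Assign x (add_exp (Reg x) (Const 1))"
abbreviation "degree_exp e \<equiv> Bin Sub (Load 0 (add_exp e (Const 1))) (Load 0 e)"

text \<open>
  Array 2 counts the removed neighbours of a vertex, array 3 is the queue of the vertices that have
  reached degree at most \<open>d\<close>, and array 4 stores the position in the queue, add_exp 1. Arrays 5, 6
  and 7 are the adjacency matrix, the out-neighbours and the counting table. Every loop has its own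
  counters, which are still 0 when it is entered.
\<close>

definition enqueue :: "nat \<Rightarrow> com" where
  "enqueue d =
     Cond (mult_exp (Bin Equal (Load 4 (Reg 2)) (Const 0))
         (Bin Less (degree_exp (Reg 2)) (add_exp (Load 2 (Reg 2)) (Const (d + 1)))))
       (Seq (Store 3 (Reg 3) (Reg 2)) (Seq (inc 3) (Store 4 (Reg 2) (Reg 3))))
       Skip"

definition init_body :: "nat \<Rightarrow> com" where
  "init_body d = Seq (Assign 2 (Reg 1)) (Seq (enqueue d) (inc 1))"

text \<open>Two nested traversals merged into one loop with a loop-free body: a round either treats
  one neighbour of the vertex at the head of the queue or moves the head on. The number of rounds is
  thus at most the number of arcs plus the number of vertices.\<close>

definition peel_body :: "nat \<Rightarrow> com" where
  "peel_body d =
     Seq (Assign 6 (Load 3 (Reg 4)))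
       (Cond (Bin Less (Reg 5) (degree_exp (Reg 6)))
         (Seq (Assign 2 (Load 1 (add_exp (Load 0 (Reg 6)) (Reg 5))))
           (Seq (Store 2 (Reg 2) (add_exp (Load 2 (Reg 2)) (Const 1)))
             (Seq (enqueue d) (inc 5))))
         (Seq (inc 4) (Assign 5 (Const 0))))"

abbreviation "init_loop d \<equiv> While (Bin Less (Reg 1) (Reg 0)) (init_body d)"
abbreviation "peel_loop d \<equiv> While (Bin Less (Reg 4) (Reg 3)) (peel_body d)"

definition fresh :: "nat \<Rightarrow> nat \<Rightarrow> state \<Rightarrow> bool" where
  "fresh a x s \<longleftrightarrow> (\<forall>b\<ge>a. arr s b = (\<lambda>_. 0)) \<and> (\<forall>y\<ge>x. reg s y = 0)"

lemma freshD: "fresh a x s \<Longrightarrow> a \<le> b \<Longrightarrow> arr s b i = 0" "fresh a x s \<Longrightarrow> x \<le> y \<Longrightarrow> reg s y = 0"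
  by (auto simp: fresh_def)

lemma fresh_frame:
  assumes "frame c s0 s" "fresh a x s0" "a \<le> b" "x \<le> y"
    "\<forall>a' \<in> written_arrs c. a' < b" "\<forall>x' \<in> written_regs c. x' < y"
  shows "fresh b y s"
proof -
  have "arr s a' = arr s0 a'" if "b \<le> a'" for a'
    using that assms(5) by (intro frame_arr[OF assms(1)]) auto
  moreover have "reg s x' = reg s0 x'" if "y \<le> x'" for x'
    using that assms(6) by (intro frame_reg[OF assms(1)]) auto
  ultimately show ?thesis
    using assms(2-4) by (simp add: fresh_def)
qed

lemma length_concat_take_Suc:
  "u < length L \<Longrightarrow> length (concat (take (Suc u) L)) = length (concat (take u L)) + length (L ! u)"
  by (simp add: take_Suc_conv_app_nth)

lemma concat_nth_offset:
  assumes "u < length L" "i < length (L ! u)"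
  shows "length (concat (take u L)) + i < length (concat L)"
    and "concat L ! (length (concat (take u L)) + i) = L ! u ! i"
proof -
  have eq: "concat L = concat (take u L) @ L ! u @ concat (drop (Suc u) L)"
    by (subst id_take_nth_drop[OF assms(1)]) simp
  show "length (concat (take u L)) + i < length (concat L)"
    by (subst eq) (use assms in simp)
  show "concat L ! (length (concat (take u L)) + i) = L ! u ! i"
    by (subst eq) (use assms in \<open>simp add: nth_append\<close>)
qed

section \<open>Adjacency lists of a degenerate graph\<close>

locale degenerate_lists =
  fixes d :: nat and L :: "nat list list"
  assumes distinct_L: "v < length L \<Longrightarrow> distinct (L ! v)"
    and range_L: "v < length L \<Longrightarrow> w \<in> set (L ! v) \<Longrightarrow> w < length L \<and> w \<noteq> v"
    and sym_L: "v < length L \<Longrightarrow> w \<in> set (L ! v) \<Longrightarrow> v \<in> set (L ! w)"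
    and degen: "S \<subseteq> {..<length L} \<Longrightarrow> S \<noteq> {} \<Longrightarrow> \<exists>v \<in> S. card (set (L ! v) \<inter> S) \<le> d"
begin

abbreviation n :: nat where "n \<equiv> length L"

text \<open>A bound on all stored values. As \<open>d\<close> is less than
  \<open>(n + 2) ^ d\<close>, the entries of the counting table, at most \<open>n * d ^ 4\<close>,
  are covered by the exponent \<open>4 * d + 1\<close>; the offsets of the input, at most
  \<open>n * n\<close>, are covered by 2.\<close>

definition X :: nat where "X = (n + 2) ^ (4 * d + 2)"

lemma X_ge: "n + 2 \<le> X" "d + 1 \<le> X" "n * n \<le> X" "n * d ^ 4 \<le> X" "2 \<le> X" "4 \<le> X"
proof -
  have "(n + 2) ^ 1 \<le> X" unfolding X_def by (rule power_increasing) auto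
  then show n: "n + 2 \<le> X" by simp
  then show "2 \<le> X" by simp
  have "4 \<le> (n + 2) ^ 2" by (simp add: power2_eq_square)
  also have "\<dots> \<le> X" unfolding X_def by (rule power_increasing) auto
  finally show "4 \<le> X" .
  have "n * n \<le> (n + 2) ^ 2" by (simp add: power2_eq_square algebra_simps)
  also have "\<dots> \<le> X" unfolding X_def by (rule power_increasing) auto
  finally show "n * n \<le> X" .
  have d: "d + 1 \<le> (n + 2) ^ d"
  proof -
    have "d + 1 \<le> 2 ^ d" by (induction d) auto
    also have "\<dots> \<le> (n + 2) ^ d" by (rule power_mono) auto
    finally show ?thesis .
  qed
  also have "\<dots> \<le> X" unfolding X_def by (rule power_increasing) auto
  finally show "d + 1 \<le> X" .
  have "n * d ^ 4 \<le> (n + 2) ^ 1 * ((n + 2) ^ d) ^ 4"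
    using d by (intro mult_le_mono power_mono) auto
  also have "\<dots> = (n + 2) ^ (1 + d * 4)"
    by (simp only: power_add power_mult)
  also have "\<dots> \<le> X" unfolding X_def by (rule power_increasing) auto
  finally show "n * d ^ 4 \<le> X" .
qed

lemma length_L: "v < n \<Longrightarrow> length (L ! v) = card (set (L ! v))"
  by (simp add: distinct_L distinct_card)

lemma length_L_le: "v < n \<Longrightarrow> length (L ! v) \<le> n"
  using range_L by (subst length_L) (auto intro!: subset_eq_atLeast0_lessThan_card)

definition common :: "state \<Rightarrow> bool" where
  "common s \<longleftrightarrow> reg s 0 = n \<and> bounded X s \<and>
     arr s 0 = arr (input_state L) 0 \<and> arr s 1 = arr (input_state L) 1"

lemma common_frame:
  "common s0 \<Longrightarrow> frame c s0 s \<Longrightarrow> bounded X s \<Longrightarrow> 0 \<notin> written_regs c \<Longrightarrow>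
     0 \<notin> written_arrs c \<Longrightarrow> 1 \<notin> written_arrs c \<Longrightarrow> common s"
  by (simp add: common_def frame_def)

lemma input_arrs:
  assumes "arr s 0 = arr (input_state L) 0" "arr s 1 = arr (input_state L) 1" "u < n"
  shows "arr s 0 (u + 1) - arr s 0 u = length (L ! u)" "arr s 0 (Suc u) - arr s 0 u = length (L ! u)"
    and "i < length (L ! u) \<Longrightarrow> arr s 1 (arr s 0 u + i) = L ! u ! i"
    and "i < length (L ! u) \<Longrightarrow> arr s (Suc 0) (arr s 0 u + i) = L ! u ! i"
  using concat_nth_offset[OF assms(3)] assms(3)
  by (simp_all add: assms(1,2) assms(2)[unfolded One_nat_def] input_state_def length_concat_take_Suc)

text \<open>The last conjunct is the key one: at its insertion a vertex has at most \<open>d\<close>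
  neighbours that are not yet in the queue. Positions in the queue therefore give the
  orientation.\<close>

definition queue_inv :: "nat list \<Rightarrow> state \<Rightarrow> bool" where
  "queue_inv q s \<longleftrightarrow> reg s 3 = length q \<and> (\<forall>i < length q. arr s 3 i = q ! i) \<and> (\<forall>i. arr s 3 i \<le> n) \<and>
     (\<forall>i < length q. arr s 4 (q ! i) = Suc i) \<and> (\<forall>w. w \<notin> set q \<longrightarrow> arr s 4 w = 0) \<and>
     distinct q \<and> set q \<subseteq> {..<n} \<and> (\<forall>i < length q. card (set (L ! (q ! i)) - set (take i q)) \<le> d)"

lemma queue_inv_cong:
  "queue_inv q s \<Longrightarrow> reg s' 3 = reg s 3 \<Longrightarrow> arr s' 3 = arr s 3 \<Longrightarrow> arr s' 4 = arr s 4 \<Longrightarrow> queue_inv q s'"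
  by (simp add: queue_inv_def)

lemma queue_length: "queue_inv q s \<Longrightarrow> length q \<le> n"
  using card_mono[of "{..<n}" "set q"] by (simp add: queue_inv_def distinct_card)

lemma queue_inv_bounds:
  assumes "queue_inv q s"
  shows "reg s 3 \<le> X" "arr s 3 i \<le> X" "arr s 4 i \<le> X"
proof -
  show "reg s 3 \<le> X" "arr s 3 i \<le> X"
    using assms queue_length[OF assms] X_ge(1) by (auto simp: queue_inv_def dest: spec[of _ i])
  show "arr s 4 i \<le> X"
  proof (cases "i \<in> set q")
    case True
    then obtain j where "j < length q" "q ! j = i" by (auto simp: in_set_conv_nth)
    with assms queue_length[OF assms] X_ge(1) show ?thesis by (auto simp: queue_inv_def)
  qed (use assms in \<open>simp add: queue_inv_def\<close>)
qed

lemma queue_inv_snoc: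
  assumes q: "queue_inv q s" and w: "w < n" "w \<notin> set q" "card (set (L ! w) - set q) \<le> d"
    and s': "reg s' 3 = Suc (length q)" "arr s' 3 = (arr s 3)(length q := w)"
      "arr s' 4 = (arr s 4)(w := Suc (length q))"
  shows "queue_inv (q @ [w]) s'"
  unfolding queue_inv_def
proof (intro conjI allI impI)
  fix i assume i: "i < length (q @ [w])"
  consider "i < length q" | "i = length q" using i by fastforce
  note cases = this
  show "arr s' 3 i = (q @ [w]) ! i"
    using cases q by cases (auto simp: queue_inv_def s' nth_append)
  show "card (set (L ! ((q @ [w]) ! i)) - set (take i (q @ [w]))) \<le> d"
    using cases q w by cases (auto simp: queue_inv_def nth_append)
  show "arr s' 4 ((q @ [w]) ! i) = Suc i"
    using cases
  proof cases
    case 1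
    then have "q ! i \<noteq> w" using w(2) nth_mem by blast
    with 1 q show ?thesis by (auto simp: queue_inv_def s' nth_append)
  qed (simp add: s')
qed (use q w in \<open>auto simp: queue_inv_def s'\<close>)

lemma written_enqueue: "written_regs (enqueue d) = {3}" "written_arrs (enqueue d) = {3, 4}"
  by (auto simp: enqueue_def)

text \<open>Assumption \<open>deg\<close> is left to the caller because the two loops justify it
  differently: initially all counts are 0 and the full degree is at most \<open>d\<close>, while
  during the peeling the counted neighbours lie in the queue.\<close>

lemma run_enqueue:
  assumes s: "reg s 2 = w" "w < n" "arr s 0 = arr (input_state L) 0" "arr s 1 = arr (input_state L) 1"
    and q: "queue_inv q s"
    and deg: "length (L ! w) \<le> d + arr s 2 w \<Longrightarrow> card (set (L ! w) - set q) \<le> d"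
  obtains q' where "queue_inv q' (run (enqueue d) s)"
    "q' = (if w \<notin> set q \<and> length (L ! w) \<le> d + arr s 2 w then q @ [w] else q)"
    "reg (run (enqueue d) s) = (reg s)(3 := length q')"
    "\<And>a. a \<noteq> 3 \<Longrightarrow> a \<noteq> 4 \<Longrightarrow> arr (run (enqueue d) s) a = arr s a"
proof -
  have pos: "arr s 4 w = 0 \<longleftrightarrow> w \<notin> set q"
    using q by (auto simp: queue_inv_def in_set_conv_nth)
  have q3: "reg s 3 = length q" using q by (simp add: queue_inv_def)
  show ?thesis
  proof (cases "w \<notin> set q \<and> length (L ! w) \<le> d + arr s 2 w")
    case True
    let ?s = "run (enqueue d) s"
    have r: "reg ?s = (reg s)(3 := Suc (length q))" 
      "arr ?s = (arr s)(3 := (arr s 3)(length q := w), 4 := (arr s 4)(w := Suc (length q)))"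
      using True pos q3 s(1) input_arrs(1)[OF s(3,4,2)] by (simp_all add: enqueue_def)
    have "queue_inv (q @ [w]) ?s"
      by (rule queue_inv_snoc[OF q s(2)]) (use True deg r in auto)
    with that[of "q @ [w]"] True r show ?thesis by simp
  next
    case False
    then have "run (enqueue d) s = s"
      using pos s(1) input_arrs(1)[OF s(3,4,2)] by (auto simp: enqueue_def)
    note run = this
    show ?thesis
      by (rule that[of q]) (use False q q3 in \<open>simp_all add: run fun_upd_idem\<close>)
  qed
qed

section \<open>The initial queue\<close>

definition init_inv :: "nat \<Rightarrow> state \<Rightarrow> bool" where
  "init_inv j s \<longleftrightarrow> reg s 1 = j \<and> j \<le> n \<and> reg s 2 \<le> n \<and>
     (\<exists>q. queue_inv q s \<and> (\<forall>w < j. w \<notin> set q \<longrightarrow> d < length (L ! w)))"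

definition queued :: "state \<Rightarrow> bool" where
  "queued s \<longleftrightarrow> common s \<and> fresh 5 4 s \<and> arr s 2 = (\<lambda>_. 0) \<and>
     (\<exists>q. queue_inv q s \<and> (\<forall>w < n. w \<notin> set q \<longrightarrow> d < length (L ! w)))"

lemma reaches_queued:
  assumes W: "X ^ growth (init_loop d) < W"
  shows "reaches W (init_loop d) ((n + 1) * ccost (init_loop d)) (\<lambda>s. common s \<and> fresh 2 1 s) queued"
  unfolding reaches_def
proof (intro allI impI, elim conjE)
  fix s0 assume s0: "common s0" "fresh 2 1 s0"
  have lf: "loopfree (init_body d)" "consts_le X (init_loop d)"
    using X_ge(2,5) by (simp_all add: init_body_def enqueue_def)
  have wr: "written_regs (init_body d) = {1, 2, 3}" "written_arrs (init_body d) = {3, 4}"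
    by (auto simp: init_body_def written_enqueue)
  have "\<exists>t j s. exec W (init_loop d) s0 t s \<and> t \<le> (n + 1) * ccost (init_loop d) \<and>
    init_inv j s \<and> val s (Bin Less (Reg 1) (Reg 0)) = 0 \<and> frame (init_body d) s0 s \<and> bounded X s"
  proof (rule exec_while[OF lf X_ge(5) W])
    show "init_inv 0 s0"
      using s0 by (auto simp: init_inv_def queue_inv_def fresh_def)
  next
    fix j s assume I: "init_inv j s" "frame (init_body d) s0 s" "val s (Bin Less (Reg 1) (Reg 0)) \<noteq> 0"
    have fr: "arr s 0 = arr (input_state L) 0" "arr s 1 = arr (input_state L) 1" "arr s 2 = (\<lambda>_. 0)" "reg s 0 = n"
      using frame_arr[OF I(2)] frame_reg[OF I(2)] s0 by (auto simp: wr common_def fresh_def)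
    with I have j: "j < n" "reg s 1 = j" by (auto simp: init_inv_def split: if_splits)
    from I obtain q where q: "queue_inv q s" "\<forall>w < j. w \<notin> set q \<longrightarrow> d < length (L ! w)"
      by (auto simp: init_inv_def)
    let ?s = "run (Assign 2 (Reg 1)) s"
    have q1: "queue_inv q ?s" by (rule queue_inv_cong[OF q(1)]) simp_all
    have s1: "reg ?s 2 = j" "arr ?s = arr s" using j by simp_all
    obtain q' where q': "queue_inv q' (run (enqueue d) ?s)"
      "q' = (if j \<notin> set q \<and> length (L ! j) \<le> d + arr ?s 2 j then q @ [j] else q)"
      "reg (run (enqueue d) ?s) = (reg ?s)(3 := length q')"
    proof (rule run_enqueue[OF s1(1) j(1) _ _ q1])
      show "card (set (L ! j) - set q) \<le> d" if "length (L ! j) \<le> d + arr ?s 2 j"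
        using that length_L[OF j(1)] card_mono[of "set (L ! j)" "set (L ! j) - set q"] s1(2) fr(3) by auto
    qed (use s1 fr in auto)
    have run: "run (init_body d) s = run (inc 1) (run (enqueue d) ?s)"
      by (simp add: init_body_def)
    have "queue_inv q' (run (init_body d) s)"
      unfolding run by (rule queue_inv_cong[OF q'(1)]) simp_all
    moreover have "d < length (L ! w)" if "w < Suc j" "w \<notin> set q'" for w
      using that q(2) q'(2) s1(2) fr(3) by (cases "w = j") (auto split: if_splits)
    moreover have "reg (run (enqueue d) ?s) 1 = j" "reg (run (enqueue d) ?s) 2 = j"
      unfolding q'(3) using j by simp_all
    then have "reg (run (init_body d) s) 1 = Suc j" "reg (run (init_body d) s) 2 \<le> n"
      using j unfolding run by simp_all
    ultimately show "j < n \<and> init_inv (Suc j) (run (init_body d) s)"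
      using j by (auto simp: init_inv_def)
  next
    fix j s assume "init_inv j s"
    then show "(\<forall>x \<in> written_regs (init_body d). reg s x \<le> X) \<and> 
        (\<forall>a \<in> written_arrs (init_body d). \<forall>i. arr s a i \<le> X)"
      using X_ge(1) queue_inv_bounds unfolding wr by (auto simp: init_inv_def)
  qed (use s0 in \<open>simp add: common_def\<close>)
  then obtain t j s where s: "exec W (init_loop d) s0 t s" "t \<le> (n + 1) * ccost (init_loop d)"
    "init_inv j s" "val s (Bin Less (Reg 1) (Reg 0)) = 0" "frame (init_body d) s0 s" "bounded X s" by blast
  have c: "common s" "fresh 5 4 s" "arr s 2 = (\<lambda>_. 0)"
    using common_frame[OF s0(1) s(5,6)] fresh_frame[OF s(5) s0(2), of 5 4] frame_arr[OF s(5), of 2] s0(2)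
    by (auto simp: wr fresh_def)
  then have "j = n" using s(3,4) by (auto simp: init_inv_def common_def split: if_splits)
  with s c have "queued s" by (auto simp: queued_def init_inv_def)
  with s show "\<exists>t s. exec W (init_loop d) s0 t s \<and> t \<le> (n + 1) * ccost (init_loop d) \<and> queued s" by blast
qed

section \<open>Peeling off vertices of small remaining degree\<close>

definition scanned :: "nat list \<Rightarrow> nat \<Rightarrow> nat \<Rightarrow> nat \<Rightarrow> nat list" where
  "scanned q h i a = (if a \<in> set (take h q) then L ! a
     else if h < length q \<and> a = q ! h then take i (L ! a) else [])"

definition work :: nat where "work = (\<Sum>a < n. length (L ! a)) + n"

text \<open>Here \<open>D a\<close> is the traversed part of the list of \<open>a\<close>: all of it
  for vertices before the head of the queue, the first \<open>i\<close> entries at the head, nothing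
  otherwise. The round number \<open>j\<close> is the number of traversed entries plus the number of
  finished heads, which is how \<open>work\<close> bounds it. The clause on vertices outside the
  queue says that none of them is ripe for insertion.\<close>

definition peel_inv :: "nat \<Rightarrow> state \<Rightarrow> bool" where
  "peel_inv j s \<longleftrightarrow> (\<exists>q. let h = reg s 4; i = reg s 5; D = scanned q h i in
     queue_inv q s \<and> h \<le> length q \<and> (if h < length q then i \<le> length (L ! (q ! h)) else i = 0) \<and>
     j = (\<Sum>a < n. length (D a)) + h \<and>
     (\<forall>w < n. arr s 2 w = card {a. a < n \<and> w \<in> set (D a)}) \<and> (\<forall>w\<ge>n. arr s 2 w = 0) \<and>
     (\<forall>w < n. w \<notin> set q \<longrightarrow> d + arr s 2 w < length (L ! w)) \<and> reg s 2 \<le> X \<and> reg s 6 \<le> n)"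

definition elimination :: "(nat \<Rightarrow> nat) \<Rightarrow> bool" where
  "elimination p \<longleftrightarrow> inj_on p {..<n} \<and> (\<forall>u < n. card {w \<in> set (L ! u). p u < p w} \<le> d)"

definition peeled :: "state \<Rightarrow> bool" where
  "peeled s \<longleftrightarrow> common s \<and> fresh 5 7 s \<and> elimination (arr s 4)"

lemma scanned_snoc: "h < length q \<Longrightarrow> scanned (q @ [w]) h i = scanned q h i"
  by (auto simp: scanned_def nth_append fun_eq_iff)

lemma scanned_Suc:
  assumes "distinct q" "h < length q" "i < length (L ! (q ! h))"
  shows "scanned q h (Suc i) = (scanned q h i)(q ! h := scanned q h i (q ! h) @ [L ! (q ! h) ! i])"
proof -
  have "q ! h \<notin> set (take h q)"
    using assms(1,2) by (auto simp: in_set_conv_nth nth_eq_iff_index_eq)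
  with assms(2,3) show ?thesis
    by (auto simp: scanned_def fun_eq_iff take_Suc_conv_app_nth)
qed

text \<open>Moving the head on traverses no new entry, so such a round is recorded by the summand
  \<open>h\<close> of \<open>peel_inv\<close> alone.\<close>

lemma scanned_next:
  assumes "distinct q" "h < length q" 
  shows "scanned q (Suc h) 0 = scanned q h (length (L ! (q ! h)))"
  using assms by (auto simp: scanned_def fun_eq_iff take_Suc_conv_app_nth)

lemma scanned_subset: "a < n \<Longrightarrow> set (scanned q h i a) \<subseteq> set (L ! a)" 
  by (auto simp: scanned_def dest: in_set_takeD)

lemma length_scanned: "length (scanned q h i a) \<le> length (L ! a)"
  by (auto simp: scanned_def)

lemma in_scanned: "w \<in> set (scanned q h i a) \<Longrightarrow> a \<in> set (take (Suc h) q)"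
  using set_take_subset_set_take[of h "Suc h" q]
  by (auto simp: scanned_def take_Suc_conv_app_nth split: if_splits)

lemma sum_append_one:
  assumes "v < n"
  shows "(\<Sum>a < n. length ((D(v := D v @ [w])) a)) = Suc (\<Sum>a < n. length (D a))"
proof -
  have "(\<Sum>a < n. length ((D(v := D v @ [w])) a)) = (\<Sum>a < n. length (D a) + (if a = v then 1 else 0))"
    by (rule sum.cong) auto
  with assms show ?thesis by (simp add: sum.distrib)
qed

lemma card_append_one:
  assumes "v < n" "w \<notin> set (D v)"
  shows "card {a. a < n \<and> x \<in> set ((D(v := D v @ [w])) a)} =
    (if x = w then Suc (card {a. a < n \<and> x \<in> set (D a)}) else card {a. a < n \<and> x \<in> set (D a)})"
proof (cases "x = w")
  case True
  have "{a. a < n \<and> w \<in> set ((D(v := D v @ [w])) a)} = insert v {a. a < n \<and> w \<in> set (D a)}"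
    using assms by auto
  with True assms show ?thesis by simp
next
  case False
  have "{a. a < n \<and> x \<in> set ((D(v := D v @ [w])) a)} = {a. a < n \<and> x \<in> set (D a)}"
    using False by auto
  with False show ?thesis by simp
qed

lemma peel_step:
  assumes inv: "peel_inv j s" and s: "arr s 0 = arr (input_state L) 0" "arr s 1 = arr (input_state L) 1"
    and guard: "reg s 4 < reg s 3"
  shows "j < work \<and> peel_inv (Suc j) (run (peel_body d) s)"
proof -
  define h i where "h = reg s 4" and "i = reg s 5"
  note hi = h_def[symmetric] i_def[symmetric]
  from inv obtain q where q: "queue_inv q s" and D: "h \<le> length q" 
    "(if h < length q then i \<le> length (L ! (q ! h)) else i = 0)"
    "j = (\<Sum>a < n. length (scanned q h i a)) + h"
    "\<And>w. w < n \<Longrightarrow> arr s 2 w = card {a. a < n \<and> w \<in> set (scanned q h i a)}" "\<And>w. w \<ge> n \<Longrightarrow> arr s 2 w = 0"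
    "\<And>w. w < n \<Longrightarrow> w \<notin> set q \<Longrightarrow> d + arr s 2 w < length (L ! w)" "reg s 2 \<le> X" "reg s 6 \<le> n"
    unfolding peel_inv_def Let_def hi by blast
  have h: "h < length q" using guard q by (simp add: hi queue_inv_def)
  let ?v = "q ! h" and ?D = "scanned q h i"
  have v: "?v < n" "arr s 3 h = ?v" "distinct q"
    using q h nth_mem[OF h] by (auto simp: queue_inv_def)
  have deg_v: "arr s 0 (Suc ?v) - arr s 0 ?v = length (L ! ?v)"
    by (rule input_arrs(2)[OF s v(1)])
  have "(\<Sum>a < n. length (?D a)) \<le> (\<Sum>a < n. length (L ! a))"
    by (intro sum_mono length_scanned)
  with D(3) h queue_length[OF q] have work: "j < work" by (simp add: work_def)
  show ?thesis
  proof (cases "i < length (L ! ?v)")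
    case True
    let ?w = "L ! ?v ! i"
    have w: "?w < n" "?w \<in> set (L ! ?v)" using True range_L[OF v(1)] by auto
    define s1 where "s1 = s\<lparr>reg := (reg s)(6 := ?v, 2 := ?w), arr := (arr s)(2 := (arr s 2)(?w := Suc (arr s 2 ?w)))\<rparr>"
    have s1: "reg s1 2 = ?w" "arr s1 0 = arr (input_state L) 0" "arr s1 1 = arr (input_state L) 1"
      "reg s1 4 = h" "reg s1 5 = i" "reg s1 6 = ?v"
      using s by (simp_all add: s1_def hi)
    have run: "run (peel_body d) s = run (inc 5) (run (enqueue d) s1)"
      using True deg_v v input_arrs(3)[OF s v(1) True] unfolding peel_body_def s1_def
      by (simp add: hi fun_upd_twist)
    have q1: "queue_inv q s1" by (rule queue_inv_cong[OF q]) (simp_all add: s1_def)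
    have sc: "scanned q h (Suc i) = ?D(?v := ?D ?v @ [?w])"
      by (rule scanned_Suc[OF v(3) h True])
    have "?v \<notin> set (take h q)"
      using v(3) h by (auto simp: in_set_conv_nth nth_eq_iff_index_eq)
    \<comment> \<open>Lists are free of repetitions, so this arc is counted for the first
      time.\<close>
    then have notin: "?w \<notin> set (?D ?v)"
      using True distinct_L[OF v(1)] h by (auto simp: scanned_def in_set_conv_nth nth_eq_iff_index_eq)
    have cnt: "arr s1 2 x = card {a. a < n \<and> x \<in> set (scanned q h (Suc i) a)}" if "x < n" for x
      unfolding sc card_append_one[where v = "?v" and D = "?D" and w = "?w", OF v(1) notin] using D(4)[OF that] by (auto simp: s1_def)
    \<comment> \<open>By symmetry of adjacency the vertices counted for \<open>?w\<close> are
      neighbours of it, and they all lie in the queue. Hence degree minus count is an upper bound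
      for the number of neighbours outside the queue.\<close>
    have card_w: "card (set (L ! ?w) - set q) \<le> d" if len: "length (L ! ?w) \<le> d + arr s1 2 ?w"
    proof -
      have "{a. a < n \<and> ?w \<in> set (scanned q h (Suc i) a)} \<subseteq> set (L ! ?w) \<inter> set q"
        using scanned_subset[of _ q h "Suc i"] in_scanned[of ?w q h "Suc i"] sym_L[of _ ?w]
          set_take_subset[of "Suc h" q] by blast
      then have "arr s1 2 ?w \<le> card (set (L ! ?w) \<inter> set q)"
        unfolding cnt[OF w(1)] by (intro card_mono) simp_all
      moreover have "length (L ! ?w) = card (set (L ! ?w) \<inter> set q) + card (set (L ! ?w) - set q)"
        unfolding length_L[OF w(1)] by (rule card_Int_Diff) simp
      ultimately show ?thesis using len by linarith
    qed
    obtain q' where q': "queue_inv q' (run (enqueue d) s1)"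
      "q' = (if ?w \<notin> set q \<and> length (L ! ?w) \<le> d + arr s1 2 ?w then q @ [?w] else q)"
      "reg (run (enqueue d) s1) = (reg s1)(3 := length q')"
      "\<And>a. a \<noteq> 3 \<Longrightarrow> a \<noteq> 4 \<Longrightarrow> arr (run (enqueue d) s1) a = arr s1 a"
      by (rule run_enqueue[OF s1(1) w(1) s1(2,3) q1 card_w]) blast+
    let ?s = "run (peel_body d) s"
    have sc': "scanned q' h (Suc i) = scanned q h (Suc i)"
      using q'(2) scanned_snoc[OF h] by simp
    have r: "reg ?s 4 = h" "reg ?s 5 = Suc i" "reg ?s 2 = ?w" "reg ?s 6 = ?v" "arr ?s 2 = arr s1 2"
      unfolding run using q'(3) s1 by (simp_all add: q'(4))
    have qh: "h < length q'" "q' ! h = ?v" using q'(2) h by (auto simp: nth_append)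
    have "queue_inv q' ?s"
      unfolding run by (rule queue_inv_cong[OF q'(1)]) simp_all
    moreover have "d + arr s1 2 x < length (L ! x)" if "x < n" "x \<notin> set q'" for x
    proof (cases "x = ?w")
      case True
      with that q'(2) show ?thesis by (auto split: if_splits)
    next
      case False
      with that q'(2) D(6)[of x] show ?thesis by (auto simp: s1_def split: if_splits)
    qed
    moreover have "Suc j = (\<Sum>a < n. length (scanned q h (Suc i) a)) + h"
      unfolding sc sum_append_one[OF v(1)] D(3) by simp
    moreover have "arr s1 2 x = 0" if "x \<ge> n" for x
      using that w(1) D(5) by (simp add: s1_def)
    ultimately have "peel_inv (Suc j) ?s"
      unfolding peel_inv_def Let_def r using qh True w(1) v(1) cnt X_ge(1)
      by (intro exI[of _ q']) (simp add: sc')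
    with work show ?thesis by simp
  next
    case False
    then have i: "i = length (L ! ?v)" using D(2) h by simp
    let ?s = "run (peel_body d) s"
    have run: "?s = s\<lparr>reg := (reg s)(6 := ?v, 4 := Suc h, 5 := 0)\<rparr>"
      using False deg_v v(2) unfolding peel_body_def by (simp add: hi)
    have "queue_inv q ?s"
      by (rule queue_inv_cong[OF q]) (simp_all add: run)
    moreover have "Suc j = (\<Sum>a < n. length (scanned q (Suc h) 0 a)) + Suc h"
      using D(3) unfolding scanned_next[OF v(3) h] i by simp
    ultimately have "peel_inv (Suc j) ?s"
      unfolding peel_inv_def Let_def using D(4-8) h v(1) scanned_next[OF v(3) h, folded i]
      by (intro exI[of _ q]) (simp add: run)
    with work show ?thesis by simp
  qed
qed

text \<open>Once the queue is exhausted, every vertex left out has more than \<open>d\<close>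
  neighbours that are left out as well, contradicting degeneracy of the subgraph they induce. So all
  vertices are in the queue, and the positions form an elimination order.\<close>

lemma peel_complete:
  assumes q: "queue_inv q s"
    and deg: "\<And>w. w < n \<Longrightarrow> w \<notin> set q \<Longrightarrow>
      d + card {a. a < n \<and> w \<in> set (scanned q (length q) 0 a)} < length (L ! w)"
  shows "elimination (arr s 4)"
proof -
  let ?S = "{..<n} - set q"
  have qn: "set q \<subseteq> {..<n}" "distinct q" using q by (simp_all add: queue_inv_def)
  have "?S = {}"
  proof (rule ccontr)
    assume "?S \<noteq> {}"
    then obtain v where v: "v \<in> ?S" "card (set (L ! v) \<inter> ?S) \<le> d"
      using degen[of ?S] by auto
    have "set (scanned q (length q) 0 a) = (if a \<in> set q then set (L ! a) else {})" for a
      by (simp add: scanned_def)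
    then have "{a. a < n \<and> v \<in> set (scanned q (length q) 0 a)} = {a. a < n \<and> a \<in> set q \<and> v \<in> set (L ! a)}"
      by auto
    also have "\<dots> = set (L ! v) \<inter> set q"
      using v(1) sym_L[of _ v] sym_L[of v] range_L[of v] by blast
    finally have "{a. a < n \<and> v \<in> set (scanned q (length q) 0 a)} = set (L ! v) \<inter> set q" .
    with deg[of v] v(1) have "d + card (set (L ! v) \<inter> set q) < card (set (L ! v))"
      by (simp add: length_L)
    also have "\<dots> = card (set (L ! v) \<inter> set q) + card (set (L ! v) - set q)"
      by (rule card_Int_Diff) simp
    also have "set (L ! v) - set q = set (L ! v) \<inter> ?S"
      using v(1) range_L by auto
    finally show False using v(2) by simp
  qed
  with qn have set_q: "set q = {..<n}" by auto
  have p: "arr s 4 (q ! i) = Suc i" if "i < length q" for i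
    using q that by (simp add: queue_inv_def)
  have "inj_on (arr s 4) {..<n}"
    unfolding set_q[symmetric] by (auto simp: inj_on_def in_set_conv_nth p)
  moreover have "card {w \<in> set (L ! u). arr s 4 u < arr s 4 w} \<le> d" if u: "u < n" for u
  proof -
    from u obtain i where i: "i < length q" "u = q ! i"
      using set_q by (metis in_set_conv_nth lessThan_iff)
    have "{w \<in> set (L ! u). arr s 4 u < arr s 4 w} \<subseteq> set (L ! u) - set (take i q)"
    proof
      fix w assume w: "w \<in> {w \<in> set (L ! u). arr s 4 u < arr s 4 w}"
      have "w \<notin> set (take i q)"
      proof
        assume "w \<in> set (take i q)"
        then obtain j where "j < i" "w = q ! j" by (auto simp: in_set_conv_nth)
        with w i p[of j] p[of i] show False by simp
      qed
      with w show "w \<in> set (L ! u) - set (take i q)" by simp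
    qed
    then have "card {w \<in> set (L ! u). arr s 4 u < arr s 4 w} \<le> card (set (L ! u) - set (take i q))"
      by (intro card_mono) simp_all
    also have "\<dots> \<le> d" using q i by (simp add: queue_inv_def)
    finally show ?thesis .
  qed
  ultimately show ?thesis by (simp add: elimination_def)
qed

lemma reaches_peeled:
  assumes W: "X ^ growth (peel_loop d) < W"
  shows "reaches W (peel_loop d) ((work + 1) * ccost (peel_loop d)) queued peeled"
  unfolding reaches_def
proof (intro allI impI)
  fix s0 assume s0: "queued s0"
  then have c0: "common s0" "fresh 5 4 s0" by (simp_all add: queued_def)
  have lf: "loopfree (peel_body d)" "consts_le X (peel_loop d)"
    using X_ge(2,5) by (simp_all add: peel_body_def enqueue_def)
  have wr: "written_regs (peel_body d) = {2, 3, 4, 5, 6}" "written_arrs (peel_body d) = {2, 3, 4}"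
    by (auto simp: peel_body_def written_enqueue)
  let ?b = "Bin Less (Reg 4) (Reg 3)"
  have "\<exists>t j s. exec W (peel_loop d) s0 t s \<and> t \<le> (work + 1) * ccost (peel_loop d) \<and>
    peel_inv j s \<and> val s ?b = 0 \<and> frame (peel_body d) s0 s \<and> bounded X s"
  proof (rule exec_while[OF lf X_ge(5) W])
    from s0 obtain q where "queue_inv q s0" "\<forall>w < n. w \<notin> set q \<longrightarrow> d < length (L ! w)"
      by (auto simp: queued_def)
    moreover have "reg s0 2 \<le> X" "reg s0 4 = 0" "reg s0 5 = 0" "reg s0 6 = 0" "arr s0 2 = (\<lambda>_. 0)"
      using s0 c0(1) by (simp_all add: freshD(2)[OF c0(2)] queued_def common_def bounded_def)
    ultimately show "peel_inv 0 s0"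
      unfolding peel_inv_def Let_def by (intro exI[of _ q]) (simp add: scanned_def)
  next
    fix j s assume I: "peel_inv j s" "frame (peel_body d) s0 s" "val s ?b \<noteq> 0"
    have "arr s 0 = arr (input_state L) 0" "arr s 1 = arr (input_state L) 1" "reg s 4 < reg s 3"
      using frame_arr[OF I(2)] c0 I(3) by (auto simp: wr common_def split: if_splits)
    with peel_step I(1) show "j < work \<and> peel_inv (Suc j) (run (peel_body d) s)"
      by simp
  next
    fix j s assume I: "peel_inv j s"
    then obtain q where q: "queue_inv q s" "reg s 4 \<le> length q"
      "if reg s 4 < length q then reg s 5 \<le> length (L ! (q ! reg s 4)) else reg s 5 = 0"
      "\<forall>w < n. arr s 2 w = card {a. a < n \<and> w \<in> set (scanned q (reg s 4) (reg s 5) a)}" "\<forall>w\<ge>n. arr s 2 w = 0"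
      "reg s 2 \<le> X" "reg s 6 \<le> n"
      unfolding peel_inv_def Let_def by blast
    have "reg s 5 \<le> n"
    proof (cases "reg s 4 < length q")
      case True
      then have "q ! reg s 4 \<in> set q" by simp
      then have "q ! reg s 4 < n" using q(1) by (auto simp: queue_inv_def)
      then show ?thesis using q(3) True length_L_le[of "q ! reg s 4"] by simp
    qed (use q in simp)
    moreover have "arr s 2 i \<le> n" for i
    proof (cases "i < n")
      case True
      have "card {a. a < n \<and> i \<in> set (scanned q (reg s 4) (reg s 5) a)} \<le> card {..<n}"
        by (rule card_mono) auto
      with True q(4) show ?thesis by simp
    qed (use q in simp)
    ultimately show "(\<forall>x \<in> written_regs (peel_body d). reg s x \<le> X) \<and> 
        (\<forall>a \<in> written_arrs (peel_body d). \<forall>i. arr s a i \<le> X)"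
      using q queue_length[OF q(1)] X_ge(1) queue_inv_bounds[OF q(1)] unfolding wr
      by (auto intro: order.trans[of _ n])
  qed (use c0 in \<open>simp add: common_def\<close>)
  then obtain t j s where s: "exec W (peel_loop d) s0 t s" "t \<le> (work + 1) * ccost (peel_loop d)"
    "peel_inv j s" "val s ?b = 0" "frame (peel_body d) s0 s" "bounded X s" by blast
  have "elimination (arr s 4)"
  proof -
    from s(3) obtain q where q: "queue_inv q s" "reg s 4 \<le> length q" 
      "if reg s 4 < length q then reg s 5 \<le> length (L ! (q ! reg s 4)) else reg s 5 = 0"
      "\<forall>w < n. arr s 2 w = card {a. a < n \<and> w \<in> set (scanned q (reg s 4) (reg s 5) a)}"
      "\<forall>w < n. w \<notin> set q \<longrightarrow> d + arr s 2 w < length (L ! w)"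
      unfolding peel_inv_def Let_def by blast
    moreover from q(1,2) s(4) have "reg s 4 = length q" by (auto simp: queue_inv_def split: if_splits)
    ultimately show ?thesis by (intro peel_complete[OF q(1)]) simp
  qed
  with s common_frame[OF c0(1) s(5,6)] fresh_frame[OF s(5) c0(2), of 5 7]
  show "\<exists>t s. exec W (peel_loop d) s0 t s \<and> t \<le> (work + 1) * ccost (peel_loop d) \<and> peeled s"
    by (auto simp: wr peeled_def)
qed

end

section \<open>Adjacency matrix and out-neighbours\<close>

definition nth0 :: "nat list \<Rightarrow> nat \<Rightarrow> nat" where
  "nth0 xs i = (if i < length xs then xs ! i else 0)"

lemma nth0_append: "nth0 (xs @ [x]) i = (if i = length xs then x else nth0 xs i)"
  by (auto simp: nth0_def nth_append)

lemma key_inj: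
  fixes w w' B :: nat
  assumes "w < B" "w' < B"
  shows "u * B + w = u' * B + w' \<longleftrightarrow> u = u' \<and> w = w'"
proof
  assume eq: "u * B + w = u' * B + w'"
  have "(u * B + w) div B = u" "(u' * B + w') div B = u'" using assms by simp_all
  with eq show "u = u' \<and> w = w'" by simp
qed simp

text \<open>Traverses all lists in the merged manner of \<open>peel_body\<close>; register 9 counts
  the slots filled for the current vertex. Rows of the matrix have width \<open>n + 2\<close> since
  names range from 0, the empty slot, to \<open>n + 1\<close>, the dummy.\<close>

definition arcs_body :: "nat \<Rightarrow> com" where
  "arcs_body d =
     Cond (Bin Less (Reg 8) (degree_exp (Reg 7)))
       (Seq (Assign 2 (Load 1 (add_exp (Load 0 (Reg 7)) (Reg 8))))
         (Seq (Store 5 (add_exp (mult_exp (add_exp (Reg 7) (Const 1)) (add_exp (Reg 0) (Const 2)))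
                 (add_exp (Reg 2) (Const 1))) (Const 1))
           (Seq (Cond (Bin Less (Load 4 (Reg 7)) (Load 4 (Reg 2)))
                (Seq (Store 6 (add_exp (mult_exp (add_exp (Reg 7) (Const 1)) (Const d)) (Reg 9))
                    (add_exp (Reg 2) (Const 1))) (inc 9))
                Skip)
             (inc 8))))
       (Seq (inc 7) (Seq (Assign 8 (Const 0)) (Assign 9 (Const 0))))"

abbreviation "arcs_loop d \<equiv> While (Bin Less (Reg 7) (Reg 0)) (arcs_body d)"

context degenerate_lists
begin

text \<open>The tables name the vertices \<open>1, \<dots>, n\<close>, so that \<open>0\<close> marks an empty slot.\<close>

definition slots :: "(nat \<Rightarrow> nat) \<Rightarrow> (nat \<Rightarrow> nat list) \<Rightarrow> nat \<Rightarrow> nat list" where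
  "slots p D u = (if u \<in> {1..n} then map Suc (filter (\<lambda>w. p (u - 1) < p w) (D (u - 1))) else [])"

text \<open>The matrix is specified for the names \<open>0\<close> and \<open>n + 1\<close> too, so
  that adjacency tests have a known value on empty slots and on the dummy.\<close>

definition tables :: "(nat \<Rightarrow> nat) \<Rightarrow> (nat \<Rightarrow> nat list) \<Rightarrow> state \<Rightarrow> bool" where
  "tables p D s \<longleftrightarrow>
     (\<forall>u \<le> n + 1. \<forall>w \<le> n + 1. arr s 5 (u * (n + 2) + w) = of_bool (u \<in> {1..n} \<and> w \<in> Suc ` set (D (u - 1)))) \<and>
     (\<forall>u. \<forall>i < d. arr s 6 (u * d + i) = nth0 (slots p D u) i) \<and>
     (\<forall>i. arr s 5 i \<le> 1) \<and> (\<forall>i. arr s 6 i \<le> n)"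

lemma tables_cong:
  "tables p D s \<Longrightarrow> arr s' 5 = arr s 5 \<Longrightarrow> arr s' 6 = arr s 6 \<Longrightarrow> tables p D s'"
  by (simp add: tables_def)

lemma tables_append:
  assumes t: "tables p D s" and ab: "a < n" "b < n"
    and s5: "arr s' 5 = (arr s 5)(Suc a * (n + 2) + Suc b := 1)"
    and s6: "arr s' 6 = (if p a < p b then (arr s 6)(Suc a * d + length (slots p D (Suc a)) := Suc b) else arr s 6)"
    and room: "p a < p b \<Longrightarrow> length (slots p D (Suc a)) < d"
  shows "tables p (D(a := D a @ [b])) s'"
proof -
  let ?D = "D(a := D a @ [b])"
  have "arr s' 5 (u * (n + 2) + w) = of_bool (u \<in> {1..n} \<and> w \<in> Suc ` set (?D (u - 1)))"
    if "u \<le> n + 1" "w \<le> n + 1" for u w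
  proof -
    have "u * (n + 2) + w = Suc a * (n + 2) + Suc b \<longleftrightarrow> u = Suc a \<and> w = Suc b"
      by (rule key_inj) (use that ab in simp_all)
    then have "arr s' 5 (u * (n + 2) + w) = (if u = Suc a \<and> w = Suc b then 1 else arr s 5 (u * (n + 2) + w))"
      unfolding s5 fun_upd_apply by simp
    also have "arr s 5 (u * (n + 2) + w) = of_bool (u \<in> {1..n} \<and> w \<in> Suc ` set (D (u - 1)))"
      using t that unfolding tables_def by blast
    finally show ?thesis
      using ab by (auto simp del: of_bool_eq_0_iff of_bool_eq_1_iff)
  qed
  moreover have "arr s' 6 (u * d + i) = nth0 (slots p ?D u) i" if "i < d" for u i
  proof -
    have old: "arr s 6 (u * d + i) = nth0 (slots p D u) i"
      using t that unfolding tables_def by blast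
    have sl: "slots p ?D u = (if u = Suc a \<and> p a < p b then slots p D u @ [Suc b] else slots p D u)"
      using ab by (auto simp: slots_def)
    show ?thesis
    proof (cases "p a < p b")
      case True
      \<comment> \<open>Assumption \<open>room\<close> keeps the new slot from spilling into the row
        of the next vertex.\<close>
      have "u * d + i = Suc a * d + length (slots p D (Suc a)) \<longleftrightarrow> u = Suc a \<and> i = length (slots p D (Suc a))"
        by (rule key_inj) (use that room True in simp_all)
      then show ?thesis
        unfolding s6 sl using True old by (auto simp: nth0_append)
    qed (use old s6 sl in simp)
  qed
  moreover have "arr s' 5 i \<le> 1" "arr s' 6 i \<le> n" for i
    using t ab unfolding s5 s6 tables_def by simp_all
  ultimately show ?thesis
    unfolding tables_def by blast
qed

definition arcs_inv :: "(nat \<Rightarrow> nat) \<Rightarrow> nat \<Rightarrow> state \<Rightarrow> bool" where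
  "arcs_inv p j s \<longleftrightarrow> (let u = reg s 7; i = reg s 8; D = scanned [0..<n] u i in
     u \<le> n \<and> (if u < n then i \<le> length (L ! u) else i = 0) \<and> j = (\<Sum>a < n. length (D a)) + u \<and>
     reg s 9 = (if u < n then length (slots p D (Suc u)) else 0) \<and> reg s 2 \<le> X \<and> tables p D s)"

definition tabled :: "state \<Rightarrow> bool" where
  "tabled s \<longleftrightarrow> common s \<and> fresh 7 10 s \<and> (\<exists>p. elimination p \<and> tables p ((!) L) s)"

lemma length_slots:
  assumes "elimination p" "distinct (D (u - 1))" "set (D (u - 1)) \<subseteq> set (L ! (u - 1))"
  shows "length (slots p D u) \<le> d"
proof (cases "u \<in> {1..n}")
  case True
  then have "length (slots p D u) = card (set (filter (\<lambda>w. p (u - 1) < p w) (D (u - 1))))"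
    using assms(2) by (simp add: slots_def distinct_card del: set_filter)
  also have "\<dots> \<le> card {w \<in> set (L ! (u - 1)). p (u - 1) < p w}"
    using assms(3) by (intro card_mono) auto
  also have "\<dots> \<le> d"
    using assms(1) True by (auto simp: elimination_def)
  finally show ?thesis .
qed (auto simp: slots_def)

lemma distinct_scanned: "a < n \<Longrightarrow> distinct (scanned q h i a)"
  by (simp add: scanned_def distinct_L)

lemma arcs_step:
  assumes inv: "arcs_inv p j s" and s: "arr s 0 = arr (input_state L) 0" "arr s 1 = arr (input_state L) 1"
    "reg s 0 = n" and p: "elimination p" "arr s 4 = p"
    and guard: "reg s 7 < n"
  shows "j < work \<and> arcs_inv p (Suc j) (run (arcs_body d) s)"
proof -
  define u i where "u = reg s 7" and "i = reg s 8"
  note ui = u_def[symmetric] i_def[symmetric]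
  let ?q = "[0..<n]"
  let ?D = "scanned ?q u i"
  from inv guard have D: "i \<le> length (L ! u)" "j = (\<Sum>a < n. length (?D a)) + u"
    "reg s 9 = length (slots p ?D (Suc u))" "reg s 2 \<le> X" "tables p ?D s" and u: "u < n"
    unfolding arcs_inv_def Let_def ui by simp_all
  have uq: "u < length ?q" "?q ! u = u" "distinct ?q" using u by simp_all
  have deg_u: "arr s 0 (Suc u) - arr s 0 u = length (L ! u)"
    by (rule input_arrs(2)[OF s(1,2) u])
  have "(\<Sum>a < n. length (?D a)) \<le> (\<Sum>a < n. length (L ! a))"
    by (intro sum_mono length_scanned)
  with D(2) u have work: "j < work" by (simp add: work_def)
  show ?thesis
  proof (cases "i < length (L ! u)")
    case True
    let ?w = "L ! u ! i" and ?s = "run (arcs_body d) s"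
    have w: "?w < n" "?w \<in> set (L ! u)" using True range_L[OF u] by auto
    have adj: "arr s (Suc 0) (arr s 0 u + i) = ?w"
      by (rule input_arrs(4)[OF s(1,2) u True])
    let ?l = "length (slots p ?D (Suc u))"
    have r: "reg ?s 7 = u" "reg ?s 8 = Suc i" "reg ?s 2 = ?w" "reg ?s 9 = (if p u < p ?w then Suc ?l else ?l)"
      "arr ?s 5 = (arr s 5)(Suc u * (n + 2) + Suc ?w := 1)"
      "arr ?s 6 = (if p u < p ?w then (arr s 6)(Suc u * d + ?l := Suc ?w) else arr s 6)"
      using True deg_u adj s(3) p(2) D(3) unfolding arcs_body_def by (simp_all add: ui)
    have sc: "scanned ?q u (Suc i) = ?D(u := ?D u @ [?w])"
      using scanned_Suc[OF uq(3,1)] True uq(2) by simp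
    have sl: "slots p (scanned ?q u (Suc i)) (Suc u) = 
        (if p u < p ?w then slots p ?D (Suc u) @ [Suc ?w] else slots p ?D (Suc u))"
      unfolding sc using u by (simp add: slots_def)
    \<comment> \<open>The bound \<open>d\<close> is applied to the list already extended by
      \<open>?w\<close>; one of its slots is the new one, so the old slots leave room for
      it.\<close>
    have "length (slots p (scanned ?q u (Suc i)) (Suc u)) \<le> d"
      by (rule length_slots[OF p(1)]) (use u distinct_scanned scanned_subset in auto)
    then have room: "?l < d" if "p u < p ?w"
      unfolding sl using that by simp
    have "tables p (scanned ?q u (Suc i)) ?s"
      unfolding sc by (rule tables_append[OF D(5) u w(1) r(5,6) room])
    moreover have "Suc j = (\<Sum>a < n. length (scanned ?q u (Suc i) a)) + u"
      unfolding sc sum_append_one[OF u] D(2) by simp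
    moreover have "reg ?s 9 = length (slots p (scanned ?q u (Suc i)) (Suc u))"
      unfolding sl r(4) by simp
    ultimately have "arcs_inv p (Suc j) ?s"
      unfolding arcs_inv_def Let_def r(1-3) using u True w(1) X_ge(1) by simp
    with work show ?thesis by simp
  next
    case False
    then have i: "i = length (L ! u)" using D(1) by simp
    let ?s = "run (arcs_body d) s"
    have run: "?s = s\<lparr>reg := (reg s)(7 := Suc u, 8 := 0, 9 := 0)\<rparr>"
      using False deg_u unfolding arcs_body_def by (simp add: ui)
    have sc: "scanned ?q (Suc u) 0 = ?D"
      using scanned_next[OF uq(3,1)] uq(2) i by simp
    have "slots p ?D (Suc (Suc u)) = []" if "Suc u < n"
      unfolding sc[symmetric] using that by (auto simp: slots_def scanned_def)
    moreover have "tables p ?D ?s"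
      by (rule tables_cong[OF D(5)]) (simp_all add: run)
    ultimately have "arcs_inv p (Suc j) ?s"
      unfolding arcs_inv_def Let_def using D(2,4) u by (simp add: run sc)
    with work show ?thesis by simp
  qed
qed

lemma reaches_tabled:
  assumes W: "X ^ growth (arcs_loop d) < W"
  shows "reaches W (arcs_loop d) ((work + 1) * ccost (arcs_loop d)) peeled tabled"
  unfolding reaches_def
proof (intro allI impI)
  fix s0 assume s0: "peeled s0"
  define p where "p = arr s0 4"
  have c0: "common s0" "fresh 5 7 s0" "elimination p" 
    using s0 by (simp_all add: peeled_def p_def)
  have lf: "loopfree (arcs_body d)" "consts_le X (arcs_loop d)"
    using X_ge(2,5) by (simp_all add: arcs_body_def)
  have wr: "written_regs (arcs_body d) = {2, 7, 8, 9}" "written_arrs (arcs_body d) = {5, 6}"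
    by (auto simp: arcs_body_def)
  let ?b = "Bin Less (Reg 7) (Reg 0)"
  have "\<exists>t j s. exec W (arcs_loop d) s0 t s \<and> t \<le> (work + 1) * ccost (arcs_loop d) \<and>
    arcs_inv p j s \<and> val s ?b = 0 \<and> frame (arcs_body d) s0 s \<and> bounded X s"
  proof (rule exec_while[OF lf X_ge(5) W])
    have "reg s0 7 = 0" "reg s0 8 = 0" "reg s0 9 = 0" "reg s0 2 \<le> X" "arr s0 5 = (\<lambda>_. 0)" "arr s0 6 = (\<lambda>_. 0)"
      using c0(1,2) by (simp_all add: freshD[OF c0(2)] common_def bounded_def fun_eq_iff)
    moreover have "scanned [0..<n] 0 0 = (\<lambda>_. [])"
      by (simp add: scanned_def fun_eq_iff)
    ultimately show "arcs_inv p 0 s0"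
      unfolding arcs_inv_def Let_def by (simp add: tables_def slots_def nth0_def)
  next
    fix j s assume I: "arcs_inv p j s" "frame (arcs_body d) s0 s" "val s ?b \<noteq> 0"
    have "arr s 0 = arr (input_state L) 0" "arr s 1 = arr (input_state L) 1" "reg s 0 = n" "arr s 4 = p"
      using frame_arr[OF I(2)] frame_reg[OF I(2)] c0(1) by (auto simp: wr common_def p_def)
    moreover from this I(3) have "reg s 7 < n" by (simp split: if_splits)
    ultimately show "j < work \<and> arcs_inv p (Suc j) (run (arcs_body d) s)"
      using arcs_step[OF I(1)] c0(3) by blast
  next
    fix j s assume I: "arcs_inv p j s"
    let ?D = "scanned [0..<n] (reg s 7) (reg s 8)"
    have "reg s 8 \<le> n" using I length_L_le[of "reg s 7"]
      unfolding arcs_inv_def Let_def by (auto split: if_splits)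
    moreover have "reg s 9 \<le> d"
    proof (cases "reg s 7 < n")
      case True
      have "length (slots p ?D (Suc (reg s 7))) \<le> d"
        by (rule length_slots[OF c0(3)]) (use True distinct_scanned scanned_subset in auto)
      with True I show ?thesis unfolding arcs_inv_def Let_def by simp
    qed (use I in \<open>simp add: arcs_inv_def Let_def\<close>)
    moreover have "reg s 7 \<le> n" "reg s 2 \<le> X" "\<And>i. arr s 5 i \<le> 1" "\<And>i. arr s 6 i \<le> n"
      using I by (auto simp: arcs_inv_def Let_def tables_def)
    ultimately show "(\<forall>x \<in> written_regs (arcs_body d). reg s x \<le> X) \<and> 
        (\<forall>a \<in> written_arrs (arcs_body d). \<forall>i. arr s a i \<le> X)"
      using X_ge(1,2,5) unfolding wr by (auto intro: order.trans[of _ n] order.trans[of _ 1])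
  qed (use c0 in \<open>simp add: common_def\<close>)
  then obtain t j s where s: "exec W (arcs_loop d) s0 t s" "t \<le> (work + 1) * ccost (arcs_loop d)"
    "arcs_inv p j s" "val s ?b = 0" "frame (arcs_body d) s0 s" "bounded X s" by blast
  have c: "common s" "fresh 7 10 s"
    using common_frame[OF c0(1) s(5,6)] fresh_frame[OF s(5) c0(2), of 7 10] by (auto simp: wr)
  have "reg s 7 = n" "reg s 8 = 0" and t: "tables p (scanned [0..<n] (reg s 7) (reg s 8)) s"
    using s(3,4) c(1) unfolding arcs_inv_def Let_def common_def by (auto split: if_splits)
  then have "scanned [0..<n] (reg s 7) (reg s 8) a = L ! a" if "a < n" for a
    using that by (simp add: scanned_def)
  then have "tables p ((!) L) s"
    using t unfolding tables_def slots_def by auto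
  with c c0(3) have "tabled s" by (auto simp: tabled_def)
  with s show "\<exists>t s. exec W (arcs_loop d) s0 t s \<and> t \<le> (work + 1) * ccost (arcs_loop d) \<and> tabled s"
    by blast
qed

end

section \<open>Counting common predecessors\<close>

definition quads :: "'a list \<Rightarrow> ('a \<times> 'a \<times> 'a \<times> 'a) list" where
  "quads xs = List.product xs (List.product xs (List.product xs xs))"

lemma set_quads: "set (quads xs) = set xs \<times> set xs \<times> set xs \<times> set xs"
  by (simp add: quads_def)

lemma distinct_quads: "distinct xs \<Longrightarrow> distinct (quads xs)"
  by (simp add: quads_def distinct_product)

lemma length_quads: "length (quads xs) = length xs ^ 4"
  by (simp add: quads_def length_product power4_eq_xxxx)

definition slot :: "nat \<Rightarrow> exp \<Rightarrow> nat \<Rightarrow> exp" where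
  "slot d e i = Load 6 (add_exp (mult_exp e (Const d)) (Const i))"

definition key_exp :: "exp \<Rightarrow> exp \<Rightarrow> exp \<Rightarrow> exp \<Rightarrow> exp" where
  "key_exp a b c e = (let B = add_exp (Reg 0) (Const 2) in
     add_exp (mult_exp (add_exp (mult_exp (add_exp (mult_exp a B) b) B) c) B) e)"

text \<open>Quadruples involving empty slots are counted as well, under keys with a component 0; the
  entries at such keys decide no test.\<close>

definition bump :: "nat \<Rightarrow> nat \<times> nat \<times> nat \<times> nat \<Rightarrow> com" where
  "bump d = (\<lambda>(i, j, k, l). let v = add_exp (Reg 10) (Const 1);
       K = key_exp (slot d v i) (slot d v j) (slot d v k) (slot d v l)
     in Store 7 K (add_exp (Load 7 K) (Const 1)))"

definition count_body :: "nat \<Rightarrow> com" where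
  "count_body d = Seq (seqs (map (bump d) (quads [0..<d]))) (inc 10)"

abbreviation "count_loop d \<equiv> While (Bin Less (Reg 10) (Reg 0)) (count_body d)"

lemma card_nth0_eq:
  assumes "distinct xs" "length xs \<le> d" "a \<noteq> 0"
  shows "card {i. i < d \<and> nth0 xs i = a} = of_bool (a \<in> set xs)"
proof (cases "a \<in> set xs")
  case True
  then obtain i where i: "i < length xs" "xs ! i = a" by (auto simp: in_set_conv_nth)
  then have "{j. j < d \<and> nth0 xs j = a} = {i}"
    using assms by (auto simp: nth0_def nth_eq_iff_index_eq split: if_splits)
  with True show ?thesis by simp
next
  case False
  then have "{j. j < d \<and> nth0 xs j = a} = {}"
    using assms(3) by (auto simp: nth0_def split: if_splits)
  with False show ?thesis by simp
qed

lemma nth0_mem: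
  assumes "length xs \<le> d" "a \<noteq> 0"
  shows "(\<exists>i < d. nth0 xs i = a) \<longleftrightarrow> a \<in> set xs"
  using assms by (fastforce simp: nth0_def in_set_conv_nth split: if_splits)

section \<open>The orientation given by an elimination order\<close>

locale eliminated = degenerate_lists +
  fixes p :: "nat \<Rightarrow> nat"
  assumes elim: "elimination p"
begin

abbreviation ol :: "nat \<Rightarrow> nat list" where "ol \<equiv> slots p ((!) L)"

sublocale oriented_graph n d ol "\<lambda>u. p (u - 1)"
proof
  show "distinct (ol u)" for u
    by (auto simp: slots_def distinct_map distinct_L)
  show "length (ol u) \<le> d" for u
    using length_slots[OF elim, of "(!) L" u] distinct_L by (cases "u \<in> {1..n}") (auto simp: slots_def)
  show "u \<in> {1..n} \<and> w \<in> {1..n} \<and> p (u - 1) < p (w - 1)" if "w \<in> set (ol u)" for u w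
    using that range_L[of "u - 1"] by (fastforce simp: slots_def split: if_splits)
qed

lemma in_ol_iff:
  "w \<in> set (ol u) \<longleftrightarrow> u \<in> {1..n} \<and> w \<in> Suc ` {b \<in> set (L ! (u - 1)). p (u - 1) < p b}"
  by (auto simp: slots_def)

text \<open>As \<open>p\<close> is injective, every edge receives a direction, and forgetting the
  directions gives back the graph.\<close>

lemma E_Suc_iff:
  assumes "a < n" "b < n"
  shows "E (Suc a) (Suc b) \<longleftrightarrow> b \<in> set (L ! a)"
proof -
  have "Suc b \<in> set (ol (Suc a)) \<longleftrightarrow> b \<in> set (L ! a) \<and> p a < p b"
    "Suc a \<in> set (ol (Suc b)) \<longleftrightarrow> a \<in> set (L ! b) \<and> p b < p a"
    using assms by (auto simp: in_ol_iff)
  moreover have "a \<in> set (L ! b) \<longleftrightarrow> b \<in> set (L ! a)"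
    using assms sym_L by blast
  moreover have "p a \<noteq> p b" if "b \<in> set (L ! a)"
  proof
    assume "p a = p b"
    with elim assms have "a = b" unfolding elimination_def by (auto dest: inj_onD)
    with range_L[OF assms(1) that] show False by simp
  qed
  ultimately show ?thesis
    unfolding E_def by (meson linorder_neqE_nat)
qed

lemma E_iff: "E u w \<longleftrightarrow> u \<in> {1..n} \<and> w \<in> Suc ` set (L ! (u - 1))"
proof
  assume E: "E u w"
  have V: "u \<in> {1..n}" "w \<in> {1..n}"
    using E_verts[OF E] by simp_all
  then have "u = Suc (u - 1)" "w = Suc (w - 1)" "u - 1 < n" "w - 1 < n" by auto
  with E E_Suc_iff have "w - 1 \<in> set (L ! (u - 1))" by metis
  then have "Suc (w - 1) \<in> Suc ` set (L ! (u - 1))" by (rule imageI)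
  with V show "u \<in> {1..n} \<and> w \<in> Suc ` set (L ! (u - 1))" by simp
next
  assume "u \<in> {1..n} \<and> w \<in> Suc ` set (L ! (u - 1))"
  then obtain a b where ab: "u = Suc a" "a < n" "w = Suc b" "b \<in> set (L ! a)"
    by (cases u) auto
  then have "b < n" using range_L by blast
  with ab show "E u w" by (simp add: E_Suc_iff)
qed

section \<open>The table of common predecessors\<close>

definition key4 :: "nat \<Rightarrow> nat \<Rightarrow> nat \<Rightarrow> nat \<Rightarrow> nat" where
  "key4 a b c e = ((a * (n + 2) + b) * (n + 2) + c) * (n + 2) + e"

text \<open>The arguments are digits in base \<open>n + 2\<close>, with \<open>a\<close> as what
  remains after the other three are split off.\<close>

lemma key4_inj:
  assumes "b \<le> n + 1" "c \<le> n + 1" "e \<le> n + 1" "b' \<le> n + 1" "c' \<le> n + 1" "e' \<le> n + 1"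
  shows "key4 a b c e = key4 a' b' c' e' \<longleftrightarrow> a = a' \<and> b = b' \<and> c = c' \<and> e = e'"
proof -
  have lt: "b < n + 2" "b' < n + 2" "c < n + 2" "c' < n + 2" "e < n + 2" "e' < n + 2"
    using assms by simp_all
  show ?thesis
    unfolding key4_def key_inj[OF lt(5,6)] key_inj[OF lt(3,4)] key_inj[OF lt(1,2)] by blast
qed

lemma nth0_ol_le: "nth0 (ol u) i \<le> n"
  using ol_set[of "ol u ! i" u] by (auto simp: nth0_def)

definition hits :: "nat \<Rightarrow> nat \<Rightarrow> nat" where
  "hits u x = length (filter (\<lambda>(i, j, k, l).
     key4 (nth0 (ol u) i) (nth0 (ol u) j) (nth0 (ol u) k) (nth0 (ol u) l) = x) (quads [0..<d]))"

lemma hits_le: "hits u x \<le> d ^ 4"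
  unfolding hits_def by (rule order.trans[OF length_filter_le]) (simp add: length_quads)

text \<open>Out-neighbours are listed without repetition, so a nonzero name occupies at most one
  slot, and a quadruple of names at most one quadruple of slots. Slots may repeat within a
  quadruple; hence names may coincide, and one table answers for pairs and triples, too.\<close>

lemma hits_key4:
  assumes "a \<in> {1..n+1}" "b \<in> {1..n+1}" "c \<in> {1..n+1}" "e \<in> {1..n+1}"
  shows "hits u (key4 a b c e) = of_bool ({a, b, c, e} \<subseteq> set (ol u))"
proof -
  let ?I = "\<lambda>a. {i. i < d \<and> nth0 (ol u) i = a}"
  have le: "nth0 (ol u) i \<le> n + 1" for i using nth0_ol_le[of u i] by simp
  have "hits u (key4 a b c e) = card (set (filter (\<lambda>(i, j, k, l).
     key4 (nth0 (ol u) i) (nth0 (ol u) j) (nth0 (ol u) k) (nth0 (ol u) l) = key4 a b c e) (quads [0..<d])))"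
    unfolding hits_def by (intro distinct_card[symmetric] distinct_filter distinct_quads distinct_upt)
  also have "set (filter (\<lambda>(i, j, k, l).
     key4 (nth0 (ol u) i) (nth0 (ol u) j) (nth0 (ol u) k) (nth0 (ol u) l) = key4 a b c e) (quads [0..<d]))
     = ?I a \<times> ?I b \<times> ?I c \<times> ?I e"
    using assms le by (auto simp: set_quads key4_inj)
  also have "card \<dots> = card (?I a) * (card (?I b) * (card (?I c) * card (?I e)))"
    by (simp add: card_cartesian_product)
  also have "\<dots> = of_bool ({a, b, c, e} \<subseteq> set (ol u))"
    using assms card_nth0_eq[OF ol_distinct ol_length] by auto
  finally show ?thesis .
qed

lemma sum_hits:
  assumes "a \<in> {1..n+1}" "b \<in> {1..n+1}" "c \<in> {1..n+1}" "e \<in> {1..n+1}"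
  shows "(\<Sum>u < n. hits (Suc u) (key4 a b c e)) = joint a b c e"
proof -
  have "(\<Sum>u < n. hits (Suc u) (key4 a b c e)) = (\<Sum>s \<in> {1..n}. of_bool ({a, b, c, e} \<subseteq> set (ol s)))"
    using hits_key4[OF assms] by (simp add: sum.atLeast1_atMost_eq del: of_bool_eq_0_iff)
  also have "\<dots> = joint a b c e"
    unfolding joint_def by (simp add: of_bool_def sum.If_cases Int_def del: insert_subset)
  finally show ?thesis .
qed

lemma run_bumps:
  assumes "reg s 0 = n" "\<And>i. i < d \<Longrightarrow> arr s 6 (Suc (reg s 10) * d + i) = nth0 (ol u) i"
    "set xs \<subseteq> set (quads [0..<d])"
  shows "run (seqs (map (bump d) xs)) s = s\<lparr>arr := (arr s)(7 := \<lambda>x. arr s 7 x + length (filter (\<lambda>(i, j, k, l).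
     key4 (nth0 (ol u) i) (nth0 (ol u) j) (nth0 (ol u) k) (nth0 (ol u) l) = x) xs))\<rparr>"
  using assms
proof (induction xs arbitrary: s)
  case Nil
  have "(arr s)(7 := \<lambda>x. arr s 7 x) = arr s" by (rule fun_upd_triv)
  then show ?case by simp
next
  case (Cons x xs)
  obtain i j k l where x: "x = (i, j, k, l)" by (cases x) auto
  then have ijkl: "i < d" "j < d" "k < d" "l < d"
    using Cons.prems(3) by (auto simp: set_quads)
  let ?K = "key4 (nth0 (ol u) i) (nth0 (ol u) j) (nth0 (ol u) k) (nth0 (ol u) l)"
  let ?s = "run (bump d x) s"
  have s': "?s = s\<lparr>arr := (arr s)(7 := (arr s 7)(?K := Suc (arr s 7 ?K)))\<rparr>"
    using Cons.prems(1) Cons.prems(2)[OF ijkl(1)] Cons.prems(2)[OF ijkl(2)] Cons.prems(2)[OF ijkl(3)]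
      Cons.prems(2)[OF ijkl(4)]
    by (simp add: bump_def x key_exp_def slot_def key4_def Let_def)
  have IH: "run (seqs (map (bump d) xs)) ?s = ?s\<lparr>arr := (arr ?s)(7 := \<lambda>x. arr ?s 7 x + length (filter (\<lambda>(i, j, k, l).
     key4 (nth0 (ol u) i) (nth0 (ol u) j) (nth0 (ol u) k) (nth0 (ol u) l) = x) xs))\<rparr>"
    by (rule Cons.IH) (use Cons.prems in \<open>simp_all add: s'\<close>)
  have "run (seqs (map (bump d) (x # xs))) s = run (seqs (map (bump d) xs)) ?s" by simp
  also note IH
  finally show ?case
    unfolding s' by (rule trans, intro state.equality) (auto simp: x fun_eq_iff)
qed

definition counted :: "state \<Rightarrow> bool" where
  "counted s \<longleftrightarrow> common s \<and> fresh 8 11 s \<and> tables p ((!) L) s \<and>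
     (\<forall>a \<in> {1..n+1}. \<forall>b \<in> {1..n+1}. \<forall>c \<in> {1..n+1}. \<forall>e \<in> {1..n+1}. arr s 7 (key4 a b c e) = joint a b c e)"

lemma reaches_counted:
  assumes W: "X ^ growth (count_loop d) < W"
  shows "reaches W (count_loop d) ((n + 1) * ccost (count_loop d))
    (\<lambda>s. common s \<and> fresh 7 10 s \<and> tables p ((!) L) s) counted"
  unfolding reaches_def
proof (intro allI impI, elim conjE)
  fix s0 assume c0: "common s0" "fresh 7 10 s0" "tables p ((!) L) s0"
  have lf: "loopfree (count_body d)" "consts_le X (count_loop d)"
    using X_ge(2,5) by (auto simp: count_body_def loopfree_seqs consts_le_seqs bump_def slot_def key_exp_def Let_def set_quads)
  have wr: "written_regs (count_body d) = {10}" "written_arrs (count_body d) \<subseteq> {7}"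
    by (auto simp: count_body_def written_regs_seqs written_arrs_seqs bump_def Let_def)
  let ?b = "Bin Less (Reg 10) (Reg 0)"
  have tb: "arr s0 6 (u * d + i) = nth0 (ol u) i" if "i < d" for i u
    using c0(3) that by (simp add: tables_def)
  define I where "I v s \<longleftrightarrow> reg s 10 = v \<and> v \<le> n \<and> (\<forall>x. arr s 7 x = (\<Sum>u < v. hits (Suc u) x))"
    for v and s :: state
  have "\<exists>t j s. exec W (count_loop d) s0 t s \<and> t \<le> (n + 1) * ccost (count_loop d) \<and>
    I j s \<and> val s ?b = 0 \<and> frame (count_body d) s0 s \<and> bounded X s"
  proof (rule exec_while[OF lf X_ge(5) W])
    show "I 0 s0" using c0 by (simp add: I_def freshD[OF c0(2)])
  next
    fix v s assume I: "I v s" "frame (count_body d) s0 s" "val s ?b \<noteq> 0"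
    have "6 \<notin> written_arrs (count_body d)" using wr(2) by auto
    then have s: "reg s 0 = n" "arr s 6 = arr s0 6"
      using frame_arr[OF I(2), of 6] frame_reg[OF I(2)] c0(1) wr(1) by (auto simp: common_def)
    have v: "v < n" "reg s 10 = v" using I s(1) by (auto simp: I_def split: if_splits)
    have "run (seqs (map (bump d) (quads [0..<d]))) s = s\<lparr>arr := (arr s)(7 := \<lambda>x. arr s 7 x + hits (Suc v) x)\<rparr>"
      unfolding hits_def by (rule run_bumps) (use s v tb[of _ "Suc v"] in auto)
    then have "run (count_body d) s = s\<lparr>reg := (reg s)(10 := Suc v), arr := (arr s)(7 := \<lambda>x. arr s 7 x + hits (Suc v) x)\<rparr>"
      using v by (simp add: count_body_def)
    then show "v < n \<and> I (Suc v) (run (count_body d) s)"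
      using I(1) v by (simp add: I_def)
  next
    fix v s assume I: "I v s"
    have "arr s 7 x \<le> X" for x
    proof -
      have "arr s 7 x = (\<Sum>u < v. hits (Suc u) x)" using I by (simp add: I_def)
      also have "\<dots> \<le> (\<Sum>u < v. d ^ 4)" by (intro sum_mono hits_le)
      also have "\<dots> \<le> n * d ^ 4" using I by (simp add: I_def)
      also have "\<dots> \<le> X" by (rule X_ge(4))
      finally show ?thesis .
    qed
    with I show "(\<forall>x \<in> written_regs (count_body d). reg s x \<le> X) \<and> 
        (\<forall>a \<in> written_arrs (count_body d). \<forall>i. arr s a i \<le> X)"
      using X_ge(1) wr by (auto simp: I_def)
  qed (use c0 in \<open>simp add: common_def\<close>)
  then obtain t v s where s: "exec W (count_loop d) s0 t s" "t \<le> (n + 1) * ccost (count_loop d)"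
    "I v s" "val s ?b = 0" "frame (count_body d) s0 s" "bounded X s" by blast
  have "common s"
    by (rule common_frame[OF c0(1) s(5,6)]) (use wr in auto)
  moreover have "fresh 8 11 s"
    by (rule fresh_frame[OF s(5) c0(2)]) (use wr in auto)
  ultimately have c: "common s" "fresh 8 11 s" by simp_all
  have "arr s 5 = arr s0 5" "arr s 6 = arr s0 6"
    using wr by (auto intro!: frame_arr[OF s(5)])
  then have t: "tables p ((!) L) s" by (rule tables_cong[OF c0(3)])
  have "v = n" using s(3,4) c(1) by (auto simp: I_def common_def split: if_splits)
  then have "counted s"
    using c t s(3) sum_hits by (simp add: counted_def I_def)
  with s show "\<exists>t s. exec W (count_loop d) s0 t s \<and> t \<le> (n + 1) * ccost (count_loop d) \<and> counted s"
    by blast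
qed

end

section \<open>Searching for a path\<close>

definition sum_exp :: "exp list \<Rightarrow> exp" where
  "sum_exp es = foldr add_exp es (Const 0)"

abbreviation "not_exp e \<equiv> Bin Equal e (Const 0)"

definition mem_exp :: "nat \<Rightarrow> exp \<Rightarrow> exp \<Rightarrow> exp" where
  "mem_exp d t u = sum_exp (map (\<lambda>i. Bin Equal (slot d u i) t) [0..<d])"

text \<open>Different expressions may denote the same vertex. An entry is therefore counted only if
  no later entry has its value.\<close>

primrec count_distinct :: "(exp \<Rightarrow> exp) \<Rightarrow> exp list \<Rightarrow> exp" where
  "count_distinct g [] = Const 0"
| "count_distinct g (e # es) =
     add_exp (mult_exp (not_exp (sum_exp (map (Bin Equal e) es))) (Bin Less (Const 0) (g e))) (count_distinct g es)"

definition adj_exp :: "exp \<Rightarrow> exp \<Rightarrow> exp" where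
  "adj_exp a b = Load 5 (add_exp (mult_exp a (add_exp (Reg 0) (Const 2))) b)"

definition joint_exp :: "exp \<Rightarrow> exp \<Rightarrow> exp \<Rightarrow> exp \<Rightarrow> exp" where
  "joint_exp a b c e = Load 7 (key_exp a b c e)"

text \<open>For \<open>k = 3\<close> the two dummies are supplied by \<open>mid_exp\<close>, so only
  the edge between the ends is left to test.\<close>

definition pattern_exp :: "nat \<Rightarrow> exp \<Rightarrow> exp \<Rightarrow> exp \<Rightarrow> exp \<Rightarrow> exp" where
  "pattern_exp k t1 z1 z2 t2 =
     (if k = 3 then adj_exp t1 t2
      else if k = 4 then mult_exp (Bin Equal z1 z2) (mult_exp (not_exp (Bin Equal t1 t2))
        (mult_exp (adj_exp t1 z1) (mult_exp (adj_exp z1 t2) (not_exp (adj_exp t1 t2)))))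
      else mult_exp (adj_exp t1 z1) (mult_exp (adj_exp z1 z2) (mult_exp (adj_exp z2 t2)
        (mult_exp (not_exp (adj_exp t1 z2)) (mult_exp (not_exp (adj_exp t1 t2)) (not_exp (adj_exp z1 t2)))))))"

definition barred_exp :: "nat \<Rightarrow> exp \<Rightarrow> exp \<Rightarrow> exp \<Rightarrow> exp \<Rightarrow> exp" where
  "barred_exp d t1 z1 z2 t2 =
     count_distinct (\<lambda>s. mult_exp (mem_exp d t1 s) (mult_exp (mem_exp d t2 s)
         (mult_exp (not_exp (mem_exp d z1 s)) (not_exp (mem_exp d z2 s)))))
       (z1 # z2 # map (slot d z1) [0..<d] @ map (slot d z2) [0..<d])"

definition test_exp :: "nat \<Rightarrow> nat \<Rightarrow> exp \<Rightarrow> exp \<Rightarrow> exp \<Rightarrow> exp \<Rightarrow> exp" where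
  "test_exp k d t1 z1 z2 t2 = mult_exp (pattern_exp k t1 z1 z2 t2)
     (Bin Less (add_exp (add_exp (joint_exp t1 t2 z1 z1) (joint_exp t1 t2 z2 z2)) (barred_exp d t1 z1 z2 t2))
        (add_exp (joint_exp t1 t2 t2 t2) (joint_exp t1 t2 z1 z2)))"

type_synonym route = "nat \<times> nat \<times> nat"

text \<open>Slots are numbered below \<open>d\<close>; the index \<open>d\<close> encodes staying in
  place.\<close>

definition hop_exp :: "nat \<Rightarrow> nat \<Rightarrow> exp \<Rightarrow> exp" where
  "hop_exp d i e = (if i = d then e else slot d e i)"

definition reach_exp :: "nat \<Rightarrow> exp \<Rightarrow> route \<Rightarrow> exp" where
  "reach_exp d e = (\<lambda>(i, j, l). hop_exp d l (hop_exp d j (hop_exp d i e)))"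

definition mid_exp :: "nat \<Rightarrow> nat \<Rightarrow> exp \<Rightarrow> route \<Rightarrow> exp" where
  "mid_exp k d e q = (if k = 3 then add_exp (Reg 0) (Const 1) else reach_exp d e q)"

definition routes :: "nat \<Rightarrow> route list" where
  "routes d = List.product [0..<Suc d] (List.product [0..<Suc d] [0..<Suc d])"

text \<open>A success replaces all four registers of the path together, so they always hold a single
  path and never a mixture.\<close>

definition search_cmd :: "nat \<Rightarrow> nat \<Rightarrow> route \<times> route \<times> route \<times> route \<Rightarrow> com" where
  "search_cmd k d = (\<lambda>(q1, q2, q3, q4).
     let v = add_exp (Reg 11) (Const 1);
       t1 = reach_exp d v q1; z1 = mid_exp k d v q2; z2 = mid_exp k d v q3; t2 = reach_exp d v q4
     in Cond (test_exp k d t1 z1 z2 t2)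
       (Seq (Assign 13 t1) (Seq (Assign 14 z1) (Seq (Assign 15 z2) (Seq (Assign 16 t2) (Assign 12 (Const 1))))))
       Skip)"

definition search_body :: "nat \<Rightarrow> nat \<Rightarrow> com" where
  "search_body k d = Seq (seqs (map (search_cmd k d) (quads (routes d)))) (inc 11)"

text \<open>The scan tests adjacency and not precedence, so it may hit a vertex that the count did
  not see; by \<open>closer_cycle\<close> any such vertex completes an induced cycle as
  well.\<close>

definition scan_body :: com where
  "scan_body = (let v = add_exp (Reg 17) (Const 1) in
     Seq (Cond (mult_exp (adj_exp v (Reg 13)) (mult_exp (adj_exp v (Reg 16))
         (mult_exp (not_exp (adj_exp v (Reg 14))) (mult_exp (not_exp (adj_exp v (Reg 15)))
         (mult_exp (not_exp (Bin Equal v (Reg 14))) (not_exp (Bin Equal v (Reg 15))))))))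
       (Assign 18 v) Skip) (inc 17))"

text \<open>Subtracting 1 turns names back into vertices. The cells follow the order of the list in
  \<open>closer_cycle\<close>, so that for every \<open>k\<close> the first \<open>k\<close> of them
  form the cycle.\<close>

definition emit :: com where
  "emit = (let pred = (\<lambda>x. Bin Sub (Reg x) (Const 1)) in
     Seq (Store 0 (Const 0) (pred 13)) (Seq (Store 0 (Const 1) (pred 16)) (Seq (Store 0 (Const 2) (pred 18))
       (Seq (Store 0 (Const 3) (pred 14)) (Seq (Store 0 (Const 4) (pred 15)) (Assign 0 (Reg 12)))))))"

abbreviation "search_loop k d \<equiv> While (Bin Less (Reg 11) (Reg 0)) (search_body k d)"
abbreviation "scan_loop \<equiv> While (Bin Less (Reg 17) (Reg 0)) scan_body"

lemma loopfree_search_cmd: "loopfree (search_cmd k d x)"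
  by (cases x) (simp add: search_cmd_def Let_def)

lemma val_sum_exp: "val s (sum_exp es) \<noteq> 0 \<longleftrightarrow> (\<exists>e \<in> set es. val s e \<noteq> 0)"
  by (induction es) (auto simp: sum_exp_def)

lemma val_mem_exp: "val s (mem_exp d t u) \<noteq> 0 \<longleftrightarrow> (\<exists>i < d. val s (slot d u i) = val s t)"
  unfolding mem_exp_def val_sum_exp by auto

lemma val_count_distinct:
  assumes "\<And>e. e \<in> set es \<Longrightarrow> val s (g e) \<noteq> 0 \<longleftrightarrow> P (val s e)"
  shows "val s (count_distinct g es) = card {x \<in> val s ` set es. P x}"
  using assms
proof (induction es)
  case (Cons e es)
  let ?A = "{x \<in> val s ` set es. P x}"
  have dup: "val s (sum_exp (map (Bin Equal e) es)) = 0 \<longleftrightarrow> val s e \<notin> val s ` set es"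
    using val_sum_exp[of s "map (Bin Equal e) es"] by (auto split: if_splits)
  have IH: "val s (count_distinct g es) = card ?A"
    by (rule Cons.IH) (use Cons.prems in simp)
  have eq: "{x \<in> val s ` set (e # es). P x} = (if P (val s e) then insert (val s e) ?A else ?A)"
    by auto
  have "card {x \<in> val s ` set (e # es). P x} = of_bool (val s e \<notin> val s ` set es \<and> P (val s e)) + card ?A"
    unfolding eq by (simp add: card_insert_if)
  with IH dup Cons.prems[of e] show ?case by simp
qed simp

lemma exp_consts_le_sum_exp: "exp_consts_le X (sum_exp es) \<longleftrightarrow> (\<forall>e \<in> set es. exp_consts_le X e)"
  by (induction es) (auto simp: sum_exp_def)

lemma exp_consts_le_count_distinct:
  "(\<And>e. e \<in> set es \<Longrightarrow> exp_consts_le X e \<and> exp_consts_le X (g e)) \<Longrightarrow> exp_consts_le X (count_distinct g es)"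
  by (induction es) (auto simp: exp_consts_le_sum_exp)

context
  fixes d X :: nat
  assumes X: "d + 1 \<le> X" "2 \<le> X"
begin

lemma exp_consts_le_slot: "exp_consts_le X e \<Longrightarrow> i < d \<Longrightarrow> exp_consts_le X (slot d e i)"
  using X by (simp add: slot_def)

lemma exp_consts_le_mem: "exp_consts_le X t \<Longrightarrow> exp_consts_le X u \<Longrightarrow> exp_consts_le X (mem_exp d t u)"
  by (auto simp: mem_exp_def exp_consts_le_sum_exp exp_consts_le_slot)

lemma exp_consts_le_reach: "exp_consts_le X e \<Longrightarrow> q \<in> set (routes d) \<Longrightarrow> exp_consts_le X (reach_exp d e q)"
  by (auto simp: reach_exp_def routes_def hop_exp_def exp_consts_le_slot)

lemma exp_consts_le_test:
  assumes "exp_consts_le X t1" "exp_consts_le X z1" "exp_consts_le X z2" "exp_consts_le X t2"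
  shows "exp_consts_le X (test_exp k d t1 z1 z2 t2)"
proof -
  have "exp_consts_le X (barred_exp d t1 z1 z2 t2)"
    unfolding barred_exp_def
    by (rule exp_consts_le_count_distinct) (use assms in \<open>auto intro!: exp_consts_le_mem exp_consts_le_slot\<close>)
  then show ?thesis
    using assms X by (simp add: test_exp_def pattern_exp_def adj_exp_def joint_exp_def key_exp_def Let_def)
qed

lemma consts_le_search_cmd:
  assumes "x \<in> set (quads (routes d))"
  shows "consts_le X (search_cmd k d x)"
proof -
  obtain q1 q2 q3 q4 where x: "x = (q1, q2, q3, q4)" by (cases x) auto
  with assms have q: "q1 \<in> set (routes d)" "q2 \<in> set (routes d)" "q3 \<in> set (routes d)" "q4 \<in> set (routes d)"
    by (simp_all add: set_quads)
  let ?v = "add_exp (Reg 11) (Const 1)"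
  have v: "exp_consts_le X ?v" using X by simp
  have "exp_consts_le X (reach_exp d ?v q)" "exp_consts_le X (mid_exp k d ?v q)" if "q \<in> set (routes d)" for q
    using exp_consts_le_reach[OF v that] X by (simp_all add: mid_exp_def)
  with q show ?thesis
    using X by (simp add: x search_cmd_def Let_def exp_consts_le_test)
qed

end

context eliminated
begin

section \<open>Values of the expressions used in the search\<close>

definition ready :: "state \<Rightarrow> bool" where
  "ready s \<longleftrightarrow> reg s 0 = n \<and> tables p ((!) L) s \<and>
     (\<forall>a \<in> {1..n+1}. \<forall>b \<in> {1..n+1}. \<forall>c \<in> {1..n+1}. \<forall>e \<in> {1..n+1}. arr s 7 (key4 a b c e) = joint a b c e)"

lemma ready_cong: "ready s \<Longrightarrow> reg s' 0 = reg s 0 \<Longrightarrow> arr s' = arr s \<Longrightarrow> ready s'"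
  by (simp add: ready_def tables_def)

lemma val_slot: "ready s \<Longrightarrow> i < d \<Longrightarrow> val s (slot d e i) = nth0 (ol (val s e)) i"
  by (simp add: slot_def ready_def tables_def)

lemma val_adj_exp:
  "ready s \<Longrightarrow> val s a \<le> n + 1 \<Longrightarrow> val s b \<le> n + 1 \<Longrightarrow> val s (adj_exp a b) = of_bool (E (val s a) (val s b))"
  unfolding adj_exp_def ready_def tables_def E_iff by simp

lemma val_joint_exp:
  "ready s \<Longrightarrow> val s a \<in> {1..n+1} \<Longrightarrow> val s b \<in> {1..n+1} \<Longrightarrow> val s c \<in> {1..n+1} \<Longrightarrow> val s e \<in> {1..n+1} \<Longrightarrow>
     val s (joint_exp a b c e) = joint (val s a) (val s b) (val s c) (val s e)"
  unfolding ready_def by (simp add: joint_exp_def key_exp_def key4_def Let_def)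

lemma val_mem_ol:
  assumes "ready s" "val s t \<noteq> 0"
  shows "val s (mem_exp d t u) \<noteq> 0 \<longleftrightarrow> val s t \<in> set (ol (val s u))"
proof -
  have "val s (mem_exp d t u) \<noteq> 0 \<longleftrightarrow> (\<exists>i < d. nth0 (ol (val s u)) i = val s t)"
    unfolding val_mem_exp using val_slot[OF assms(1)] by auto
  also have "\<dots> \<longleftrightarrow> val s t \<in> set (ol (val s u))"
    by (rule nth0_mem[OF ol_length assms(2)])
  finally show ?thesis .
qed

lemma val_barred_exp:
  assumes s: "ready s" and nz: "val s t1 \<noteq> 0" "val s z1 \<noteq> 0" "val s z2 \<noteq> 0" "val s t2 \<noteq> 0"
  shows "val s (barred_exp d t1 z1 z2 t2) = card (barred (val s t1) (val s z1) (val s z2) (val s t2))"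
proof -
  let ?P = "\<lambda>x. val s t1 \<in> set (ol x) \<and> val s t2 \<in> set (ol x) \<and> val s z1 \<notin> set (ol x) \<and> val s z2 \<notin> set (ol x)"
  let ?es = "z1 # z2 # map (slot d z1) [0..<d] @ map (slot d z2) [0..<d]"
  \<comment> \<open>Empty slots among the candidates read as 0, which precedes nothing, so they drop
    out of the count.\<close>
  have P0: "\<not> ?P 0" by (simp add: slots_def)
  have im: "x \<in> nth0 (ol u) ` {..<d} \<longleftrightarrow> x \<in> set (ol u)" if "?P x" for x u
  proof -
    have "x \<noteq> 0" using P0 that by metis
    from nth0_mem[OF ol_length this, of u] show ?thesis by auto
  qed
  have sl: "(\<lambda>i. val s (slot d z i)) ` {..<d} = nth0 (ol (val s z)) ` {..<d}" for z
    by (rule image_cong) (simp_all add: val_slot[OF s])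
  have "val s ` set ?es = {val s z1, val s z2} \<union> (\<lambda>i. val s (slot d z1 i)) ` {..<d} \<union> (\<lambda>i. val s (slot d z2 i)) ` {..<d}"
    by (simp add: image_Un image_image atLeast0LessThan)
  then have es: "val s ` set ?es =
      {val s z1, val s z2} \<union> nth0 (ol (val s z1)) ` {..<d} \<union> nth0 (ol (val s z2)) ` {..<d}"
    unfolding sl .
  have "{x \<in> val s ` set ?es. ?P x} = barred (val s t1) (val s z1) (val s z2) (val s t2)"
    unfolding barred_def es
  proof (rule Collect_cong)
    fix x
    show "x \<in> {val s z1, val s z2} \<union> nth0 (ol (val s z1)) ` {..<d} \<union> nth0 (ol (val s z2)) ` {..<d} \<and> ?P x
      \<longleftrightarrow> x \<in> {val s z1, val s z2} \<union> set (ol (val s z1)) \<union> set (ol (val s z2)) \<and> ?P x"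
    proof (cases "?P x")
      case True
      show ?thesis unfolding Un_iff im[OF True] ..
    next
      case False
      then show ?thesis by (simp only: simp_thms)
    qed
  qed
  moreover have "val s (barred_exp d t1 z1 z2 t2) = card {x \<in> val s ` set ?es. ?P x}"
    unfolding barred_exp_def
  proof (rule val_count_distinct)
    fix e
    show "val s (mult_exp (mem_exp d t1 e) (mult_exp (mem_exp d t2 e)
         (mult_exp (not_exp (mem_exp d z1 e)) (not_exp (mem_exp d z2 e))))) \<noteq> 0 \<longleftrightarrow> ?P (val s e)"
      using val_mem_ol[OF s nz(1), of e] val_mem_ol[OF s nz(2), of e]
        val_mem_ol[OF s nz(3), of e] val_mem_ol[OF s nz(4), of e] by auto
  qed
  ultimately show ?thesis by simp
qed

definition good :: "nat \<Rightarrow> nat \<Rightarrow> nat \<Rightarrow> nat \<Rightarrow> nat \<Rightarrow> bool" where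
  "good k t1 z1 z2 t2 \<longleftrightarrow> path_pattern k n E t1 z1 z2 t2 \<and> (\<exists>s. closer t1 z1 z2 t2 s)"

text \<open>The pattern guarantees that all four names are nonzero, and only then are the table
  entries meaningful. Without the pattern the product is 0, whatever the comparison of counts
  yields.\<close>

lemma val_test_exp:
  assumes s: "ready s" and k: "3 \<le> k" "k \<le> 5"
    and le: "val s t1 \<le> n" "val s t2 \<le> n" "val s z1 \<le> n + 1" "val s z2 \<le> n + 1"
    and z: "k = 3 \<Longrightarrow> val s z1 = n + 1 \<and> val s z2 = n + 1"
  shows "val s (test_exp k d t1 z1 z2 t2) \<noteq> 0 \<longleftrightarrow> good k (val s t1) (val s z1) (val s z2) (val s t2)"
proof -
  let ?P = "path_pattern k n E (val s t1) (val s z1) (val s z2) (val s t2)"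
  have k: "k = 3 \<or> k = 4 \<or> k = 5" using k by linarith
  have le': "val s t1 \<le> n + 1" "val s t2 \<le> n + 1" using le by simp_all
  note adj = val_adj_exp[OF s le'(1) le'(2)] val_adj_exp[OF s le'(1) le(3)] val_adj_exp[OF s le'(1) le(4)]
    val_adj_exp[OF s le(3) le'(2)] val_adj_exp[OF s le(3,4)] val_adj_exp[OF s le(4) le'(2)]
  have pattern: "val s (pattern_exp k t1 z1 z2 t2) \<noteq> 0 \<longleftrightarrow> ?P"
    using k z unfolding pattern_exp_def path_pattern_def
    by (elim disjE) (auto simp: adj)
  show ?thesis
  proof (cases ?P)
    case True
    then have "val s t1 \<in> {1..n}" "val s t2 \<in> {1..n}" "val s z1 \<in> {1..n+1}" "val s z2 \<in> {1..n+1}"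
      using k E_verts by (fastforce simp: path_pattern_def split: if_splits)+
    then have V: "val s t1 \<in> {1..n+1}" "val s t2 \<in> {1..n+1}" "val s z1 \<in> {1..n+1}" "val s z2 \<in> {1..n+1}"
      by simp_all
    then have nz: "val s t1 \<noteq> 0" "val s z1 \<noteq> 0" "val s z2 \<noteq> 0" "val s t2 \<noteq> 0" by simp_all
    have "val s (Bin Less (add_exp (add_exp (joint_exp t1 t2 z1 z1) (joint_exp t1 t2 z2 z2)) (barred_exp d t1 z1 z2 t2))
        (add_exp (joint_exp t1 t2 t2 t2) (joint_exp t1 t2 z1 z2))) \<noteq> 0 \<longleftrightarrow>
        (\<exists>x. closer (val s t1) (val s z1) (val s z2) (val s t2) x)"
      unfolding ex_closer_iff
      by (simp add: val_joint_exp[OF s V(1,2,3,3)] val_joint_exp[OF s V(1,2,4,4)]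
          val_joint_exp[OF s V(1,2,2,2)] val_joint_exp[OF s V(1,2,3,4)] val_barred_exp[OF s nz])
    with True pattern show ?thesis by (simp add: test_exp_def good_def)
  next
    case False
    with pattern show ?thesis by (simp add: test_exp_def good_def)
  qed
qed

definition hop_val :: "nat \<Rightarrow> nat \<Rightarrow> nat" where
  "hop_val i x = (if i = d then x else nth0 (ol x) i)"

definition reach_val :: "nat \<Rightarrow> route \<Rightarrow> nat" where
  "reach_val x = (\<lambda>(i, j, l). hop_val l (hop_val j (hop_val i x)))"

definition mid_val :: "nat \<Rightarrow> nat \<Rightarrow> route \<Rightarrow> nat" where
  "mid_val k x q = (if k = 3 then n + 1 else reach_val x q)"

lemma hop_val_le: "x \<le> n \<Longrightarrow> hop_val i x \<le> n"
  using nth0_ol_le by (simp add: hop_val_def)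

lemma reach_val_le: "x \<le> n \<Longrightarrow> reach_val x q \<le> n"
  by (auto simp: reach_val_def hop_val_le split: prod.splits)

lemma mid_val_le: "x \<le> n \<Longrightarrow> mid_val k x q \<le> n + 1"
  using reach_val_le[of x q] by (simp add: mid_val_def)

lemma val_hop_exp: "ready s \<Longrightarrow> i \<le> d \<Longrightarrow> val s (hop_exp d i e) = hop_val i (val s e)"
  by (simp add: hop_exp_def hop_val_def val_slot)

lemma val_reach_exp: "ready s \<Longrightarrow> q \<in> set (routes d) \<Longrightarrow> val s (reach_exp d e q) = reach_val (val s e) q"
  by (auto simp: reach_exp_def reach_val_def routes_def val_hop_exp)

lemma val_mid_exp: "ready s \<Longrightarrow> q \<in> set (routes d) \<Longrightarrow> val s (mid_exp k d e q) = mid_val k (val s e) q"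
  by (simp add: mid_exp_def mid_val_def val_reach_exp) (simp add: ready_def)

lemma ex_reach_val:
  assumes "reach v w" "v \<in> {1..n}"
  shows "\<exists>q \<in> set (routes d). reach_val v q = w"
proof -
  have hop: "\<exists>i \<le> d. hop_val i a = b" if "hop a b" for a b
  proof (cases "b = a")
    case False
    with that have b: "b \<in> set (ol a)" by (simp add: hop_def)
    then have "b \<noteq> 0" using ol_set by fastforce
    with b nth0_mem[OF ol_length, of b a] obtain i where "i < d" "nth0 (ol a) i = b" by auto
    then show ?thesis by (intro exI[of _ i]) (simp add: hop_val_def)
  qed (auto simp: hop_val_def)
  from assms(1) obtain a b where "hop v a" "hop a b" "hop b w" by (auto simp: reach_def)
  with hop obtain i j l where "i \<le> d" "j \<le> d" "l \<le> d" "hop_val l (hop_val j (hop_val i v)) = w"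
    by metis
  then show ?thesis
    by (intro bexI[of _ "(i, j, l)"]) (auto simp: reach_val_def routes_def)
qed

definition good_route :: "nat \<Rightarrow> nat \<Rightarrow> route \<times> route \<times> route \<times> route \<Rightarrow> bool" where
  "good_route k v = (\<lambda>(q1, q2, q3, q4).
     good k (reach_val v q1) (mid_val k v q2) (mid_val k v q3) (reach_val v q4))"

lemma reachable_cycle_good_route:
  assumes "reachable_cycle k"
  obtains v x where "v < n" "x \<in> set (quads (routes d))" "good_route k (Suc v) x"
proof -
  from assms obtain v t1 z1 z2 t2 where v: "v \<in> {1..n}" "reach v t1" "reach v t2"
    "k \<noteq> 3 \<Longrightarrow> reach v z1 \<and> reach v z2" and P: "path_pattern k n E t1 z1 z2 t2" "\<exists>s. closer t1 z1 z2 t2 s"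
    unfolding reachable_cycle_def by blast
  obtain q1 q4 where q14: "q1 \<in> set (routes d)" "reach_val v q1 = t1" "q4 \<in> set (routes d)" "reach_val v q4 = t2"
    using ex_reach_val[OF v(2,1)] ex_reach_val[OF v(3,1)] by blast
  have mid: "\<exists>q \<in> set (routes d). mid_val k v q = z" if "k \<noteq> 3 \<Longrightarrow> reach v z" "k = 3 \<Longrightarrow> z = n + 1" for z
  proof (cases "k = 3")
    case True
    with that q14(1) show ?thesis by (intro bexI[of _ q1]) (simp_all add: mid_val_def)
  next
    case False
    with ex_reach_val[OF that(1)[OF False] v(1)] show ?thesis by (simp add: mid_val_def)
  qed
  have "k = 3 \<Longrightarrow> z1 = n + 1" "k = 3 \<Longrightarrow> z2 = n + 1" using P(1) by (simp_all add: path_pattern_def)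
  then obtain q2 q3 where "q2 \<in> set (routes d)" "mid_val k v q2 = z1" "q3 \<in> set (routes d)" "mid_val k v q3 = z2"
    using mid[of z1] mid[of z2] v(4) by blast
  with q14 v(1) P show ?thesis
    by (intro that[of "v - 1" "(q1, q2, q3, q4)"]) (auto simp: good_route_def good_def set_quads)
qed

text \<open>The bounds hold also before the first success, when the registers are 0; they keep the
  later scan within the specified part of the matrix.\<close>

definition found_inv :: "nat \<Rightarrow> state \<Rightarrow> bool" where
  "found_inv k s \<longleftrightarrow> reg s 12 \<le> 1 \<and> (reg s 12 = 1 \<longrightarrow> good k (reg s 13) (reg s 14) (reg s 15) (reg s 16)) \<and>
     reg s 13 \<le> n + 1 \<and> reg s 14 \<le> n + 1 \<and> reg s 15 \<le> n + 1 \<and> reg s 16 \<le> n + 1"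

lemma run_search_cmd:
  assumes s: "ready s" "reg s 11 = v" "v < n" and k: "3 \<le> k" "k \<le> 5"
    and x: "x = (q1, q2, q3, q4)" "x \<in> set (quads (routes d))"
  shows "run (search_cmd k d x) s = (if good_route k (Suc v) x then
     s\<lparr>reg := (reg s)(13 := reach_val (Suc v) q1, 14 := mid_val k (Suc v) q2,
        15 := mid_val k (Suc v) q3, 16 := reach_val (Suc v) q4, 12 := 1)\<rparr> else s)"
proof -
  let ?v = "add_exp (Reg 11) (Const 1)"
  have q: "q1 \<in> set (routes d)" "q2 \<in> set (routes d)" "q3 \<in> set (routes d)" "q4 \<in> set (routes d)"
    using x by (simp_all add: set_quads)
  have val: "val s' (reach_exp d ?v q) = reach_val (Suc v) q" "val s' (mid_exp k d ?v q) = mid_val k (Suc v) q"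
    if "q \<in> set (routes d)" "arr s' = arr s" "reg s' 0 = reg s 0" "reg s' 11 = v" for s' q
  proof -
    have "ready s'" by (rule ready_cong[OF s(1) that(3,2)])
    with val_reach_exp val_mid_exp that show "val s' (reach_exp d ?v q) = reach_val (Suc v) q"
      "val s' (mid_exp k d ?v q) = mid_val k (Suc v) q" by simp_all
  qed
  let ?t = "test_exp k d (reach_exp d ?v q1) (mid_exp k d ?v q2) (mid_exp k d ?v q3) (reach_exp d ?v q4)"
  have vs: "val s (reach_exp d ?v q1) = reach_val (Suc v) q1" "val s (mid_exp k d ?v q2) = mid_val k (Suc v) q2"
    "val s (mid_exp k d ?v q3) = mid_val k (Suc v) q3" "val s (reach_exp d ?v q4) = reach_val (Suc v) q4"
    using val q s(2) by simp_all
  have "val s ?t \<noteq> 0 \<longleftrightarrow> good k (reach_val (Suc v) q1) (mid_val k (Suc v) q2) (mid_val k (Suc v) q3) (reach_val (Suc v) q4)"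
    unfolding vs[symmetric]
  proof (rule val_test_exp[OF s(1) k])
    show "val s (mid_exp k d ?v q2) = n + 1 \<and> val s (mid_exp k d ?v q3) = n + 1" if "k = 3"
      unfolding vs using that by (simp add: mid_val_def)
  qed (use s(3) in \<open>simp_all only: vs reach_val_le mid_val_le Suc_le_eq\<close>)
  then have "val s ?t \<noteq> 0 \<longleftrightarrow> good_route k (Suc v) x"
    by (simp only: x(1) good_route_def prod.case)
  then show ?thesis
    by (simp add: x(1) search_cmd_def Let_def val q s(2) del: val.simps(4) One_nat_def)
qed

lemma run_search_cmds:
  assumes "ready s" "reg s 11 = v" "v < n" "3 \<le> k" "k \<le> 5" "set xs \<subseteq> set (quads (routes d))" "found_inv k s"
  shows "let s' = run (seqs (map (search_cmd k d) xs)) s in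
     arr s' = arr s \<and> reg s' 0 = reg s 0 \<and> reg s' 11 = v \<and> found_inv k s' \<and>
     (reg s 12 = 1 \<or> (\<exists>x \<in> set xs. good_route k (Suc v) x) \<longrightarrow> reg s' 12 = 1)"
  using assms
proof (induction xs arbitrary: s)
  case (Cons x xs)
  obtain q1 q2 q3 q4 where x: "x = (q1, q2, q3, q4)" by (cases x) auto
  let ?s = "run (search_cmd k d x) s"
  have run: "?s = (if good_route k (Suc v) x then
     s\<lparr>reg := (reg s)(13 := reach_val (Suc v) q1, 14 := mid_val k (Suc v) q2,
        15 := mid_val k (Suc v) q3, 16 := reach_val (Suc v) q4, 12 := 1)\<rparr> else s)"
    by (rule run_search_cmd) (use Cons.prems x in simp_all)
  have 1: "arr ?s = arr s" "reg ?s 0 = reg s 0" "reg ?s 11 = v"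
    using Cons.prems(2) unfolding run by simp_all
  have 2: "reg ?s 12 = (if good_route k (Suc v) x then 1 else reg s 12)"
    unfolding run by simp
  have 3: "found_inv k ?s"
  proof (cases "good_route k (Suc v) x")
    case True
    have "reach_val (Suc v) q \<le> n + 1" "mid_val k (Suc v) q \<le> n + 1" for q
      using reach_val_le[of "Suc v" q] mid_val_le[of "Suc v" k q] Cons.prems(3) by simp_all
    moreover have "?s = s\<lparr>reg := (reg s)(13 := reach_val (Suc v) q1, 14 := mid_val k (Suc v) q2,
        15 := mid_val k (Suc v) q3, 16 := reach_val (Suc v) q4, 12 := 1)\<rparr>"
      using run True by simp
    moreover have "good k (reach_val (Suc v) q1) (mid_val k (Suc v) q2) (mid_val k (Suc v) q3) (reach_val (Suc v) q4)"
      using True unfolding good_route_def x by simp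
    ultimately show ?thesis unfolding found_inv_def by simp
  qed (use Cons.prems in \<open>simp add: run\<close>)
  have "ready ?s" by (rule ready_cong[OF Cons.prems(1) 1(2,1)])
  from Cons.IH[OF this 1(3) Cons.prems(3,4,5) _ 3] Cons.prems(6) 1 2
  show ?case by (auto simp: Let_def)
qed (simp add: Let_def)

definition searched :: "nat \<Rightarrow> state \<Rightarrow> bool" where
  "searched k s \<longleftrightarrow> common s \<and> fresh 8 17 s \<and> ready s \<and> found_inv k s \<and> (reachable_cycle k \<longrightarrow> reg s 12 = 1)"

lemma reaches_searched:
  assumes k: "3 \<le> k" "k \<le> 5" and W: "X ^ growth (search_loop k d) < W"
  shows "reaches W (search_loop k d) ((n + 1) * ccost (search_loop k d)) counted (searched k)"
  unfolding reaches_def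
proof (intro allI impI)
  fix s0 assume "counted s0"
  then have c0: "common s0" "fresh 8 11 s0" "ready s0"
    by (simp_all add: counted_def ready_def common_def)
  have lf: "loopfree (search_body k d)" "consts_le X (search_loop k d)"
    using X_ge(2,5) by (auto simp: search_body_def loopfree_seqs consts_le_seqs consts_le_search_cmd loopfree_search_cmd)
  have wr: "written_regs (search_body k d) \<subseteq> {11, 12, 13, 14, 15, 16}" "written_arrs (search_body k d) = {}"
    by (auto simp: search_body_def written_regs_seqs written_arrs_seqs search_cmd_def Let_def)
  let ?b = "Bin Less (Reg 11) (Reg 0)"
  define I where "I v s \<longleftrightarrow> reg s 11 = v \<and> v \<le> n \<and> found_inv k s \<and>
      (\<forall>u < v. \<forall>x \<in> set (quads (routes d)). good_route k (Suc u) x \<longrightarrow> reg s 12 = 1)"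
    for v and s :: state
  have "\<exists>t j s. exec W (search_loop k d) s0 t s \<and> t \<le> (n + 1) * ccost (search_loop k d) \<and>
    I j s \<and> val s ?b = 0 \<and> frame (search_body k d) s0 s \<and> bounded X s"
  proof (rule exec_while[OF lf X_ge(5) W])
    show "I 0 s0" by (simp add: I_def found_inv_def freshD[OF c0(2)])
  next
    fix v s assume I: "I v s" "frame (search_body k d) s0 s" "val s ?b \<noteq> 0"
    have "arr s = arr s0" using frame_arr[OF I(2)] wr(2) by auto
    moreover have "reg s 0 = reg s0 0" by (rule frame_reg[OF I(2)]) (use wr(1) in auto)
    ultimately have s: "ready s" "reg s 0 = n"
      using ready_cong[OF c0(3)] c0(1) by (auto simp: common_def)
    have v: "v < n" "reg s 11 = v" using I s(2) by (auto simp: I_def split: if_splits)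
    let ?xs = "quads (routes d)"
    let ?s = "run (seqs (map (search_cmd k d) ?xs)) s"
    have r: "arr ?s = arr s" "reg ?s 0 = reg s 0" "reg ?s 11 = v" "found_inv k ?s"
      "reg s 12 = 1 \<or> (\<exists>x \<in> set ?xs. good_route k (Suc v) x) \<longrightarrow> reg ?s 12 = 1"
      using run_search_cmds[OF s(1) v(2,1) k order.refl] I(1) unfolding Let_def I_def by blast+
    have run: "run (search_body k d) s = ?s\<lparr>reg := (reg ?s)(11 := Suc v)\<rparr>"
      using r(3) by (simp add: search_body_def)
    have "found_inv k (run (search_body k d) s)"
      using r(4) unfolding run by (simp add: found_inv_def)
    moreover have "reg (run (search_body k d) s) 12 = 1"
      if "u < Suc v" "x \<in> set ?xs" "good_route k (Suc u) x" for u x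
      using that r(5) I(1) unfolding run I_def by (cases "u = v") auto
    moreover have "reg (run (search_body k d) s) 11 = Suc v" unfolding run by simp
    ultimately show "v < n \<and> I (Suc v) (run (search_body k d) s)"
      using v unfolding I_def by auto
  next
    fix v s assume "I v s"
    then have "reg s x \<le> X" if "x \<in> {11, 12, 13, 14, 15, 16}" for x
      using that X_ge(1) by (auto simp: I_def found_inv_def)
    then show "(\<forall>x \<in> written_regs (search_body k d). reg s x \<le> X) \<and> 
        (\<forall>a \<in> written_arrs (search_body k d). \<forall>i. arr s a i \<le> X)"
      using wr by blast
  qed (use c0 in \<open>simp add: common_def\<close>)
  then obtain t v s where s: "exec W (search_loop k d) s0 t s" "t \<le> (n + 1) * ccost (search_loop k d)"
    "I v s" "val s ?b = 0" "frame (search_body k d) s0 s" "bounded X s" by blast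
  have c: "common s"
    by (rule common_frame[OF c0(1) s(5,6)]) (use wr in auto)
  have "fresh 8 17 s"
    by (rule fresh_frame[OF s(5) c0(2)]) (use wr in auto)
  moreover have "arr s = arr s0" using frame_arr[OF s(5)] wr(2) by auto
  then have "ready s" using c c0(1) by (intro ready_cong[OF c0(3)]) (simp_all add: common_def)
  moreover have "v = n" using s(3,4) c by (auto simp: I_def common_def split: if_splits)
  then have "reg s 12 = 1" if "reachable_cycle k"
    using reachable_cycle_good_route[OF that] s(3) unfolding I_def by metis
  ultimately have "searched k s"
    using c s(3) by (simp add: searched_def I_def)
  with s show "\<exists>t s. exec W (search_loop k d) s0 t s \<and> t \<le> (n + 1) * ccost (search_loop k d) \<and> searched k s"
    by blast
qed

section \<open>Finding the closing vertex\<close>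

definition completes :: "state \<Rightarrow> nat \<Rightarrow> bool" where
  "completes s u \<longleftrightarrow> E u (reg s 13) \<and> E u (reg s 16) \<and> \<not> E u (reg s 14) \<and> \<not> E u (reg s 15) \<and>
     u \<noteq> reg s 14 \<and> u \<noteq> reg s 15"

definition scanned_all :: "nat \<Rightarrow> state \<Rightarrow> bool" where
  "scanned_all k s \<longleftrightarrow> bounded X s \<and> found_inv k s \<and> (reachable_cycle k \<longrightarrow> reg s 12 = 1) \<and>
     (reg s 12 = 1 \<longrightarrow> completes s (reg s 18))"

lemma reaches_scanned_all:
  assumes W: "X ^ growth scan_loop < W"
  shows "reaches W scan_loop ((n + 1) * ccost scan_loop) (searched k) (scanned_all k)"
  unfolding reaches_def
proof (intro allI impI)
  fix s0 assume s0: "searched k s0"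
  then have c0: "common s0" "fresh 8 17 s0" "ready s0" "found_inv k s0"
    by (simp_all add: searched_def)
  have lf: "loopfree scan_body" "consts_le X scan_loop"
    using X_ge(2,5) by (simp_all add: scan_body_def Let_def adj_exp_def)
  have wr: "written_regs scan_body = {17, 18}" "written_arrs scan_body = {}"
    by (auto simp: scan_body_def Let_def)
  let ?b = "Bin Less (Reg 17) (Reg 0)"
  \<comment> \<open>The scan changes neither the stored path nor the matrix, so candidates may be
    judged in the initial state \<open>s0\<close>.\<close>
  define I where "I v s \<longleftrightarrow> reg s 17 = v \<and> v \<le> n \<and> reg s 18 \<le> n \<and>
      ((\<exists>u < v. completes s0 (Suc u)) \<longrightarrow> completes s0 (reg s 18))" for v and s :: state
  have "\<exists>t j s. exec W scan_loop s0 t s \<and> t \<le> (n + 1) * ccost scan_loop \<and>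
    I j s \<and> val s ?b = 0 \<and> frame scan_body s0 s \<and> bounded X s"
  proof (rule exec_while[OF lf X_ge(5) W])
    show "I 0 s0" by (simp add: I_def freshD[OF c0(2)])
  next
    fix v s assume I: "I v s" "frame scan_body s0 s" "val s ?b \<noteq> 0"
    have arr: "arr s = arr s0" using frame_arr[OF I(2)] wr(2) by auto
    have reg: "reg s 0 = reg s0 0" "reg s 13 = reg s0 13" "reg s 14 = reg s0 14"
      "reg s 15 = reg s0 15" "reg s 16 = reg s0 16"
      using frame_reg[OF I(2)] wr(1) by simp_all
    have s: "ready s" "reg s 0 = n"
      using ready_cong[OF c0(3) reg(1) arr] c0(1) reg(1) by (auto simp: common_def)
    have v: "v < n" "reg s 17 = v" using I s(2) by (auto simp: I_def split: if_splits)
    have le: "reg s 13 \<le> n + 1" "reg s 14 \<le> n + 1" "reg s 15 \<le> n + 1" "reg s 16 \<le> n + 1"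
      using c0(4) reg by (simp_all add: found_inv_def)
    have adj: "val s (adj_exp (add_exp (Reg 17) (Const 1)) (Reg x)) = of_bool (E (Suc v) (reg s x))"
      if "reg s x \<le> n + 1" for x
      using val_adj_exp[OF s(1), of "add_exp (Reg 17) (Const 1)" "Reg x"] v that by simp
    have "run scan_body s = s\<lparr>reg := (if completes s0 (Suc v) then (reg s)(18 := Suc v, 17 := Suc v)
        else (reg s)(17 := Suc v))\<rparr>"
      using v adj[OF le(1)] adj[OF le(2)] adj[OF le(3)] adj[OF le(4)]
      by (simp add: scan_body_def Let_def completes_def reg)
    then show "v < n \<and> I (Suc v) (run scan_body s)"
      using I(1) v by (auto simp: I_def less_Suc_eq)
  next
    fix v s assume "I v s"
    then show "(\<forall>x \<in> written_regs scan_body. reg s x \<le> X) \<and> (\<forall>a \<in> written_arrs scan_body. \<forall>i. arr s a i \<le> X)"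
      using X_ge(1) unfolding wr by (auto simp: I_def)
  qed (use c0 in \<open>simp add: common_def\<close>)
  then obtain t v s where s: "exec W scan_loop s0 t s" "t \<le> (n + 1) * ccost scan_loop"
    "I v s" "val s ?b = 0" "frame scan_body s0 s" "bounded X s" by blast
  have c: "common s"
    by (rule common_frame[OF c0(1) s(5,6)]) (use wr in auto)
  then have v: "v = n" using s(3,4) by (auto simp: I_def common_def split: if_splits)
  have reg: "reg s x = reg s0 x" if "x \<noteq> 17" "x \<noteq> 18" for x
    using frame_reg[OF s(5)] wr(1) that by simp
  have f: "found_inv k s" using c0(4) by (simp add: found_inv_def reg)
  have "completes s (reg s 18)" if "reg s 12 = 1"
  proof -
    \<comment> \<open>The test on the path has certified that a closing vertex exists, so a scan
      over all vertices cannot miss.\<close>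
    from that f obtain u where u: "closer (reg s 13) (reg s 14) (reg s 15) (reg s 16) u"
      by (auto simp: found_inv_def good_def)
    then have "completes s0 u" "u \<in> {1..n}"
      using E_verts[of u] by (auto simp: completes_def closer_def E_def reg)
    then have "\<exists>u' < v. completes s0 (Suc u')"
      using v by (intro exI[of _ "u - 1"]) auto
    with s(3) have "completes s0 (reg s 18)" by (simp add: I_def)
    then show ?thesis by (simp add: completes_def reg)
  qed
  with s0 f s(6) have "scanned_all k s" by (simp add: scanned_all_def searched_def reg)
  with s show "\<exists>t s. exec W scan_loop s0 t s \<and> t \<le> (n + 1) * ccost scan_loop \<and> scanned_all k s"
    by blast
qed

end

section \<open>The complete program\<close>

definition program :: "nat \<Rightarrow> nat \<Rightarrow> com" where
  "program k d = Seq (init_loop d) (Seq (peel_loop d) (Seq (arcs_loop d) (Seq (count_loop d)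
     (Seq (search_loop k d) (Seq scan_loop emit)))))"

lemma reaches_conseq:
  "reaches W c B P Q \<Longrightarrow> (\<And>s. P' s \<Longrightarrow> P s) \<Longrightarrow> (\<And>s. Q s \<Longrightarrow> Q' s) \<Longrightarrow> reaches W c B P' Q'"
  unfolding reaches_def by blast

context degenerate_lists
begin

lemma input_initial: "common (input_state L) \<and> fresh 2 1 (input_state L)"
proof -
  have offset: "length (concat (take v L)) \<le> X" for v
  proof -
    have "length (concat (take v L)) \<le> length (concat L)"
      by (metis append_take_drop_id concat_append le_add1 length_append)
    also have "\<dots> = (\<Sum>a < n. length (L ! a))"
      by (simp add: length_concat sum_list_sum_nth atLeast0LessThan)
    also have "\<dots> \<le> (\<Sum>a < n. n)" by (intro sum_mono length_L_le) simp
    also have "\<dots> \<le> X" using X_ge(3) by simp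
    finally show ?thesis .
  qed
  have "concat L ! j \<le> X" if "j < length (concat L)" for j
  proof -
    have "concat L ! j \<in> set (concat L)" using that by (rule nth_mem)
    then obtain xs where "xs \<in> set L" "concat L ! j \<in> set xs" by auto
    then obtain a where "a < n" "concat L ! j \<in> set (L ! a)" by (metis in_set_conv_nth)
    with range_L X_ge(1) show ?thesis by fastforce
  qed
  with offset X_ge(1) show ?thesis
    by (auto simp: common_def fresh_def bounded_def input_state_def)
qed

text \<open>Each edge occurs in two lists and leads forward from exactly one of its ends, and at
  most \<open>d\<close> edges lead forward from a vertex. This gives \<open>2 * d * n\<close> list
  entries; the remaining \<open>n\<close> is the second summand of \<open>work\<close>.\<close>

lemma elimination_work:
  assumes "elimination p"
  shows "work \<le> (2 * d + 1) * n"
proof -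
  let ?A = "\<lambda>u w. w \<in> set (L ! u) \<and> p u < p w"
  have "length (L ! u) = (\<Sum>w < n. of_bool (?A u w)) + (\<Sum>w < n. of_bool (?A w u))" if u: "u < n" for u
  proof -
    have "p u \<noteq> p w" if "w \<in> set (L ! u)" for w
      using assms range_L[OF u that] u by (auto simp: elimination_def dest: inj_onD)
    then have "set (L ! u) = {w \<in> set (L ! u). p u < p w} \<union> {w \<in> set (L ! u). p w < p u}" by fastforce
    also have "card \<dots> = card {w \<in> set (L ! u). p u < p w} + card {w \<in> set (L ! u). p w < p u}"
      by (rule card_Un_disjoint) auto
    also have "{w \<in> set (L ! u). p u < p w} = {w \<in> {..<n}. ?A u w}"
      using range_L[OF u] by auto
    also have "{w \<in> set (L ! u). p w < p u} = {w \<in> {..<n}. ?A w u}"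
      using range_L[OF u] sym_L[OF u] sym_L[of _ u] by auto
    finally show ?thesis
      by (simp add: length_L[OF u] of_bool_def sum.If_cases Int_def)
  qed
  then have "(\<Sum>u < n. length (L ! u)) = (\<Sum>u < n. \<Sum>w < n. of_bool (?A u w)) + (\<Sum>u < n. \<Sum>w < n. of_bool (?A w u))"
    by (simp add: sum.distrib del: sum_of_bool_eq)
  \<comment> \<open>Exchanging the sums turns the backward entries of all lists into forward
    entries.\<close>
  also have "(\<Sum>u < n. \<Sum>w < n. of_bool (?A w u)) = (\<Sum>u < n. \<Sum>w < n. of_bool (?A u w) :: nat)"
    by (rule sum.swap)
  also have "(\<Sum>u < n. \<Sum>w < n. of_bool (?A u w) :: nat) \<le> (\<Sum>u < n. d)"
  proof (rule sum_mono)
    fix u assume "u \<in> {..<n}"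
    then have u: "u < n" by simp
    have "(\<Sum>w < n. of_bool (?A u w) :: nat) = card {w \<in> {..<n}. ?A u w}"
      by (simp add: of_bool_def sum.If_cases Int_def)
    also have "{w \<in> {..<n}. ?A u w} = {w \<in> set (L ! u). p u < p w}"
      using range_L[OF u] by auto
    also have "card \<dots> \<le> d" using assms u by (simp add: elimination_def)
    finally show "(\<Sum>w < n. of_bool (?A u w) :: nat) \<le> d" .
  qed
  finally show ?thesis by (simp add: work_def algebra_simps)
qed

text \<open>The existence of an elimination order is read off a run with a sufficiently large word size.\<close>

lemma work_le: "work \<le> (2 * d + 1) * n"
proof -
  let ?W = "X ^ growth (init_loop d) + X ^ growth (peel_loop d) + 1"
  have "reaches ?W (Seq (init_loop d) (peel_loop d)) ((n + 1) * ccost (init_loop d) + (work + 1) * ccost (peel_loop d) + 1)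
      (\<lambda>s. common s \<and> fresh 2 1 s) peeled"
    by (intro reaches_seq[OF reaches_queued reaches_peeled]) linarith+
  with input_initial obtain s where "peeled s" unfolding reaches_def by blast
  then show ?thesis using elimination_work by (auto simp: peeled_def)
qed

lemma reaches_emitted:
  assumes W: "X ^ growth emit < W"
  shows "reaches W emit (ccost emit) (\<lambda>s. bounded X s \<and> P s)
    (\<lambda>s'. \<exists>s. P s \<and> reg s' 0 = reg s 12 \<and>
       (\<forall>i < 5. arr s' 0 i = [reg s 13, reg s 16, reg s 18, reg s 14, reg s 15] ! i - 1))"
  unfolding reaches_def
proof (intro allI impI, elim conjE)
  fix s assume s: "bounded X s" "P s"
  \<comment> \<open>The largest literal in \<open>emit\<close> is the cell index 4, whence the bound
    4 on \<open>X\<close> from below.\<close>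
  have "loopfree emit" "consts_le X emit"
    using X_ge(6) by (simp_all add: emit_def Let_def)
  with exec_loopfree[OF _ s(1) X_ge(5) _ W] obtain t where
    t: "t \<le> ccost emit" "exec W emit s t (run emit s)" by blast
  have "arr (run emit s) 0 i = [reg s 13, reg s 16, reg s 18, reg s 14, reg s 15] ! i - 1" if "i < 5" for i
  proof -
    have "i \<in> {0, 1, 2, 3, 4}" using that by auto
    then show ?thesis by (auto simp: emit_def Let_def)
  qed
  moreover have "reg (run emit s) 0 = reg s 12" by (simp add: emit_def Let_def)
  ultimately show "\<exists>t s'. exec W emit s t s' \<and> t \<le> ccost emit \<and> (\<exists>s. P s \<and> reg s' 0 = reg s 12 \<and>
       (\<forall>i < 5. arr s' 0 i = [reg s 13, reg s 16, reg s 18, reg s 14, reg s 15] ! i - 1))"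
    using s(2) t by blast
qed

end

text \<open>If the flag is set, \<open>closer_cycle\<close> joins the stored path and the scanned
  vertex to a cycle. If not, the search has refuted \<open>reachable_cycle k\<close>, which any
  induced cycle would imply by \<open>induced_cycle_reachable\<close>.\<close>

lemma (in eliminated) emitted_finds:
  assumes k: "3 \<le> k" "k \<le> 5" and G: "pair_graph G" "adjacency_lists L G"
    and s: "scanned_all k s" and s': "reg s' 0 = reg s 12"
      "\<forall>i < 5. arr s' 0 i = [reg s 13, reg s 16, reg s 18, reg s 14, reg s 15] ! i - 1"
  shows "finds_induced_cycle k G s'"
proof -
  have V: "pverts G = {..<n}" and A: "(u, w) \<in> parcs G \<longleftrightarrow> w \<in> set (L ! u)" if "u < n" for u w
    using G(2) that by (auto simp: adjacency_lists_def)
  have V: "pverts G = {..<n}" using G(2) by (simp add: adjacency_lists_def)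
  have AE: "E (Suc u) (Suc w) \<longleftrightarrow> (u, w) \<in> parcs G" if "u < n" "w < n" for u w
    using E_Suc_iff[OF that] A[OF that(1)] by simp
  show ?thesis
  proof (cases "reg s 12 = 1")
    case True
    let ?xs = "[reg s 13, reg s 16, reg s 18, reg s 14, reg s 15]"
    from s True have P: "path_pattern k n E (reg s 13) (reg s 14) (reg s 15) (reg s 16)"
      and C: "completes s (reg s 18)"
      by (auto simp: scanned_all_def found_inv_def good_def)
    obtain c where c: "inj_on c {..<k}" "c ` {..<k} = (\<lambda>i. ?xs ! i) ` {..<k}" "c ` {..<k} \<subseteq> {1..n}"
      "\<And>i j. i < k \<Longrightarrow> j < k \<Longrightarrow> E (c i) (c j) \<longleftrightarrow> cyc k i j"
      by (rule closer_cycle[OF k P]) (use C in \<open>auto simp: completes_def\<close>)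
    let ?c = "\<lambda>i. c i - 1"
    have c': "Suc (?c i) = c i" "?c i < n" if "i < k" for i
      using c(3) that by (force simp: image_subset_iff)+
    have "induced_cycle k G (?c ` {..<k})"
    proof (rule induced_cycleI[OF G(1)])
      show "inj_on ?c {..<k}"
      proof (rule inj_onI)
        fix i j assume ij: "i \<in> {..<k}" "j \<in> {..<k}" "?c i = ?c j"
        then have "c i = c j" using c'(1)[of i] c'(1)[of j] by simp
        with ij c(1) show "i = j" by (auto dest: inj_onD)
      qed
      show "?c ` {..<k} \<subseteq> pverts G" using c'(2) V by auto
      show "(?c i, ?c j) \<in> parcs G \<longleftrightarrow> cyc k i j" if "i < k" "j < k" for i j
        using AE[OF c'(2)[OF that(1)] c'(2)[OF that(2)]] c(4)[OF that] c'(1) that by simp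
    qed
    also have "?c ` {..<k} = (\<lambda>x. x - 1) ` (\<lambda>i. ?xs ! i) ` {..<k}"
      unfolding c(2)[symmetric] by (simp add: image_image)
    also have "\<dots> = arr s' 0 ` {..<k}"
      unfolding image_image using s'(2) k(2) by (intro image_cong) auto
    finally show ?thesis
      using True s'(1) by (auto simp: finds_induced_cycle_def)
  next
    case False
    then have 0: "reg s 12 = 0" "\<not> reachable_cycle k"
      using s by (auto simp: scanned_all_def found_inv_def)
    have "\<not> induced_cycle k G S" for S
    proof
      assume "induced_cycle k G S"
      then obtain c where c: "c ` {..<k} = S" "inj_on c {..<k}" "S \<subseteq> pverts G"
        "\<And>i j. i < k \<Longrightarrow> j < k \<Longrightarrow> (c i, c j) \<in> parcs G \<longleftrightarrow> cyc k i j"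
        using induced_cycleD[OF G(1)] by metis
      have cn: "c i < n" if "i < k" for i using c(1,3) V that by auto
      have "reachable_cycle k"
      proof (rule induced_cycle_reachable[OF k])
        show "inj_on (\<lambda>i. Suc (c i)) {..<k}" using c(2) by (auto simp: inj_on_def)
        show "E (Suc (c i)) (Suc (c j)) \<longleftrightarrow> cyc k i j" if "i < k" "j < k" for i j
          using AE[OF cn[OF that(1)] cn[OF that(2)]] c(4)[OF that] by simp
      qed
      with 0 show False by simp
    qed
    with 0 s'(1) show ?thesis by (simp add: finds_induced_cycle_def)
  qed
qed

section \<open>Total word size and running time\<close>

definition growth_bound :: "nat \<Rightarrow> nat \<Rightarrow> nat" where
  "growth_bound k d = growth (init_loop d) + growth (peel_loop d) + growth (arcs_loop d) +
     growth (count_loop d) + growth (search_loop k d) + growth scan_loop + growth emit"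

text \<open>The summand 6 pays for the six \<open>Seq\<close> nodes that join the seven pieces of
  the program.\<close>

definition time_factor :: "nat \<Rightarrow> nat \<Rightarrow> nat" where
  "time_factor k d = ccost (init_loop d) + ccost (peel_loop d) + ccost (arcs_loop d) +
     ccost (count_loop d) + ccost (search_loop k d) + ccost scan_loop + ccost emit + 6"

lemma (in eliminated) reaches_finds:
  assumes k: "3 \<le> k" "k \<le> 5" and G: "pair_graph G" "adjacency_lists L G"
    and W: "X ^ growth (count_loop d) < W" "X ^ growth (search_loop k d) < W"
      "X ^ growth scan_loop < W" "X ^ growth emit < W"
  shows "reaches W (Seq (count_loop d) (Seq (search_loop k d) (Seq scan_loop emit)))
    ((n + 1) * ccost (count_loop d) + ((n + 1) * ccost (search_loop k d) +
      ((n + 1) * ccost scan_loop + ccost emit + 1) + 1) + 1)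
    (\<lambda>s. common s \<and> fresh 7 10 s \<and> tables p ((!) L) s) (finds_induced_cycle k G)"
proof (intro reaches_seq[OF reaches_counted[OF W(1)] reaches_seq[OF reaches_searched[OF k W(2)]
      reaches_seq[OF reaches_scanned_all[OF W(3)]]]])
  show "reaches W emit (ccost emit) (scanned_all k) (finds_induced_cycle k G)"
  proof (rule reaches_conseq[OF reaches_emitted[OF W(4), where P = "scanned_all k"]])
    show "bounded X s \<and> scanned_all k s" if "scanned_all k s" for s
      using that by (simp add: scanned_all_def)
  qed (use emitted_finds[OF k G] in blast)
qed

context degenerate_lists
begin

lemma program_finds:
  assumes k: "3 \<le> k" "k \<le> 5" and G: "pair_graph G" "adjacency_lists L G"
    and W: "X ^ growth_bound k d < W"
  shows "\<exists>t s. exec W (program k d) (input_state L) t s \<and> t \<le> time_factor k d * ((2 * d + 1) * n + 1) \<and>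
    finds_induced_cycle k G s"
proof -
  have small: "X ^ g < W" if "g \<le> growth_bound k d" for g
  proof -
    have "X ^ g \<le> X ^ growth_bound k d" using that X_ge(5) by (intro power_increasing) auto
    with W show ?thesis by simp
  qed
  let ?B = "(n + 1) * ccost (count_loop d) + ((n + 1) * ccost (search_loop k d) +
      ((n + 1) * ccost scan_loop + ccost emit + 1) + 1) + 1"
  have tail: "reaches W (Seq (count_loop d) (Seq (search_loop k d) (Seq scan_loop emit))) ?B tabled (finds_induced_cycle k G)"
    unfolding reaches_def
  proof (intro allI impI)
    fix s assume "tabled s"
    then obtain p where p: "elimination p" and s: "common s \<and> fresh 7 10 s \<and> tables p ((!) L) s"
      by (auto simp: tabled_def)
    \<comment> \<open>The elimination order is produced by the run itself, so it can be fixed only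
      here, separately for each state left by the first three loops.\<close>
    interpret eliminated d L p by unfold_locales (rule p)
    have "reaches W (Seq (count_loop d) (Seq (search_loop k d) (Seq scan_loop emit))) ?B
        (\<lambda>s. common s \<and> fresh 7 10 s \<and> tables p ((!) L) s) (finds_induced_cycle k G)"
      by (rule reaches_finds[OF k G]) (rule small, simp add: growth_bound_def del: growth.simps)+
    with s show "\<exists>t s'. exec W (Seq (count_loop d) (Seq (search_loop k d) (Seq scan_loop emit))) s t s' \<and>
        t \<le> ?B \<and> finds_induced_cycle k G s'"
      unfolding reaches_def by blast
  qed
  have loops: "reaches W (init_loop d) ((n + 1) * ccost (init_loop d)) (\<lambda>s. common s \<and> fresh 2 1 s) queued"
    "reaches W (peel_loop d) ((work + 1) * ccost (peel_loop d)) queued peeled"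
    "reaches W (arcs_loop d) ((work + 1) * ccost (arcs_loop d)) peeled tabled"
    by (rule reaches_queued reaches_peeled reaches_tabled, rule small, simp add: growth_bound_def del: growth.simps)+
  have "reaches W (program k d)
      ((n + 1) * ccost (init_loop d) + ((work + 1) * ccost (peel_loop d) + ((work + 1) * ccost (arcs_loop d) + ?B + 1) + 1) + 1)
      (\<lambda>s. common s \<and> fresh 2 1 s) (finds_induced_cycle k G)"
    unfolding program_def
    by (rule reaches_seq[OF loops(1) reaches_seq[OF loops(2) reaches_seq[OF loops(3) tail]]])
  with input_initial obtain t s where ts: "exec W (program k d) (input_state L) t s" "finds_induced_cycle k G s"
    and t: "t \<le> (n + 1) * ccost (init_loop d) + ((work + 1) * ccost (peel_loop d) +
      ((work + 1) * ccost (arcs_loop d) + ?B + 1) + 1) + 1"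
    unfolding reaches_def by blast
  let ?m = "(2 * d + 1) * n + 1"
  \<comment> \<open>The number \<open>?m\<close> dominates the rounds of every loop including the
    final evaluation of its guard; being at least 1, it also absorbs the units for
    \<open>Seq\<close> and the cost of \<open>emit\<close>.\<close>
  have m: "work + 1 \<le> ?m" "n + 1 \<le> ?m" "1 \<le> ?m" using work_le by simp_all
  have "t \<le> ?m * ccost (init_loop d) + (?m * ccost (peel_loop d) + (?m * ccost (arcs_loop d) +
      (?m * ccost (count_loop d) + (?m * ccost (search_loop k d) + (?m * ccost scan_loop + ?m * ccost emit + ?m) + ?m) + ?m)
      + ?m) + ?m) + ?m"
    by (rule order.trans[OF t]) (intro add_mono mult_le_mono1 m; use m(3) in simp)
  also have "\<dots> = time_factor k d * ?m"
    unfolding time_factor_def by (simp only: algebra_simps)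
  finally show ?thesis using ts by blast
qed

end

text \<open>Arcs leaving \<open>v\<close> correspond to entries of \<open>L ! v\<close>, so the
  degree of \<open>v\<close> in the subgraph induced by \<open>S\<close> is the number of these
  entries in \<open>S\<close>.\<close>

lemma degenerate_listsI:
  assumes G: "pair_graph G" "degenerated d G" "adjacency_lists L G"
  shows "degenerate_lists d L"
proof
  interpret pair_graph G by (rule G(1))
  have V: "pverts G = {..<length L}" using G(3) by (simp add: adjacency_lists_def)
  have A: "set (L ! v) = {w. (v, w) \<in> parcs G}" "distinct (L ! v)" if "v < length L" for v
    using G(3) that by (simp_all add: adjacency_lists_def)
  show "distinct (L ! v)" if "v < length L" for v by (rule A(2)[OF that])
  show "w < length L \<and> w \<noteq> v" if "v < length L" "w \<in> set (L ! v)" for v w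
    using that A(1)[OF that(1)] V in_arcsD2[of v w] pair_no_loops[of "(v, w)"] by auto
  show "v \<in> set (L ! w)" if v: "v < length L" "w \<in> set (L ! v)" for v w
  proof -
    have vw: "(v, w) \<in> parcs G" using A(1)[OF v(1)] v(2) by auto
    then have "w < length L" using V in_arcsD2 by auto
    moreover have "(w, v) \<in> parcs G"
      using pair_sym_arcs vw by (auto simp: symmetric_def dest: symD)
    ultimately show ?thesis using A(1) by auto
  qed
  show "\<exists>v \<in> S. card (set (L ! v) \<inter> S) \<le> d" if S: "S \<subseteq> {..<length L}" "S \<noteq> {}" for S
  proof -
    from G(2) S V obtain v where v: "v \<in> S" "out_degree (with_proj G \<restriction> S) v \<le> d"
      unfolding degenerated_def by blast
    have "out_arcs (with_proj G \<restriction> S) v = Pair v ` (set (L ! v) \<inter> S)"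
      using v(1) S(1) A(1)[of v] by (auto simp: out_arcs_def)
    then have "out_degree (with_proj G \<restriction> S) v = card (set (L ! v) \<inter> S)"
      by (simp add: out_degree_def card_image inj_on_def)
    with v show ?thesis by auto
  qed
qed

theorem theorem6:
  fixes d k :: nat
  assumes "1 \<le> d" and "3 \<le> k" and "k \<le> 5"
  shows "\<exists>(P :: com) (c :: nat) (T :: nat \<Rightarrow> nat).
           (\<lambda>n. real (T n)) \<in> O(\<lambda>n. real n) \<and>
           (\<forall>n (G :: nat pair_pre_digraph) L.
              pair_graph G \<and> card (pverts G) = n \<and> degenerated d G \<and> adjacency_lists L G \<longrightarrow>
              (\<exists>t s. exec ((n + 2) ^ c) P (input_state L) t s \<and> t \<le> T n \<and>
                     finds_induced_cycle k G s))"
proof -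
  \<comment> \<open>Unfolding \<open>X\<close>, the words have to exceed
    \<open>(n + 2) ^ ((4 * d + 2) * growth_bound k d)\<close>; the additional 1 in the exponent
    makes the inequality strict.\<close>
  let ?K = "time_factor k d" and ?c = "(4 * d + 2) * growth_bound k d + 1"
  let ?T = "\<lambda>n. ?K * ((2 * d + 1) * n + 1)"
  have "(\<lambda>n. real (?T n)) \<in> O(\<lambda>n. real n)"
  proof (rule bigoI)
    show "\<forall>\<^sub>F n in sequentially. norm (real (?K * ((2 * d + 1) * n + 1))) \<le> real (?K * (2 * d + 2)) * norm (real n)"
      \<comment> \<open>For positive \<open>n\<close> the constant term is absorbed by one more
        multiple of \<open>n\<close>.\<close>
      using eventually_ge_at_top[of 1]
    proof eventually_elim
      case (elim n)
      then have "(2 * d + 1) * n + 1 \<le> (2 * d + 2) * n" by simp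
      then have "?K * ((2 * d + 1) * n + 1) \<le> ?K * (2 * d + 2) * n"
        by (simp only: mult.assoc mult_le_mono2)
      then show ?case by (simp only: norm_of_nat of_nat_mult[symmetric] of_nat_le_iff)
    qed
  qed
  moreover have "\<exists>t s. exec ((n + 2) ^ ?c) (program k d) (input_state L) t s \<and> t \<le> ?T n \<and> finds_induced_cycle k G s"
    if G: "pair_graph G" "card (pverts G) = n" "degenerated d G" "adjacency_lists L G"
    for n and G :: "nat pair_pre_digraph" and L
  proof -
    interpret degenerate_lists d L by (rule degenerate_listsI[OF G(1,3,4)])
    have n: "n = length L" using G(2,4) by (auto simp: adjacency_lists_def)
    have "X ^ growth_bound k d = (n + 2) ^ ((4 * d + 2) * growth_bound k d)"
      unfolding n X_def by (simp only: power_mult)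
    also have "\<dots> < (n + 2) ^ ?c" by (rule power_strict_increasing) simp_all
    finally show ?thesis
      using program_finds[OF assms(2,3) G(1,4)] unfolding n by blast
  qed
  ultimately show ?thesis
    by (intro exI[of _ "program k d"] exI[of _ ?c] exI[of _ ?T]) blast
qed

end
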